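(* Let $S$ be a $\mathrm{GL}_2(\mathbb{Z})$-invariant subset of $V_{\mathbb{Z}}$ defined by finitely many congruence conditions, and let $i\in\{0,1,2\}$. Then for every $\epsilon>0$, $$N(S\cap V_{\mathbb{Z}}^{(i)};X)=N(V_{\mathbb{Z}}^{(i)};X)\prod_p\mu_p(S)+O(X^{3/4+\epsilon}),$$ where the implied constant depends only on $S$ (and $\epsilon$).
   Context: $V_{\mathbb{Z}}$ is the set of integral binary quartic forms $f=ax^4+bx^3y+cx^2y^2+dxy^3+ey^4$, $a,\dots,e\in\mathbb{Z}$, with $\mathrm{GL}_2(\mathbb{Z})$ acting by $\gamma\cdot f(x,y)=f((x,y)\gamma)$. $V_{\mathbb{Z}}^{(i)}$ is the set of $f\in V_\mathbb{Z}$ with exactly $4-2i$ real roots in $\mathbb{P}^1(\mathbb{R})$. Invariants: $I(f)=12ae-3bd+c^2$, $J(f)=72ace+9bcd-27ad^2-27eb^2-2c^3$; height $H(f)=\max\{|I(f)|^3,J(f)^2/4\}$. For a $\mathrm{GL}_2(\mathbb{Z})$-invariant set $S$, $N(S;X)$ is the number of $\mathrm{GL}_2(\mathbb{Z})$-equivalence classes of elements $f\in S$ irreducible over $\mathbb{Q}$ with $H(f)<X$. $\mu_p(S)$ is the measure of the closure of $S$ in $V_{\mathbb{Z}_p}\cong\mathbb{Z}_p^5$, with respect to the additive Haar measure normalized to give $V_{\mathbb{Z}_p}$ measure $1$.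
   Formalization: "Defined by finitely many congruence conditions" means a finite intersection of conditions, each modulo a prime power; for a condition modulo a composite number that ties primes together (e.g. exactly one of 2, 3 divides the discriminant) the product formula fails. *)

theory Defs
  imports "HOL-Probability.Probability" "HOL-Computational_Algebra.Polynomial" "HOL-Computational_Algebra.Primes"
begin

section \<open>Integral binary quartic forms\<close>

text \<open>
  The vector \<open>f\<close> with entries \<open>f$1, \<dots>, f$5\<close> stands for the form
  \<open>a x^4 + b x^3 y + c x^2 y^2 + d x y^3 + e y^4\<close> with \<open>(a, b, c, d, e) = (f$1, \<dots>, f$5)\<close>.
\<close>

type_synonym quartic = "int ^ 5"

definition quartic_eval :: "quartic \<Rightarrow> 'a::comm_ring_1 \<Rightarrow> 'a \<Rightarrow> 'a" where
  "quartic_eval f x y =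
     of_int (f$1) * x^4 + of_int (f$2) * x^3 * y + of_int (f$3) * x^2 * y^2
       + of_int (f$4) * x * y^3 + of_int (f$5) * y^4"

text \<open>
  The action \<open>(\<gamma> \<cdot> f)(x, y) = f((x, y)\<gamma>)\<close>, where \<open>(x, y)\<close> is a row vector. A form is determined by
  its values at integer points; see \<open>quartic_eval_inject\<close> and \<open>quartic_eval_act\<close>.
\<close>

definition quartic_act :: "int ^ 2 ^ 2 \<Rightarrow> quartic \<Rightarrow> quartic" where
  "quartic_act \<gamma> f =
     (THE g. \<forall>x y :: int. quartic_eval g x y =
        (let v = vector [x, y] v* \<gamma> in quartic_eval f (v$1) (v$2)))"

definition GL2Z :: "(int ^ 2 ^ 2) set" where
  "GL2Z = {\<gamma>. invertible \<gamma>}"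

definition GL2Z_invariant :: "quartic set \<Rightarrow> bool" where
  "GL2Z_invariant S \<longleftrightarrow> (\<forall>\<gamma>\<in>GL2Z. \<forall>f\<in>S. quartic_act \<gamma> f \<in> S)"

definition GL2Z_orbit :: "quartic \<Rightarrow> quartic set" where
  "GL2Z_orbit f = (\<lambda>\<gamma>. quartic_act \<gamma> f) ` GL2Z"

definition inv_I :: "quartic \<Rightarrow> int" where
  "inv_I f = 12 * f$1 * f$5 - 3 * f$2 * f$4 + (f$3)^2"

definition inv_J :: "quartic \<Rightarrow> int" where
  "inv_J f = 72 * f$1 * f$3 * f$5 + 9 * f$2 * f$3 * f$4
     - 27 * f$1 * (f$4)^2 - 27 * f$5 * (f$2)^2 - 2 * (f$3)^3"

definition height :: "quartic \<Rightarrow> real" where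
  "height f = max (\<bar>of_int (inv_I f)\<bar> ^ 3) ((of_int (inv_J f))\<^sup>2 / 4)"

text \<open>
  Irreducibility in \<open>\<rat>[x, y]\<close>, modelled as \<open>(\<rat>[y])[x]\<close>: the outer variable of the type
  \<open>rat poly poly\<close> is \<open>x\<close>, the inner one is \<open>y\<close>.
\<close>

definition irreducible_over_Q :: "quartic \<Rightarrow> bool" where
  "irreducible_over_Q f \<longleftrightarrow>
     irreducible (quartic_eval f [:0, 1:] [:[:0, 1:]:] :: rat poly poly)"

text \<open>Points of the real projective line are the lines through the origin in the plane.\<close>

definition P1_real :: "(real ^ 2) set set" where
  "P1_real = {L. subspace L \<and> dim L = 1}"

definition real_roots :: "quartic \<Rightarrow> (real ^ 2) set set" where
  "real_roots f = {L \<in> P1_real. \<forall>v\<in>L. quartic_eval f (v$1) (v$2) = 0}"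

text \<open>
  Finiteness is required explicitly because the zero form has infinitely many roots, and the
  cardinality of an infinite set is \<open>0\<close> in HOL.
\<close>

definition V_Z :: "nat \<Rightarrow> quartic set" where
  "V_Z i = {f. finite (real_roots f) \<and> int (card (real_roots f)) = 4 - 2 * int i}"

definition N_classes :: "quartic set \<Rightarrow> real \<Rightarrow> nat" where
  "N_classes S X = card (GL2Z_orbit ` {f \<in> S. irreducible_over_Q f \<and> height f < X})"

section \<open>Sets defined by finitely many congruence conditions\<close>

text \<open>
  A congruence condition modulo \<open>q\<close> is a union of residue classes modulo \<open>q\<close>. A set defined by
  congruence conditions is cut out by conditions at the individual primes, that is, by conditions
  modulo prime powers, all of which have to hold. (A single condition modulo a number with several
  prime factors may tie the conditions at different primes together; for such sets the density is
  not a product of local densities.)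
\<close>

definition congruence_condition :: "nat \<Rightarrow> quartic set \<Rightarrow> bool" where
  "congruence_condition q C \<longleftrightarrow>
     (\<forall>f g. (\<forall>j. f$j mod int q = g$j mod int q) \<longrightarrow> (f \<in> C \<longleftrightarrow> g \<in> C))"

definition finitely_many_congruence_conditions :: "quartic set \<Rightarrow> bool" where
  "finitely_many_congruence_conditions S \<longleftrightarrow>
     (\<exists>\<C>. finite \<C> \<and> (\<forall>C\<in>\<C>. \<exists>p k. prime p \<and> congruence_condition (p ^ k) C) \<and> S = \<Inter>\<C>)"

section \<open>The \<open>p\<close>-adic integers and the Haar measure\<close>

text \<open>
  \<open>Z_p\<close> is the inverse limit of the rings \<open>Z/p^n\<close>, each represented by \<open>{0..<p^n}\<close>. Its
  topology is the one induced by the product topology on \<open>nat \<Rightarrow> int\<close>, where \<open>int\<close> is discrete.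
\<close>

definition padic_ints :: "nat \<Rightarrow> (nat \<Rightarrow> int) set" where
  "padic_ints p = {x. \<forall>n. x n \<in> {0..<int p ^ n} \<and> x (Suc n) mod int p ^ n = x n}"

definition padic_add :: "nat \<Rightarrow> (nat \<Rightarrow> int) \<Rightarrow> (nat \<Rightarrow> int) \<Rightarrow> (nat \<Rightarrow> int)" where
  "padic_add p x y = (\<lambda>n. (x n + y n) mod int p ^ n)"

definition padic_of_int :: "nat \<Rightarrow> int \<Rightarrow> (nat \<Rightarrow> int)" where
  "padic_of_int p a = (\<lambda>n. a mod int p ^ n)"

definition V_Zp :: "nat \<Rightarrow> ((nat \<Rightarrow> int) ^ 5) set" where
  "V_Zp p = {v. \<forall>j. v$j \<in> padic_ints p}"

definition V_Zp_add :: "nat \<Rightarrow> (nat \<Rightarrow> int) ^ 5 \<Rightarrow> (nat \<Rightarrow> int) ^ 5 \<Rightarrow> (nat \<Rightarrow> int) ^ 5" where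
  "V_Zp_add p v w = (\<chi> j. padic_add p (v$j) (w$j))"

definition V_Zp_of_int :: "nat \<Rightarrow> quartic \<Rightarrow> (nat \<Rightarrow> int) ^ 5" where
  "V_Zp_of_int p f = (\<chi> j. padic_of_int p (f$j))"

definition is_normalized_haar :: "nat \<Rightarrow> ((nat \<Rightarrow> int) ^ 5) measure \<Rightarrow> bool" where
  "is_normalized_haar p M \<longleftrightarrow>
     sets M = sets (restrict_space borel (V_Zp p)) \<and>
     emeasure M (V_Zp p) = 1 \<and>
     (\<forall>a\<in>V_Zp p. \<forall>A\<in>sets M. emeasure M (V_Zp_add p a ` A) = emeasure M A)"

text \<open>Existence and uniqueness: \<open>ex1_normalized_haar\<close> below.\<close>

definition haar :: "nat \<Rightarrow> ((nat \<Rightarrow> int) ^ 5) measure" where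
  "haar p = (THE M. is_normalized_haar p M)"

definition local_density :: "nat \<Rightarrow> quartic set \<Rightarrow> real" where
  "local_density p S = measure (haar p) (top_of_set (V_Zp p) closure_of (V_Zp_of_int p ` S))"

text \<open>
  The product over all primes is the limit of its partial products. This differs from
  \<open>prodinf\<close>, which is unspecified when infinitely many factors vanish (as for empty \<open>S\<close>).
\<close>

definition prod_local_densities :: "quartic set \<Rightarrow> real" where
  "prod_local_densities S = lim (\<lambda>n. \<Prod>p | prime p \<and> p \<le> n. local_density p S)"

section \<open>Well-definedness of the action\<close>

lemma exhaust_5: "k = 1 \<or> k = 2 \<or> k = 3 \<or> k = 4 \<or> k = 5" for k :: 5
proof (induct k)
  case (of_int z)
  then have "z = 0 \<or> z = 1 \<or> z = 2 \<or> z = 3 \<or> z = 4" by fastforce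
  then show ?case by auto
qed

lemma vector_5:
  "(vector [a, b, c, d, e] :: 'a::zero ^ 5)$1 = a"
  "(vector [a, b, c, d, e] :: 'a::zero ^ 5)$2 = b"
  "(vector [a, b, c, d, e] :: 'a::zero ^ 5)$3 = c"
  "(vector [a, b, c, d, e] :: 'a::zero ^ 5)$4 = d"
  "(vector [a, b, c, d, e] :: 'a::zero ^ 5)$5 = e"
  unfolding vector_def by simp_all

lemma quartic_eval_inject:
  assumes "\<forall>x y :: int. quartic_eval f x y = quartic_eval g x y"
  shows "f = g"
proof -
  have e: "f$1 * x^4 + f$2 * x^3 * y + f$3 * x^2 * y^2 + f$4 * x * y^3 + f$5 * y^4 =
     g$1 * x^4 + g$2 * x^3 * y + g$3 * x^2 * y^2 + g$4 * x * y^3 + g$5 * y^4" for x y :: int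
    using assms by (simp add: quartic_eval_def)
  have "f$1 = g$1" "f$5 = g$5" "f$2 = g$2" "f$3 = g$3" "f$4 = g$4"
    using e[of 1 0] e[of 0 1] e[of 1 1] e[of 1 "-1"] e[of 2 1] by simp_all
  then have "f$k = g$k" for k
    using exhaust_5[of k] by auto
  then show ?thesis by (simp add: vec_eq_iff)
qed

lemma quartic_eval_act:
  "quartic_eval (quartic_act \<gamma> f) x y =
     (let v = vector [x, y] v* \<gamma> in quartic_eval f (v$1) (v$2))" for x y :: int
proof -
  let ?P = "\<lambda>g. \<forall>x y :: int. quartic_eval g x y =
        (let v = vector [x, y] v* \<gamma> in quartic_eval f (v$1) (v$2))"
  define p q r s where "p = \<gamma>$1$1" and "q = \<gamma>$1$2" and "r = \<gamma>$2$1" and "s = \<gamma>$2$2"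
  have "\<exists>g. ?P g"
    apply (rule exI[of _ "vector [quartic_eval f p q,
       f$1 * (4 * p^3 * r) + f$2 * (p^3 * s + 3 * p^2 * r * q) + f$3 * (2 * p^2 * q * s + 2 * p * r * q^2)
         + f$4 * (3 * p * q^2 * s + r * q^3) + f$5 * (4 * q^3 * s),
       f$1 * (6 * p^2 * r^2) + f$2 * (3 * p^2 * r * s + 3 * p * r^2 * q) + f$3 * (p^2 * s^2 + 4 * p * q * r * s + r^2 * q^2)
         + f$4 * (3 * p * q * s^2 + 3 * r * q^2 * s) + f$5 * (6 * q^2 * s^2),
       f$1 * (4 * p * r^3) + f$2 * (3 * p * r^2 * s + r^3 * q) + f$3 * (2 * p * r * s^2 + 2 * r^2 * q * s)
         + f$4 * (p * s^3 + 3 * r * q * s^2) + f$5 * (4 * q * s^3),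
       quartic_eval f r s]"])
    apply (simp add: quartic_eval_def vector_matrix_mult_def vector_5 sum_2 Let_def
        p_def q_def r_def s_def)
    apply algebra
    done
  then obtain g where g: "?P g" by blast
  have "g' = g" if "?P g'" for g'
    using g that by (intro quartic_eval_inject) simp
  with g have "?P (quartic_act \<gamma> f)"
    unfolding quartic_act_def by (rule theI)
  then show ?thesis by blast
qed

section \<open>Existence and uniqueness of the Haar measure\<close>

definition pball :: "nat \<Rightarrow> nat \<Rightarrow> (nat \<Rightarrow> int) ^ 5 \<Rightarrow> ((nat \<Rightarrow> int) ^ 5) set" where
  "pball p n w = {v \<in> V_Zp p. \<forall>j. (v$j) n = (w$j) n}"

definition V_Zp_diff :: "nat \<Rightarrow> (nat \<Rightarrow> int) ^ 5 \<Rightarrow> (nat \<Rightarrow> int) ^ 5 \<Rightarrow> (nat \<Rightarrow> int) ^ 5" where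
  "V_Zp_diff p v w = (\<chi> j. (\<lambda>n. ((v$j) n - (w$j) n) mod int p ^ n))"

definition pballs :: "nat \<Rightarrow> ((nat \<Rightarrow> int) ^ 5) set set" where
  "pballs p = insert {} {pball p n w |n w. w \<in> V_Zp p}"

lemma finite_bounded_vec:
  assumes "finite A"
  shows "finite {u :: 'a ^ 'n. \<forall>j. u$j \<in> A}"
proof (rule finite_subset)
  show "{u :: 'a ^ 'n. \<forall>j. u$j \<in> A} \<subseteq> vec_lambda ` (\<Pi>\<^sub>E j\<in>UNIV. A)"
  proof
    fix u :: "'a ^ 'n" assume "u \<in> {u. \<forall>j. u$j \<in> A}"
    then show "u \<in> vec_lambda ` (\<Pi>\<^sub>E j\<in>UNIV. A)"
      by (intro image_eqI[of _ _ "vec_nth u"]) auto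
  qed
  show "finite (vec_lambda ` (\<Pi>\<^sub>E (j::'n)\<in>UNIV. A))"
    using assms by (intro finite_imageI finite_PiE) auto
qed

lemma V_Zp_iff:
  "v \<in> V_Zp p \<longleftrightarrow> (\<forall>j n. 0 \<le> (v$j) n \<and> (v$j) n < int p ^ n \<and> (v$j) (Suc n) mod int p ^ n = (v$j) n)"
  by (auto simp: V_Zp_def padic_ints_def)

lemma V_Zp_mod:
  assumes "v \<in> V_Zp p" "m \<le> n"
  shows "(v$j) n mod int p ^ m = (v$j) m"
  using assms(2)
proof (induction n rule: dec_induct)
  case base
  then show ?case using assms(1) by (simp add: V_Zp_iff)
next
  case (step n)
  have "(v$j) (Suc n) mod int p ^ m = (v$j) (Suc n) mod int p ^ n mod int p ^ m"
    by (rule mod_mod_cancel[symmetric]) (use step in \<open>simp add: le_imp_power_dvd\<close>)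
  then show ?case using assms(1) step by (simp add: V_Zp_iff)
qed

lemma mod_mod_pow: "a mod int p ^ Suc n mod int p ^ n = a mod int p ^ n"
  by (rule mod_mod_cancel) simp

context
  fixes p :: nat
  assumes p: "p > 0"
begin

lemma V_Zp_I:
  assumes "\<And>j n. (v$j) n = g j n mod int p ^ n" "\<And>j n. g j (Suc n) mod int p ^ n = g j n mod int p ^ n"
  shows "v \<in> V_Zp p"
  using assms p by (auto simp: V_Zp_iff mod_mod_pow simp del: power_Suc)

lemma V_Zp_nonempty: "(\<chi> j. (\<lambda>n. 0)) \<in> V_Zp p"
  using p by (simp add: V_Zp_iff)

lemma V_Zp_cong:
  assumes "v \<in> V_Zp p"
  shows "(v$j) (Suc n) mod int p ^ n = (v$j) n mod int p ^ n"
  using assms by (auto simp: V_Zp_iff)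

lemma V_Zp_add_in: "v \<in> V_Zp p \<Longrightarrow> w \<in> V_Zp p \<Longrightarrow> V_Zp_add p v w \<in> V_Zp p"
  by (rule V_Zp_I[where g = "\<lambda>j n. (v$j) n + (w$j) n"])
    (auto simp: V_Zp_add_def padic_add_def intro!: mod_add_cong V_Zp_cong)

lemma V_Zp_diff_in: "v \<in> V_Zp p \<Longrightarrow> w \<in> V_Zp p \<Longrightarrow> V_Zp_diff p v w \<in> V_Zp p"
  by (rule V_Zp_I[where g = "\<lambda>j n. (v$j) n - (w$j) n"])
    (auto simp: V_Zp_diff_def intro!: mod_diff_cong V_Zp_cong)

lemma V_Zp_add_diff:
  assumes "v \<in> V_Zp p"
  shows "V_Zp_add p a (V_Zp_diff p v a) = v" "V_Zp_diff p (V_Zp_add p a v) a = v"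
  using assms by (auto simp: V_Zp_add_def V_Zp_diff_def padic_add_def vec_eq_iff fun_eq_iff
      V_Zp_iff mod_simps)

lemma pball_add:
  assumes "a \<in> V_Zp p" "w \<in> V_Zp p"
  shows "V_Zp_add p a ` pball p n w = pball p n (V_Zp_add p a w)" (is "?L = ?R")
proof
  show "?L \<subseteq> ?R"
    using assms by (auto simp: pball_def V_Zp_add_in) (simp add: V_Zp_add_def padic_add_def)
  show "?R \<subseteq> ?L"
  proof
    fix u assume u: "u \<in> ?R"
    then have "u \<in> V_Zp p" by (simp add: pball_def)
    have "((V_Zp_diff p u a)$j) n = (w$j) n" for j
    proof -
      have "((V_Zp_diff p u a)$j) n = ((V_Zp_diff p (V_Zp_add p a w) a)$j) n"
        using u by (simp add: V_Zp_diff_def pball_def)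
      then show ?thesis using assms by (simp add: V_Zp_add_diff)
    qed
    then have "V_Zp_diff p u a \<in> pball p n w"
      using \<open>u \<in> V_Zp p\<close> assms by (simp add: pball_def V_Zp_diff_in)
    then show "u \<in> ?L"
      using V_Zp_add_diff(1)[OF \<open>u \<in> V_Zp p\<close>, of a] by (metis imageI)
  qed
qed

lemma pball_0: "pball p 0 w = V_Zp p" if "w \<in> V_Zp p"
proof -
  have "(v$j) 0 = 0" if "v \<in> V_Zp p" for v j
  proof -
    have "0 \<le> (v$j) 0" "(v$j) 0 < int p ^ 0" using that unfolding V_Zp_iff by blast+
    then show ?thesis by simp
  qed
  then show ?thesis using that by (simp add: pball_def cong: conj_cong)
qed

lemma Int_stable_pballs: "Int_stable (pballs p)"
proof (rule Int_stableI)
  have *: "pball p n w \<inter> pball p m u \<in> pballs p" if "n \<le> m" for n m w u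
  proof (cases "pball p n w \<inter> pball p m u = {}")
    case False
    then obtain z where z: "z \<in> pball p n w" "z \<in> pball p m u" by blast
    have "v \<in> pball p n w" if "v \<in> pball p m u" for v
      using that z V_Zp_mod[OF _ \<open>n \<le> m\<close>] by (simp add: pball_def) metis
    then have "pball p n w \<inter> pball p m u = pball p m z"
      using z by (auto simp: pball_def)
    moreover have "z \<in> V_Zp p" using z by (simp add: pball_def)
    ultimately show ?thesis unfolding pballs_def by blast
  qed (simp add: pballs_def)
  fix A B assume A: "A \<in> pballs p" and B: "B \<in> pballs p"
  show "A \<inter> B \<in> pballs p"
  proof (cases "A = {} \<or> B = {}")
    case True
    then show ?thesis by (auto simp: pballs_def)
  next
    case False
    then obtain n w m u where "A = pball p n w" "B = pball p m u"
      using A B unfolding pballs_def by blast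
    moreover have "n \<le> m \<or> m \<le> n" by linarith
    ultimately show ?thesis using *[of n m w u] *[of m n u w] by (metis Int_commute)
  qed
qed

lemma finite_pballs: "finite (pball p n ` V_Zp p)"
proof -
  let ?R = "{u :: int ^ 5. \<forall>j. u$j \<in> {0..<int p ^ n}}"
  have "finite ?R"
    by (rule finite_bounded_vec) simp
  moreover have "pball p n ` V_Zp p \<subseteq> (\<lambda>u. {v \<in> V_Zp p. \<forall>j. (v$j) n = u$j}) ` ?R"
  proof
    fix A assume "A \<in> pball p n ` V_Zp p"
    then obtain w where w: "w \<in> V_Zp p" "A = pball p n w" by blast
    show "A \<in> (\<lambda>u. {v \<in> V_Zp p. \<forall>j. (v$j) n = u$j}) ` ?R"
      by (rule image_eqI[of _ _ "\<chi> j. (w$j) n"]) (use w in \<open>auto simp: pball_def V_Zp_iff\<close>)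
  qed
  ultimately show ?thesis by (rule finite_surj)
qed

lemma open_level: "open {v :: (nat \<Rightarrow> int) ^ 5. \<forall>j. (v$j) n = a j}"
proof -
  have "open {x :: nat \<Rightarrow> int. x n = a j}" for j
    using product_topology_basis'[of "{n}" "\<lambda>_. {a j}" id] by (simp add: Topological_Spaces.open_discrete)
  from open_vector_box[of "\<lambda>j. {x. x n = a j}"] this show ?thesis by simp
qed

lemma pball_measurable: "pball p n w \<in> sets (restrict_space borel (V_Zp p))"
proof -
  have "pball p n w = V_Zp p \<inter> {v. \<forall>j. (v$j) n = (w$j) n}"
    by (auto simp: pball_def)
  moreover have "{v. \<forall>j. (v$j) n = (w$j) n} \<in> sets borel"
    by (rule borel_open[OF open_level])
  ultimately show ?thesis
    unfolding sets_restrict_space by (rule image_eqI)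
qed

lemma open_pball:
  assumes "open U" "v \<in> U" "v \<in> V_Zp p"
  shows "\<exists>n. pball p n v \<subseteq> U"
proof -
  obtain A where A: "\<And>j. open (A j)" "\<And>j. v$j \<in> A j" "\<And>y. (\<forall>j. y$j \<in> A j) \<Longrightarrow> y \<in> U"
    using assms unfolding open_vec_def by metis
  have "\<exists>n. \<forall>y. (\<forall>m<n. y m = (v$j) m) \<longrightarrow> y \<in> A j" for j
  proof -
    obtain X where X: "v$j \<in> (\<Pi>\<^sub>E i\<in>UNIV. X i)" "finite {i. X i \<noteq> UNIV}" "(\<Pi>\<^sub>E i\<in>UNIV. X i) \<subseteq> A j"
      using product_topology_open_contains_basis[OF A(1)[unfolded open_fun_def] A(2), of j]
      by (simp only: topspace_euclidean) blast
    obtain n where n: "{i. X i \<noteq> UNIV} \<subseteq> {..<n}"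
      using X(2) finite_nat_iff_bounded by blast
    have "y \<in> A j" if "\<forall>m<n. y m = (v$j) m" for y
    proof -
      have "y i \<in> X i" for i
      proof (cases "i < n")
        case True
        then show ?thesis using that X(1) by (auto simp: PiE_iff)
      next
        case False
        then show ?thesis using n by auto
      qed
      then show ?thesis using X(3) by (auto simp: PiE_iff)
    qed
    then show ?thesis by blast
  qed
  then obtain N where N: "\<And>j y. (\<forall>m<N j. y m = (v$j) m) \<Longrightarrow> y \<in> A j" by metis
  have "u \<in> U" if "u \<in> pball p (Max (range N)) v" for u
  proof (rule A(3), intro allI N impI)
    fix j m assume "m < N j"
    moreover have "N j \<le> Max (range N)" by simp
    ultimately have "m \<le> Max (range N)" by linarith
    then show "(u$j) m = (v$j) m"
      using that assms(3) V_Zp_mod by (simp add: pball_def) metis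
  qed
  then show ?thesis by blast
qed

lemma sets_V_Zp: "sets (restrict_space borel (V_Zp p)) = sigma_sets (V_Zp p) (pballs p)"
proof
  have sub: "pballs p \<subseteq> Pow (V_Zp p)" by (auto simp: pballs_def pball_def)
  have "countable (pball p n ` V_Zp p)" for n
    by (rule countable_finite[OF finite_pballs])
  then have "countable (\<Union>n. pball p n ` V_Zp p)" by simp
  moreover have "pballs p = insert {} (\<Union>n. pball p n ` V_Zp p)" by (auto simp: pballs_def)
  ultimately have cnt: "countable (pballs p)" by simp
  have op: "V_Zp p \<inter> U \<in> sigma_sets (V_Zp p) (pballs p)" if U: "open U" for U
  proof -
    have "V_Zp p \<inter> U = \<Union>{B \<in> pballs p. B \<subseteq> U}"
    proof
      show "V_Zp p \<inter> U \<subseteq> \<Union>{B \<in> pballs p. B \<subseteq> U}"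
      proof
        fix v assume v: "v \<in> V_Zp p \<inter> U"
        then obtain n where "pball p n v \<subseteq> U" using open_pball[OF U] by blast
        moreover have "v \<in> pball p n v" "pball p n v \<in> pballs p"
          using v by (auto simp: pball_def pballs_def)
        ultimately show "v \<in> \<Union>{B \<in> pballs p. B \<subseteq> U}" by blast
      qed
    qed (use sub in auto)
    also have "\<dots> \<in> sigma_sets (V_Zp p) (pballs p)"
      by (rule sigma_sets_UNION) (auto intro: countable_subset[OF _ cnt])
    finally show ?thesis .
  qed
  show "sets (restrict_space borel (V_Zp p)) \<subseteq> sigma_sets (V_Zp p) (pballs p)"
  proof
    fix A assume "A \<in> sets (restrict_space borel (V_Zp p))"
    then obtain B where B: "B \<in> sets borel" "A = V_Zp p \<inter> B"
      by (auto simp: sets_restrict_space)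
    have "B \<in> sigma_sets UNIV {S. open S}" using B(1) by (simp add: borel_def)
    then have "V_Zp p \<inter> B \<in> sigma_sets (V_Zp p) (pballs p)"
    proof induction
      case (Basic a)
      then show ?case using op by simp
    next
      case Empty
      then show ?case by (simp add: sigma_sets.Empty)
    next
      case (Compl a)
      have "V_Zp p \<inter> (UNIV - a) = V_Zp p - (V_Zp p \<inter> a)" by blast
      then show ?case using Compl by (simp add: sigma_sets.Compl)
    next
      case (Union a)
      have "V_Zp p \<inter> \<Union> (range a) = (\<Union>i. V_Zp p \<inter> a i)" by blast
      moreover have "(\<Union>i. V_Zp p \<inter> a i) \<in> sigma_sets (V_Zp p) (pballs p)"
        by (rule sigma_sets.Union) (rule Union.IH)
      ultimately show ?case by (simp only:)
    qed
    then show "A \<in> sigma_sets (V_Zp p) (pballs p)" using B by simp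
  qed
  have "pballs p \<subseteq> sets (restrict_space borel (V_Zp p))"
    using pball_measurable by (auto simp: pballs_def)
  then show "sigma_sets (V_Zp p) (pballs p) \<subseteq> sets (restrict_space borel (V_Zp p))"
    using sets.sigma_sets_subset[of "pballs p" "restrict_space borel (V_Zp p)"]
    by (simp add: space_restrict_space)
qed

lemma measure_eqI_pballs:
  assumes "sets M = sets (restrict_space borel (V_Zp p))"
    "sets N = sets (restrict_space borel (V_Zp p))"
    "\<And>n w. w \<in> V_Zp p \<Longrightarrow> emeasure M (pball p n w) = emeasure N (pball p n w)"
    "emeasure M (V_Zp p) = 1"
  shows "M = N"
proof (rule measure_eqI_generator_eq[OF Int_stable_pballs, where A = "\<lambda>_. V_Zp p" and \<Omega> = "V_Zp p"])
  show "range (\<lambda>_. V_Zp p) \<subseteq> pballs p"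
    using pball_0[OF V_Zp_nonempty] V_Zp_nonempty by (auto simp: pballs_def)
qed (use assms in \<open>auto simp: sets_V_Zp pballs_def pball_def\<close>)

lemma haar_pball:
  assumes M: "is_normalized_haar p M" and w: "w \<in> V_Zp p"
  shows "emeasure M (pball p n w) = 1 / of_nat (card (pball p n ` V_Zp p))"
proof -
  let ?F = "pball p n ` V_Zp p"
  have sets: "B \<in> sets M" if "B \<in> ?F" for B
    using M that pball_measurable by (auto simp: is_normalized_haar_def)
  have eq: "emeasure M B = emeasure M (pball p n w)" if B: "B \<in> ?F" for B
  proof -
    obtain u where u: "u \<in> V_Zp p" "B = pball p n u" using B by blast
    have "V_Zp_add p (V_Zp_diff p u w) w = V_Zp_add p w (V_Zp_diff p u w)"
      by (simp add: V_Zp_add_def padic_add_def add.commute)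
    then have "V_Zp_add p (V_Zp_diff p u w) ` pball p n w = B"
      using u w by (simp add: pball_add V_Zp_diff_in V_Zp_add_diff)
    then show ?thesis
      using M V_Zp_diff_in[OF u(1) w] pball_measurable unfolding is_normalized_haar_def by metis
  qed
  have "1 = emeasure M (\<Union>?F)"
  proof -
    have "\<Union>?F = V_Zp p" by (auto simp: pball_def)
    then show ?thesis using M by (simp add: is_normalized_haar_def)
  qed
  also have "\<dots> = (\<Sum>B\<in>?F. emeasure M B)"
  proof -
    have "disjoint_family_on (\<lambda>B. B) ?F"
      by (force simp: disjoint_family_on_def pball_def)
    moreover have "(\<lambda>B. B) ` ?F \<subseteq> sets M" using sets by blast
    ultimately show ?thesis
      using sum_emeasure[OF _ _ finite_pballs, of "\<lambda>B. B" n M] by simp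
  qed
  also have "\<dots> = of_nat (card ?F) * emeasure M (pball p n w)"
    using eq by simp
  finally have e: "1 = of_nat (card ?F) * emeasure M (pball p n w)" .
  have "card ?F \<noteq> 0" using finite_pballs w by (auto simp: card_eq_0_iff)
  then have "of_nat (card ?F) \<noteq> (0 :: ennreal)" by simp
  then show ?thesis
    using e by (metis ennreal_mult_divide_eq ennreal_of_nat_neq_top mult.commute)
qed

definition digit_map :: "(nat \<Rightarrow> int ^ 5) \<Rightarrow> (nat \<Rightarrow> int) ^ 5" where
  "digit_map d = (\<chi> j. (\<lambda>n. \<Sum>k<n. ((d k)$j mod int p) * int p ^ k))"

lemma digit_map_in: "digit_map d \<in> V_Zp p"
proof -
  have b: "0 \<le> ((digit_map d)$j) n \<and> ((digit_map d)$j) n < int p ^ n" for j n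
  proof (induction n)
    case (Suc n)
    have "(d n$j mod int p) \<le> int p - 1" using p by simp
    then have "(d n$j mod int p) * int p ^ n \<le> (int p - 1) * int p ^ n"
      by (intro mult_right_mono) simp_all
    moreover have "0 \<le> (d n$j mod int p) * int p ^ n" using p by simp
    ultimately show ?case using Suc by (simp add: digit_map_def algebra_simps)
  qed (simp add: digit_map_def)
  have "((digit_map d)$j) (Suc n) mod int p ^ n = ((digit_map d)$j) n" for j n
  proof -
    have "((digit_map d)$j) (Suc n) = ((digit_map d)$j) n + (d n$j mod int p) * int p ^ n"
      by (simp add: digit_map_def)
    then show ?thesis using b[of j n] by simp
  qed
  with b show ?thesis by (simp add: V_Zp_iff)
qed

definition nth_digit :: "nat \<Rightarrow> (nat \<Rightarrow> int) ^ 5 \<Rightarrow> int ^ 5" where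
  "nth_digit k w = (\<chi> j. (w$j) (Suc k) div int p ^ k)"

lemma nth_digit_bounds: "w \<in> V_Zp p \<Longrightarrow> 0 \<le> (nth_digit k w)$j \<and> (nth_digit k w)$j < int p"
proof -
  assume w: "w \<in> V_Zp p"
  have b: "0 \<le> (w$j) (Suc k)" "(w$j) (Suc k) < int p ^ Suc k"
    using w unfolding V_Zp_iff by blast+
  have "(w$j) (Suc k) div int p ^ k * int p ^ k \<le> (w$j) (Suc k)"
  proof -
    have "0 \<le> (w$j) (Suc k) mod int p ^ k" using p by simp
    then show ?thesis using div_mult_mod_eq[of "(w$j) (Suc k)" "int p ^ k"] by linarith
  qed
  then have "(w$j) (Suc k) div int p ^ k * int p ^ k < int p * int p ^ k" using b by simp
  then have "(w$j) (Suc k) div int p ^ k < int p"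
    by (rule mult_right_less_imp_less) simp
  then show ?thesis using b p by (simp add: nth_digit_def pos_imp_zdiv_nonneg_iff)
qed

lemma digit_map_pball_iff:
  assumes w: "w \<in> V_Zp p"
  shows "digit_map d \<in> pball p n w \<longleftrightarrow> (\<forall>k<n. \<forall>j. (d k)$j mod int p = (nth_digit k w)$j)"
proof -
  have "((digit_map d)$j) n = (w$j) n \<longleftrightarrow> (\<forall>k<n. (d k)$j mod int p = (nth_digit k w)$j)" for j
  proof (induction n)
    case 0
    have "0 \<le> (w$j) 0" "(w$j) 0 < int p ^ 0" using w unfolding V_Zp_iff by blast+
    then show ?case by (simp add: digit_map_def)
  next
    case (Suc n)
    let ?h = "digit_map d"
    have h: "(?h$j) (Suc n) = (?h$j) n + (d n$j mod int p) * int p ^ n"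
      by (simp add: digit_map_def)
    have w': "(w$j) (Suc n) = (w$j) n + (nth_digit n w$j) * int p ^ n"
      using w div_mult_mod_eq[of "(w$j) (Suc n)" "int p ^ n"] by (simp add: V_Zp_iff nth_digit_def)
    have "(?h$j) (Suc n) = (w$j) (Suc n) \<longleftrightarrow>
      (?h$j) n = (w$j) n \<and> (d n)$j mod int p = (nth_digit n w)$j"
    proof
      assume a: "(?h$j) (Suc n) = (w$j) (Suc n)"
      then have "(?h$j) n = (w$j) n"
        using w digit_map_in[of d] by (metis V_Zp_iff)
      with a h w' p show "(?h$j) n = (w$j) n \<and> (d n)$j mod int p = (nth_digit n w)$j" by simp
    qed (simp add: h w')
    then show ?case using Suc by (auto simp: less_Suc_eq)
  qed
  then show ?thesis using digit_map_in by (auto simp: pball_def)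
qed

lemma ex_normalized_haar: "\<exists>M. is_normalized_haar p M"
proof -
  define D where "D = {u :: int ^ 5. \<forall>j. u$j \<in> {0..<int p}}"
  have D: "finite D" "D \<noteq> {}"
  proof -
    show "finite D" unfolding D_def by (rule finite_bounded_vec) simp
    have "(\<chi> j. 0) \<in> D" using p by (simp add: D_def)
    then show "D \<noteq> {}" by blast
  qed
  define Q where "Q = (\<lambda>_ :: nat. measure_pmf (pmf_of_set D))"
  interpret Q: product_prob_space Q UNIV
    unfolding Q_def by unfold_locales
  let ?B = "restrict_space borel (V_Zp p)"
  define M where "M = distr (PiM UNIV Q) ?B digit_map"
  define E where "E = (\<lambda>(n :: nat) w. \<lambda>k :: nat. {x :: int ^ 5. \<forall>j. x$j mod int p = (nth_digit k w)$j})"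
  have pre: "digit_map -` pball p n w \<inter> space (PiM UNIV Q) = {x \<in> space (PiM UNIV Q). \<forall>k\<in>{..<n}. x k \<in> E n w k}"
    if "w \<in> V_Zp p" for n w
    using digit_map_pball_iff[OF that] by (auto simp: E_def)
  have pre_sets: "digit_map -` pball p n w \<inter> space (PiM UNIV Q) \<in> sets (PiM UNIV Q)"
    if "w \<in> V_Zp p" for n w
    unfolding pre[OF that] by (intro sets.sets_Collect_finite_All sets_Collect_single) (auto simp: Q_def)
  have meas: "digit_map \<in> measurable (PiM UNIV Q) ?B"
  proof (rule measurable_sigma_sets[OF sets_V_Zp])
    show "digit_map -` A \<inter> space (PiM UNIV Q) \<in> sets (PiM UNIV Q)" if "A \<in> pballs p" for A
      using that pre_sets by (auto simp: pballs_def)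
  qed (auto simp: digit_map_in pballs_def pball_def)
  have sets_M: "sets M = sets ?B" by (simp add: M_def)
  have ball: "emeasure M (pball p n w) = (1 / of_nat (card D)) ^ n" if w: "w \<in> V_Zp p" for n w
  proof -
    have "emeasure M (pball p n w) = emeasure (PiM UNIV Q) {x \<in> space (PiM UNIV Q). \<forall>k\<in>{..<n}. x k \<in> E n w k}"
      unfolding M_def using meas pball_measurable pre[OF w] by (simp add: emeasure_distr)
    also have "\<dots> = (\<Prod>k\<in>{..<n}. emeasure (Q k) (E n w k))"
      by (rule Q.emeasure_PiM_Collect) (auto simp: Q_def)
    also have "\<dots> = (\<Prod>k\<in>{..<n}. 1 / of_nat (card D))"
    proof (rule prod.cong)
      fix k assume "k \<in> {..<n}"
      have "D \<inter> E n w k = {nth_digit k w}"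
        using nth_digit_bounds[OF w, of k] by (auto simp: D_def E_def vec_eq_iff)
      then show "emeasure (Q k) (E n w k) = 1 / of_nat (card D)"
        using D by (simp add: Q_def emeasure_pmf_of_set card_gt_0_iff flip: ennreal_of_nat_eq_real_of_nat divide_ennreal)
    qed simp
    finally show ?thesis by simp
  qed
  have total: "emeasure M (V_Zp p) = 1"
    using ball[OF V_Zp_nonempty, of 0] by (simp add: pball_0[OF V_Zp_nonempty])
  have "emeasure M (V_Zp_add p a ` A) = emeasure M A" if a: "a \<in> V_Zp p" and A: "A \<in> sets M" for a A
  proof -
    let ?T = "\<lambda>v. V_Zp_diff p v a"
    have space: "space M = V_Zp p" "space ?B = V_Zp p" by (simp_all add: M_def space_restrict_space)
    have pre': "?T -` A \<inter> V_Zp p = V_Zp_add p a ` A" if "A \<subseteq> V_Zp p" for A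
    proof
      show "?T -` A \<inter> V_Zp p \<subseteq> V_Zp_add p a ` A"
      proof
        fix v assume "v \<in> ?T -` A \<inter> V_Zp p"
        then show "v \<in> V_Zp_add p a ` A"
          using V_Zp_add_diff(1)[of v a] by (intro image_eqI[of v _ "?T v"]) auto
      qed
      show "V_Zp_add p a ` A \<subseteq> ?T -` A \<inter> V_Zp p"
        using that a V_Zp_add_diff(2) V_Zp_add_in by auto
    qed
    have T: "?T \<in> measurable M ?B"
    proof (rule measurable_sigma_sets[OF sets_V_Zp])
      fix A assume A: "A \<in> pballs p"
      then have "A \<subseteq> V_Zp p" by (auto simp: pballs_def pball_def)
      then show "?T -` A \<inter> space M \<in> sets M"
        using A a pball_add pball_measurable by (auto simp: pre' space pballs_def sets_M)
    qed (use a in \<open>auto simp: space V_Zp_diff_in pballs_def pball_def\<close>)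
    have "distr M ?B ?T = M"
    proof (rule sym, rule measure_eqI_pballs)
      fix n w assume w: "w \<in> V_Zp p"
      have "pball p n w \<subseteq> V_Zp p" by (auto simp: pball_def)
      then show "emeasure M (pball p n w) = emeasure (distr M ?B ?T) (pball p n w)"
        using T w a by (simp add: emeasure_distr pball_measurable space pre' pball_add ball V_Zp_add_in)
    qed (use sets_M total in auto)
    moreover have "A \<subseteq> V_Zp p" using sets.sets_into_space[OF A] space by simp
    then have "emeasure (distr M ?B ?T) A = emeasure M (V_Zp_add p a ` A)"
      using T A sets_M by (simp add: emeasure_distr space pre')
    ultimately show ?thesis by simp
  qed
  with sets_M total show ?thesis unfolding is_normalized_haar_def by blast
qed

lemma ex1_normalized_haar: "\<exists>!M. is_normalized_haar p M"
proof (rule ex_ex1I[OF ex_normalized_haar])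
  fix M N assume MN: "is_normalized_haar p M" "is_normalized_haar p N"
  show "M = N"
    by (rule measure_eqI_pballs) (use MN haar_pball in \<open>auto simp: is_normalized_haar_def\<close>)
qed

end

lemma haar_normalized: "p > 0 \<Longrightarrow> is_normalized_haar p (haar p)"
  unfolding haar_def by (rule theI'[OF ex1_normalized_haar])

end

theory Submission
  imports Defs "HOL-Computational_Algebra.Fundamental_Theorem_Algebra"
begin

text \<open>
  Every form \<open>f\<close> with \<open>4\<close>, \<open>2\<close> or \<open>0\<close> real roots has a center \<open>z(f)\<close> in the upper half plane that
  is equivariant under \<open>GL\<^sub>2\<close>: the non-real root if there are two real roots, and otherwise the fixed
  point of the rotation by \<open>\<pi>\<close> in the stabilizer of \<open>f\<close>. Hence irreducible classes correspond, up to a factor \<open>2\<close> and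
  up to boundary points, to the \<open>f\<close> with \<open>z(f)\<close> in the fundamental domain and \<open>a \<noteq> 0\<close>. Reducible
  forms and boundary points are determined by few integers of small product, and there
  are \<open>O(X powr (3/4))\<close> of them.

  No volume is computed. One shows directly that, in a box-shaped piece of the fundamental domain,
  all residue classes modulo \<open>m\<close> contain equally many forms: moving \<open>f\<close> by a unit vector
  enters or leaves the piece only if one of finitely many polynomials of bounded degree vanishes on the
  way, and a polynomial has few zeros on the coordinate lines that meet the box. High in the cusp these lines are too
  many. But the unit strip at height \<open>L\<close> may be replaced by the average over \<open>L\<close> of its translates,
  that is, by the piece \<open>wedge L\<close> with weight \<open>1 / (2 L)\<close>. With \<open>\<lambda> = X powr (1/6)\<close>
  it meets \<open>O(\<lambda>^4 L^2)\<close> lines, and \<open>a \<noteq> 0\<close> forces \<open>L^2 = O(\<lambda>)\<close>, so that the total error is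
  \<open>O(\<lambda>^4 \<lambda> powr (1/2)) = O(X powr (3/4))\<close>.
\<close>

section \<open>Real quartic forms and substitutions\<close>

text \<open>The counts for \<open>S\<close> and for all forms are taken over the same set of forms,
  so no main term has to be evaluated and only the boundary of that set matters. It must consist of
  zeros of polynomials. Domains for the center are therefore bounded by geodesics: the forms with
  center on the imaginary axis satisfy a polynomial equation, and every other geodesic is a
  substitution away. That nothing else can happen on the way is topology. A form of given type is an
  injective function of five real parameters (center, \<open>w0\<close>, \<open>w\<close>), and by
  invariance of domain an open set of parameters has an open image. A segment that leaves the image
  passes a limit of parameters, where a strict inequality has become an equality.

  The factor 2 comes from the reflection in GL2(Z), which pairs \<open>f\<close> with
  \<open>flip f\<close>. Averaging over translates is legitimate because \<open>S\<close> is
  invariant under integral translations, and it is made dyadic by trading two copies of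
  \<open>cusp L\<close> for \<open>wedge L\<close> and \<open>cusp (2 * L)\<close>.\<close>

lemma forall_5: "(\<forall>j::5. P j) \<longleftrightarrow> P 1 \<and> P 2 \<and> P 3 \<and> P 4 \<and> P 5"
  using exhaust_5 by metis

lemma vec5_eq_iff:
  "(f :: 'a ^ 5) = g \<longleftrightarrow> f$1 = g$1 \<and> f$2 = g$2 \<and> f$3 = g$3 \<and> f$4 = g$4 \<and> f$5 = g$5"
  by (simp add: vec_eq_iff forall_5)

definition real_form :: "quartic \<Rightarrow> real ^ 5" where
  "real_form f = (\<chi> j. of_int (f$j))"

lemma real_form_nth [simp]: "real_form f $ j = of_int (f$j)"
  by (simp add: real_form_def)

lemma real_form_inject: "real_form f = real_form g \<longleftrightarrow> f = g"
  by (simp add: vec5_eq_iff)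

definition form_eval :: "real ^ 5 \<Rightarrow> real \<Rightarrow> real \<Rightarrow> real" where
  "form_eval f x y = f$1 * x^4 + f$2 * x^3 * y + f$3 * x^2 * y^2 + f$4 * x * y^3 + f$5 * y^4"

lemma form_eval_real_form: "form_eval (real_form f) x y = quartic_eval f x y"
  by (simp add: form_eval_def quartic_eval_def)

lemma form_eval_inject:
  assumes "\<And>x y. form_eval f x y = form_eval g x y"
  shows "f = g"
proof -
  have e: "f$1 * x^4 + f$2 * x^3 * y + f$3 * x^2 * y^2 + f$4 * x * y^3 + f$5 * y^4 =
     g$1 * x^4 + g$2 * x^3 * y + g$3 * x^2 * y^2 + g$4 * x * y^3 + g$5 * y^4" for x y :: real
    using assms by (simp add: form_eval_def)
  \<comment> \<open>A quartic form is determined by its values at five pairwise non-proportional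
    points.\<close>
  show ?thesis
    using e[of 1 0] e[of 0 1] e[of 1 1] e[of 1 "-1"] e[of 2 1] by (simp add: vec5_eq_iff)
qed

text \<open>The coefficients of f((x, y) g) for the matrix g with rows (p, q) and (r, s). The
  entries are real because the substitutions that move a center to \<open>\<i>\<close> are not
  integral.\<close>

definition subst_form :: "real \<Rightarrow> real \<Rightarrow> real \<Rightarrow> real \<Rightarrow> real ^ 5 \<Rightarrow> real ^ 5" where
  "subst_form p q r s f = vector [
     f$1 * p^4 + f$2 * p^3 * q + f$3 * p^2 * q^2 + f$4 * p * q^3 + f$5 * q^4,
     f$1 * (4 * p^3 * r) + f$2 * (p^3 * s + 3 * p^2 * r * q) + f$3 * (2 * p^2 * q * s + 2 * p * r * q^2)
       + f$4 * (3 * p * q^2 * s + r * q^3) + f$5 * (4 * q^3 * s),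
     f$1 * (6 * p^2 * r^2) + f$2 * (3 * p^2 * r * s + 3 * p * r^2 * q) + f$3 * (p^2 * s^2 + 4 * p * q * r * s + r^2 * q^2)
       + f$4 * (3 * p * q * s^2 + 3 * r * q^2 * s) + f$5 * (6 * q^2 * s^2),
     f$1 * (4 * p * r^3) + f$2 * (3 * p * r^2 * s + r^3 * q) + f$3 * (2 * p * r * s^2 + 2 * r^2 * q * s)
       + f$4 * (p * s^3 + 3 * r * q * s^2) + f$5 * (4 * q * s^3),
     f$1 * r^4 + f$2 * r^3 * s + f$3 * r^2 * s^2 + f$4 * r * s^3 + f$5 * s^4]"

lemma form_eval_subst: "form_eval (subst_form p q r s f) x y = form_eval f (p * x + r * y) (q * x + s * y)"
  unfolding form_eval_def subst_form_def vector_5 by algebra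

lemma subst_form_subst:
  "subst_form p q r s (subst_form p' q' r' s' f) =
     subst_form (p * p' + q * r') (p * q' + q * s') (r * p' + s * r') (r * q' + s * s') f"
  by (rule form_eval_inject) (simp add: form_eval_subst algebra_simps)

lemma subst_form_id: "subst_form 1 0 0 1 f = f"
  by (rule form_eval_inject) (simp add: form_eval_subst)

lemma subst_form_inverse:
  assumes "p * s - q * r \<noteq> 0"
  defines "D \<equiv> p * s - q * r"
  shows "subst_form p q r s (subst_form (s / D) (- q / D) (- r / D) (p / D) f) = f"
    "subst_form (s / D) (- q / D) (- r / D) (p / D) (subst_form p q r s f) = f"
proof -
  have D: "(p * s - q * r) / D = 1" using assms by simp
  have 1: "p * (s / D) + q * (- r / D) = 1" "p * (- q / D) + q * (p / D) = 0"
    "r * (s / D) + s * (- r / D) = 0" "r * (- q / D) + s * (p / D) = 1"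
    using D by (simp_all add: diff_divide_distrib mult.commute)
  have 2: "(s / D) * p + (- q / D) * r = 1" "(s / D) * q + (- q / D) * s = 0"
    "(- r / D) * p + (p / D) * r = 0" "(- r / D) * q + (p / D) * s = 1"
    using D by (simp_all add: diff_divide_distrib mult.commute)
  show "subst_form p q r s (subst_form (s / D) (- q / D) (- r / D) (p / D) f) = f"
    unfolding subst_form_subst 1 by (rule subst_form_id)
  show "subst_form (s / D) (- q / D) (- r / D) (p / D) (subst_form p q r s f) = f"
    unfolding subst_form_subst 2 by (rule subst_form_id)
qed

lemma real_form_act:
  "real_form (quartic_act \<gamma> f) = subst_form (\<gamma>$1$1) (\<gamma>$1$2) (\<gamma>$2$1) (\<gamma>$2$2) (real_form f)"
proof -
  define p q r s where "p = \<gamma>$1$1" and "q = \<gamma>$1$2" and "r = \<gamma>$2$1" and "s = \<gamma>$2$2"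
  define g :: quartic where "g = vector [
     f$1 * p^4 + f$2 * p^3 * q + f$3 * p^2 * q^2 + f$4 * p * q^3 + f$5 * q^4,
     f$1 * (4 * p^3 * r) + f$2 * (p^3 * s + 3 * p^2 * r * q) + f$3 * (2 * p^2 * q * s + 2 * p * r * q^2)
       + f$4 * (3 * p * q^2 * s + r * q^3) + f$5 * (4 * q^3 * s),
     f$1 * (6 * p^2 * r^2) + f$2 * (3 * p^2 * r * s + 3 * p * r^2 * q) + f$3 * (p^2 * s^2 + 4 * p * q * r * s + r^2 * q^2)
       + f$4 * (3 * p * q * s^2 + 3 * r * q^2 * s) + f$5 * (6 * q^2 * s^2),
     f$1 * (4 * p * r^3) + f$2 * (3 * p * r^2 * s + r^3 * q) + f$3 * (2 * p * r * s^2 + 2 * r^2 * q * s)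
       + f$4 * (p * s^3 + 3 * r * q * s^2) + f$5 * (4 * q * s^3),
     f$1 * r^4 + f$2 * r^3 * s + f$3 * r^2 * s^2 + f$4 * r * s^3 + f$5 * s^4]"
  have eq: "real_form g = subst_form p q r s (real_form f)"
    by (simp add: vec5_eq_iff g_def subst_form_def vector_5)
  have "quartic_act \<gamma> f = g"
  proof (rule quartic_eval_inject, intro allI)
    fix x y :: int
    have "real_of_int (quartic_eval g x y) = form_eval (real_form g) x y"
      by (simp add: form_eval_def quartic_eval_def)
    also have "\<dots> = real_of_int (quartic_eval f (p * x + r * y) (q * x + s * y))"
      unfolding eq form_eval_subst by (simp add: form_eval_def quartic_eval_def)
    finally have "quartic_eval g x y = quartic_eval f (p * x + r * y) (q * x + s * y)" by simp
    then show "quartic_eval (quartic_act \<gamma> f) x y = quartic_eval g x y"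
      by (simp add: quartic_eval_act Let_def vector_matrix_mult_def sum_2 p_def q_def r_def s_def mult.commute)
  qed
  with eq show ?thesis by (simp add: p_def q_def r_def s_def)
qed

section \<open>Invariants and height under real substitutions\<close>

definition form_I :: "real ^ 5 \<Rightarrow> real" where
  "form_I f = 12 * f$1 * f$5 - 3 * f$2 * f$4 + (f$3)^2"

definition form_J :: "real ^ 5 \<Rightarrow> real" where
  "form_J f = 72 * f$1 * f$3 * f$5 + 9 * f$2 * f$3 * f$4
     - 27 * f$1 * (f$4)^2 - 27 * f$5 * (f$2)^2 - 2 * (f$3)^3"

definition form_height :: "real ^ 5 \<Rightarrow> real" where
  "form_height f = max (\<bar>form_I f\<bar> ^ 3) ((form_J f)\<^sup>2 / 4)"

lemma form_height_real_form: "form_height (real_form f) = height f"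
  by (simp add: form_height_def height_def form_I_def form_J_def inv_I_def inv_J_def)

lemma form_I_subst: "form_I (subst_form p q r s f) = (p * s - q * r)^4 * form_I f"
  unfolding form_I_def subst_form_def vector_5 by algebra

lemma form_J_subst: "form_J (subst_form p q r s f) = (p * s - q * r)^6 * form_J f"
  unfolding form_J_def subst_form_def vector_5 by algebra

lemma form_height_subst: "form_height (subst_form p q r s f) = (p * s - q * r)^12 * form_height f"
proof -
  have "\<bar>form_I (subst_form p q r s f)\<bar> ^ 3 = (p * s - q * r)^12 * \<bar>form_I f\<bar> ^ 3"
    by (simp add: form_I_subst abs_mult power_mult_distrib power_abs flip: power_mult)
  moreover have "(form_J (subst_form p q r s f))\<^sup>2 / 4 = (p * s - q * r)^12 * ((form_J f)\<^sup>2 / 4)"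
    by (simp add: form_J_subst power_mult_distrib flip: power_mult)
  ultimately show ?thesis
    unfolding form_height_def by (simp add: max_mult_distrib_left)
qed

section \<open>Centers in the upper half plane\<close>

text \<open>
  In terms of the coordinate \<open>x - z y\<close> a form has components of weights \<open>0\<close>, \<open>2\<close> and \<open>4\<close> under rotation
  about \<open>z\<close>. For \<open>k = 2\<close> the component of weight \<open>4\<close> vanishes, that is, \<open>z\<close> is a root; for \<open>k = 4\<close> the
  component of weight \<open>2\<close> vanishes, that is, \<open>f\<close> is fixed by the rotation by \<open>\<pi>\<close> about \<open>z\<close>.
\<close>

definition rep :: "nat \<Rightarrow> real ^ 5 \<Rightarrow> complex \<Rightarrow> real \<Rightarrow> complex \<Rightarrow> bool" where
  "rep k f z w0 w \<longleftrightarrow> (\<forall>x y. form_eval f x y =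
     w0 * cmod (of_real x - z * of_real y) ^ 4
       + cmod (of_real x - z * of_real y) ^ (4 - k) * Re (w * (of_real x - z * of_real y) ^ k))"

definition weight :: "nat \<Rightarrow> nat" where
  "weight i = (if i = 1 then 2 else 4)"

text \<open>For z = \<open>\<i>\<close> the form is w0 + Re (w e^(k i t)) on the unit circle. It has
  k real roots if |w0| < |w|, and none if |w| < |w0|; so these inequalities single out the forms
  with \<open>4 - 2 * i\<close> real roots. In the case of equality the discriminant
  vanishes.\<close>

definition admissible :: "nat \<Rightarrow> real \<Rightarrow> complex \<Rightarrow> bool" where
  "admissible i w0 w \<longleftrightarrow> (if i = 2 then cmod w < \<bar>w0\<bar> else \<bar>w0\<bar> < cmod w)"

definition center :: "nat \<Rightarrow> real ^ 5 \<Rightarrow> complex \<Rightarrow> bool" where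
  "center i f z \<longleftrightarrow> Im z > 0 \<and> (\<exists>w0 w. admissible i w0 w \<and> rep (weight i) f z w0 w)"

text \<open>The form with center \<open>\<i>\<close>, written out: w0 |u|^4 + Re (w u^4) for
  \<open>k = 4\<close> and w0 |u|^4 + |u|^2 Re (w u^2) for \<open>k = 2\<close>, where u = x - i y.
  \<open>Psi\<close> moves the center to z.\<close>

definition base_form :: "nat \<Rightarrow> real \<Rightarrow> complex \<Rightarrow> real ^ 5" where
  "base_form k w0 w =
     (if k = 4 then vector [w0 + Re w, 4 * Im w, 2 * w0 - 6 * Re w, - 4 * Im w, w0 + Re w]
      else vector [w0 + Re w, 2 * Im w, 2 * w0, 2 * Im w, w0 - Re w])"

definition Psi :: "nat \<Rightarrow> complex \<Rightarrow> real \<Rightarrow> complex \<Rightarrow> real ^ 5" where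
  "Psi k z w0 w = subst_form 1 0 (- Re z) (Im z) (base_form k w0 w)"

lemma weight_cases: "weight i = 2 \<or> weight i = 4"
  by (simp add: weight_def)

lemma form_eval_base_form:
  assumes "k = 2 \<or> k = 4"
  shows "form_eval (base_form k w0 w) X Y =
    w0 * cmod (Complex X (- Y)) ^ 4 + cmod (Complex X (- Y)) ^ (4 - k) * Re (w * Complex X (- Y) ^ k)"
proof -
  have c2: "cmod (Complex X (- Y)) ^ 2 = X^2 + Y^2" by (simp add: cmod_power2)
  have c4: "cmod (Complex X (- Y)) ^ 4 = (X^2 + Y^2)^2"
    using c2 by (metis mult_2_right numeral_Bit0 power_mult power2_eq_square power_even_eq)
  have s2: "Complex X (- Y) ^ 2 = Complex (X^2 - Y^2) (- 2 * X * Y)"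
    by (simp add: complex_eq_iff power2_eq_square)
  have "Complex X (- Y) ^ 4 = (Complex X (- Y) ^ 2)^2" by simp
  also have "\<dots> = Complex ((X^2 - Y^2)^2 - 4 * X^2 * Y^2) (- 4 * X * Y * (X^2 - Y^2))"
    unfolding s2 by (simp add: complex_eq_iff power2_eq_square algebra_simps)
  finally have s4: "Complex X (- Y) ^ 4 = Complex ((X^2 - Y^2)^2 - 4 * X^2 * Y^2) (- 4 * X * Y * (X^2 - Y^2))" .
  from assms show ?thesis
  proof
    assume "k = 2"
    then show ?thesis unfolding \<open>k = 2\<close>
      by (simp add: s2 c2 c4 form_eval_def base_form_def vector_5) algebra
  next
    assume "k = 4"
    then show ?thesis unfolding \<open>k = 4\<close>
      by (simp add: s4 c4 form_eval_def base_form_def vector_5) algebra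
  qed
qed

lemma rep_iff:
  assumes "k = 2 \<or> k = 4"
  shows "rep k f z w0 w \<longleftrightarrow> f = Psi k z w0 w"
proof -
  have e: "of_real x - z * of_real y = Complex (x - Re z * y) (- (Im z * y))" for x y
    by (simp add: complex_eq_iff)
  have "form_eval (Psi k z w0 w) x y =
     w0 * cmod (of_real x - z * of_real y) ^ 4
       + cmod (of_real x - z * of_real y) ^ (4 - k) * Re (w * (of_real x - z * of_real y) ^ k)" for x y
    unfolding e using form_eval_base_form[OF assms, of w0 w "x - Re z * y" "Im z * y"]
    by (simp add: Psi_def form_eval_subst)
  then show ?thesis unfolding rep_def using form_eval_inject by metis
qed

lemma rep_cnj:
  assumes "rep k f z w0 w"
  shows "rep k f (cnj z) w0 (cnj w)"
proof -
  have "Re (cnj w * cnj a ^ k) = Re (w * a ^ k)" for a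
    using cnj.sel(1)[of "w * a ^ k"] by (simp only: complex_cnj_mult complex_cnj_power)
  moreover have "of_real x - cnj z * of_real y = cnj (of_real x - z * of_real y)" for x y by simp
  ultimately show ?thesis using assms unfolding rep_def by (simp only: complex_mod_cnj simp_thms)
qed

text \<open>The substitution turns x - z y into \<open>c\<close> times x - z' y, where z' is the
  image of z. So the weights are preserved, both \<open>w0\<close> and |w| are multiplied by |c|^4,
  and w acquires the phase of c^k.\<close>

lemma rep_subst:
  fixes p q r s :: real
  assumes "rep k f z w0 w" "k \<le> 4"
  defines "c \<equiv> of_real p - z * of_real q"
  assumes c: "c \<noteq> 0"
  shows "rep k (subst_form p q r s f) ((z * of_real s - of_real r) / c)
    (cmod c ^ 4 * w0) (of_real (cmod c ^ (4 - k)) * c ^ k * w)"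
  unfolding rep_def
proof (intro allI)
  fix x y :: real
  let ?z = "(z * of_real s - of_real r) / c"
  have e: "of_real (p * x + r * y) - z * of_real (q * x + s * y) = c * (of_real x - ?z * of_real y)"
    using c by (simp add: field_simps) (simp add: c_def algebra_simps)
  have "form_eval (subst_form p q r s f) x y = form_eval f (p * x + r * y) (q * x + s * y)"
    by (rule form_eval_subst)
  also have "\<dots> = w0 * cmod (c * (of_real x - ?z * of_real y)) ^ 4
       + cmod (c * (of_real x - ?z * of_real y)) ^ (4 - k) * Re (w * (c * (of_real x - ?z * of_real y)) ^ k)"
    using assms(1) unfolding rep_def by (simp only: e)
  also have "w * (c * (of_real x - ?z * of_real y)) ^ k = c ^ k * w * (of_real x - ?z * of_real y) ^ k"
    by (simp add: power_mult_distrib)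
  finally show "form_eval (subst_form p q r s f) x y = cmod c ^ 4 * w0 * cmod (of_real x - ?z * of_real y) ^ 4
       + cmod (of_real x - ?z * of_real y) ^ (4 - k) *
         Re (of_real (cmod c ^ (4 - k)) * c ^ k * w * (of_real x - ?z * of_real y) ^ k)"
    by (simp add: norm_mult power_mult_distrib mult.assoc del: of_real_power)
qed

lemma Im_moebius:
  "Im ((z * of_real s - of_real r) / (of_real p - z * of_real q)) =
     (p * s - q * r) * Im z / (cmod (of_real p - z * of_real q))\<^sup>2"
  unfolding Im_divide cmod_power2 by (simp add: power2_eq_square algebra_simps flip: diff_divide_distrib)

lemma moebius_denominator_nonzero:
  assumes "Im z \<noteq> 0" "p * s - q * r \<noteq> 0"
  shows "of_real p - z * of_real q \<noteq> 0"
proof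
  assume "of_real p - z * of_real q = 0"
  then have "Re (of_real p - z * of_real q) = 0" "Im (of_real p - z * of_real q) = 0" by simp_all
  with assms show False by auto
qed

lemma admissible_scale:
  assumes "admissible i w0 w" "c \<noteq> 0" "k \<le> 4"
  shows "admissible i (cmod c ^ 4 * w0) (of_real (cmod c ^ (4 - k)) * c ^ k * w)"
proof -
  have "cmod (of_real (cmod c ^ (4 - k)) * c ^ k * w) = cmod c ^ 4 * cmod w"
    using assms(3) by (simp add: norm_mult norm_power flip: power_add)
  then show ?thesis using assms(1,2) by (simp add: admissible_def abs_mult)
qed

lemma center_subst_pos:
  assumes "center i f z" "p * s - q * r > 0"
  shows "center i (subst_form p q r s f) ((z * of_real s - of_real r) / (of_real p - z * of_real q))"
proof -
  obtain w0 w where w: "Im z > 0" "admissible i w0 w" "rep (weight i) f z w0 w"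
    using assms(1) by (auto simp: center_def)
  have c: "of_real p - z * of_real q \<noteq> 0"
    using moebius_denominator_nonzero[of z p s q r] w assms by auto
  have k: "weight i \<le> 4" by (simp add: weight_def)
  have "Im ((z * of_real s - of_real r) / (of_real p - z * of_real q)) > 0"
    unfolding Im_moebius using w assms(2) c by simp
  then show ?thesis
    unfolding center_def using rep_subst[OF w(3) k c] admissible_scale[OF w(2) c k] by blast
qed

lemma center_subst_neg:
  assumes "center i f z" "p * s - q * r < 0"
  shows "center i (subst_form p q r s f) (cnj ((z * of_real s - of_real r) / (of_real p - z * of_real q)))"
proof -
  obtain w0 w where w: "Im z > 0" "admissible i w0 w" "rep (weight i) f z w0 w"
    using assms(1) by (auto simp: center_def)
  have c: "of_real p - z * of_real q \<noteq> 0"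
    using moebius_denominator_nonzero[of z p s q r] w assms by auto
  have k: "weight i \<le> 4" by (simp add: weight_def)
  have "Im ((z * of_real s - of_real r) / (of_real p - z * of_real q)) < 0"
    unfolding Im_moebius using w assms(2) c by (simp add: divide_neg_pos mult_neg_pos)
  moreover have "admissible i a (cnj b) = admissible i a b" for a b by (simp add: admissible_def)
  ultimately show ?thesis
    unfolding center_def using rep_cnj[OF rep_subst[OF w(3) k c]] admissible_scale[OF w(2) c k]
    by (metis cnj.sel(2) neg_0_less_iff_less)
qed

text \<open>A rotation about z only changes the phase of \<open>w\<close>, so I and J depend on
  \<open>w0\<close> and |w| alone; the powers of Im z come from the determinant of the substitution
  in \<open>Psi\<close>.\<close>

lemma form_invariants_Psi:
  fixes z w :: complex and w0 :: real
  assumes "k = 2 \<or> k = 4"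
  defines "\<sigma> \<equiv> (Im z)^2 * w0" and "\<tau> \<equiv> (Im z)^2 * cmod w"
  shows "form_I (Psi k z w0 w) = (if k = 4 then 16 * \<sigma>^2 + 48 * \<tau>^2 else 16 * \<sigma>^2 - 12 * \<tau>^2)"
    "form_J (Psi k z w0 w) = (if k = 4 then 128 * \<sigma>^3 - 1152 * \<sigma> * \<tau>^2 else 128 * \<sigma>^3 - 144 * \<sigma> * \<tau>^2)"
proof -
  have t: "\<tau>^2 = (Im z)^4 * ((Re w)^2 + (Im w)^2)"
    by (simp add: \<tau>_def power_mult_distrib cmod_power2 flip: power_mult)
  have I: "form_I (Psi k z w0 w) = (Im z)^4 * form_I (base_form k w0 w)"
    by (simp add: Psi_def form_I_subst)
  have J: "form_J (Psi k z w0 w) = (Im z)^6 * form_J (base_form k w0 w)"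
    by (simp add: Psi_def form_J_subst)
  have b: "form_I (base_form 4 w0 w) = 16 * w0^2 + 48 * ((Re w)^2 + (Im w)^2)"
    "form_I (base_form 2 w0 w) = 16 * w0^2 - 12 * ((Re w)^2 + (Im w)^2)"
    "form_J (base_form 4 w0 w) = 128 * w0^3 - 1152 * w0 * ((Re w)^2 + (Im w)^2)"
    "form_J (base_form 2 w0 w) = 128 * w0^3 - 144 * w0 * ((Re w)^2 + (Im w)^2)"
    unfolding form_I_def form_J_def base_form_def
    by (simp_all add: vector_5) algebra+
  show "form_I (Psi k z w0 w) = (if k = 4 then 16 * \<sigma>^2 + 48 * \<tau>^2 else 16 * \<sigma>^2 - 12 * \<tau>^2)"
    using assms(1)
  proof
    assume k: "k = 2"
    show ?thesis unfolding I t \<sigma>_def unfolding k by (simp add: b) algebra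
  next
    assume k: "k = 4"
    show ?thesis unfolding I t \<sigma>_def unfolding k by (simp add: b) algebra
  qed
  show "form_J (Psi k z w0 w) = (if k = 4 then 128 * \<sigma>^3 - 1152 * \<sigma> * \<tau>^2 else 128 * \<sigma>^3 - 144 * \<sigma> * \<tau>^2)"
    using assms(1)
  proof
    assume k: "k = 2"
    show ?thesis unfolding J t \<sigma>_def unfolding k by (simp add: b) algebra
  next
    assume k: "k = 4"
    show ?thesis unfolding J t \<sigma>_def unfolding k by (simp add: b) algebra
  qed
qed

text \<open>27 times the discriminant of the form.\<close>

definition form_disc :: "real ^ 5 \<Rightarrow> real" where
  "form_disc f = 4 * form_I f ^ 3 - form_J f ^ 2"

lemma form_disc_Psi:
  fixes z w :: complex and w0 :: real
  assumes "k = 2 \<or> k = 4"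
  defines "\<sigma> \<equiv> (Im z)^2 * w0" and "\<tau> \<equiv> (Im z)^2 * cmod w"
  shows "form_disc (Psi k z w0 w) =
    (if k = 4 then 442368 * \<tau>^2 * (\<sigma>^2 - \<tau>^2)^2 else 6912 * \<tau>^4 * (\<sigma>^2 - \<tau>^2))"
  unfolding form_disc_def form_invariants_Psi[OF assms(1)] \<sigma>_def[symmetric] \<tau>_def[symmetric]
  by (auto simp: power2_eq_square power3_eq_cube power4_eq_xxxx algebra_simps)

section \<open>Uniqueness of the center\<close>

lemma base_form_inject:
  assumes "base_form k w0 w = base_form k w0' w'"
  shows "w0 = w0' \<and> w = w'"
  using assms by (auto simp: base_form_def vec5_eq_iff vector_5 complex_eq_iff split: if_splits)

lemma Psi_inject:
  assumes "Psi k z w0 w = Psi k z w0' w'" "Im z \<noteq> 0"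
  shows "w0 = w0' \<and> w = w'"
proof (rule base_form_inject)
  have "1 * Im z - 0 * (- Re z) \<noteq> 0" using assms by simp
  from subst_form_inverse(2)[OF this] show "base_form k w0 w = base_form k w0' w'"
    using assms(1) unfolding Psi_def by metis
qed

text \<open>With z = u + i v, the vanishing of the component of weight 2 at z amounts to two real
  equations in u and v. A combination of them has the positive factor u^2 + v^2 + 1; what remains
  forces u = 0 and v = 1 unless |w| = |w0|.\<close>

lemma Psi4_center_unique_at_i:
  assumes "base_form 4 w0 w = Psi 4 z w0' w'" "Im z > 0" "cmod w \<noteq> \<bar>w0\<bar>"
  shows "z = \<i>"
proof -
  define u v where "u = Re z" and "v = Im z"
  define a b c where "a = w0 + Re w" and "b = 4 * Im w" and "c = 2 * w0 - 6 * Re w"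
  have v: "v > 0" using assms by (simp add: v_def)
  define g where "g = Psi 4 z w0' w'"
  have g: "g$1 = a" "g$2 = b" "g$3 = c" "g$4 = - b" "g$5 = a"
    using assms(1) by (auto simp: g_def base_form_def vec5_eq_iff vector_5 a_def b_def c_def)
  have G: "g$4 + (4 * g$1 * u + g$2) * v^2 + 4 * g$1 * u^3 + 3 * g$2 * u^2 + 2 * g$3 * u = 0"
    "g$1 * u^4 + g$2 * u^3 + g$3 * u^2 + g$4 * u + g$5 = g$1 * v^4"
    unfolding g_def Psi_def subst_form_def base_form_def vector_5 u_def[symmetric] v_def[symmetric]
    by (simp_all add: vector_5) algebra+
  have e1: "4*a*u^3 + 3*b*u^2 + 2*c*u - b = - (4*a*u + b) * v^2" using G(1) g by simp algebra
  have e2: "a*u^4 + b*u^3 + c*u^2 - b*u + a = a * v^4" using G(2) g by simp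
  have "(u^2 + v^2 + 1) * (2*a*(u^2+v^2-1) + b*u) = 0" using e1 e2 by algebra
  moreover have "u^2 + v^2 + 1 > 0" by (simp add: add_nonneg_pos)
  ultimately have e3: "2*a*(u^2+v^2-1) + b*u = 0" by simp
  \<comment> \<open>Up to a positive constant this is w0^2 - |w|^2.\<close>
  have ne: "16 * (8*a*a + 4*a*c - b*b) \<noteq> 0"
  proof
    assume "16 * (8*a*a + 4*a*c - b*b) = 0"
    then have "(Re w)^2 + (Im w)^2 = w0^2" unfolding a_def b_def c_def by algebra
    then have "(cmod w)^2 = \<bar>w0\<bar>^2" by (simp add: cmod_power2)
    then show False using assms(3) power2_eq_imp_eq[of "cmod w" "\<bar>w0\<bar>"] by simp
  qed
  have u0: "u = 0"
  proof (rule ccontr)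
    assume u: "u \<noteq> 0"
    have "2*c*u = - (b * (u^2+v^2-1)) - 4*a*u" using e1 e3 u by algebra
    then have "u * u * (8*a*a + 4*a*c - b*b) = 0" using e3 by algebra
    then show False using u ne by simp
  qed
  have "v^2 = 1"
  proof (rule ccontr)
    assume "v^2 \<noteq> 1"
    then have "a = 0" using e3 u0 by simp
    moreover have "b * (v^2 - 1) = 0" using e1 u0 by (simp add: algebra_simps)
    then have "b = 0" using \<open>v^2 \<noteq> 1\<close> by simp
    ultimately show False using ne by simp
  qed
  then have "v = 1" using v by (simp add: power2_eq_1_iff)
  with u0 show ?thesis by (simp add: u_def v_def complex_eq_iff)
qed

text \<open>The form is x^2 + y^2 times a quadratic form, and z is one of its roots. As |w0| < |w|,
  the quadratic form has positive discriminant, so its roots are real and z must be a root of the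
  first factor.\<close>

lemma Psi2_center_unique_at_i:
  assumes "base_form 2 w0 w = Psi 2 z w0' w'" "Im z > 0" "\<bar>w0\<bar> < cmod w"
  shows "z = \<i>"
proof -
  define u v where "u = Re z" and "v = Im z"
  define \<alpha> \<beta> \<gamma> where "\<alpha> = w0 + Re w" and "\<beta> = 2 * Im w" and "\<gamma> = w0 - Re w"
  have v: "v > 0" using assms by (simp add: v_def)
  define g where "g = Psi 2 z w0' w'"
  have g: "g$1 = \<alpha>" "g$2 = \<beta>" "g$3 = \<alpha> + \<gamma>" "g$4 = \<beta>" "g$5 = \<gamma>"
    using assms(1) by (auto simp: g_def base_form_def vec5_eq_iff vector_5 \<alpha>_def \<beta>_def \<gamma>_def)
  \<comment> \<open>\<open>?P\<close> and \<open>?Q\<close> are the real and the imaginary part of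
    the form at (z, 1).\<close>
  let ?P = "g$1 * (u^4 - 6*u^2* v^2 + v^4) + g$2 * (u^3 - 3*u* v^2) + g$3 * (u^2 - v^2) + g$4 * u + g$5"
  let ?Q = "g$1 * (4*u^3* v - 4*u* v^3) + g$2 * (3*u^2* v - v^3) + g$3 * (2*u* v) + g$4 * v"
  have G: "?P = 0" "?Q = 0"
    unfolding g_def Psi_def subst_form_def base_form_def vector_5 u_def[symmetric] v_def[symmetric]
    by (simp_all add: vector_5) algebra+
  \<comment> \<open>A + i B is the value of the quadratic factor at z, while u^2 - v^2 + 1 + 2 u v i
    is z^2 + 1.\<close>
  define A B where "A = \<alpha> * (u^2 - v^2) + \<beta> * u + \<gamma>" and "B = \<alpha> * (2*u* v) + \<beta> * v"
  have 1: "(u^2 - v^2 + 1) * A - 2*u* v * B = 0" using G(1) unfolding g A_def B_def by algebra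
  have 2: "(u^2 - v^2 + 1) * B + 2*u* v * A = 0" using G(2) unfolding g A_def B_def by algebra
  have "((u^2 - v^2 + 1)^2 + (2*u* v)^2) * (A^2 + B^2) = 0" using 1 2 by algebra
  moreover have "A^2 + B^2 \<noteq> 0"
  proof
    assume "A^2 + B^2 = 0"
    then have "A = 0" "B = 0" by (simp_all add: sum_power2_eq_zero_iff)
    then have "v * (2 * \<alpha> * u + \<beta>) = 0" unfolding B_def by algebra
    then have b: "\<beta> = - 2 * \<alpha> * u" using v by simp
    then have c: "\<gamma> = \<alpha> * (u^2 + v^2)" using \<open>A = 0\<close> unfolding A_def by algebra
    have "\<beta>^2 - 4*\<alpha>*\<gamma> = - ((2*\<alpha>* v)^2)" unfolding b c by algebra
    then have "\<beta>^2 - 4*\<alpha>*\<gamma> \<le> 0" by simp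
    moreover have "\<beta>^2 - 4*\<alpha>*\<gamma> = 4 * ((cmod w)^2 - \<bar>w0\<bar>^2)"
      unfolding cmod_power2 power2_abs \<alpha>_def \<beta>_def \<gamma>_def by algebra
    ultimately show False using assms(3) power_strict_mono[OF assms(3), of 2] by simp
  qed
  ultimately have "u^2 - v^2 + 1 = 0" "u * v = 0" by (auto simp: sum_power2_eq_zero_iff)
  then have "u = 0" "v^2 = 1" using v by auto
  then have "v = 1" using v by (simp add: power2_eq_1_iff)
  with \<open>u = 0\<close> show ?thesis by (simp add: u_def v_def complex_eq_iff)
qed

lemma center_iff_Psi:
  "center i f z \<longleftrightarrow> Im z > 0 \<and> (\<exists>w0 w. admissible i w0 w \<and> f = Psi (weight i) z w0 w)"
  by (simp add: center_def rep_iff[OF weight_cases])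

lemma Psi_i: "Psi k \<i> w0 w = base_form k w0 w"
  by (simp add: Psi_def subst_form_id)

text \<open>A substitution moves the first center to \<open>\<i>\<close>, where the two explicit
  computations apply. Only the weights have to agree, so that the types 0 and 2 can be compared with
  each other.\<close>

lemma center_unique_weight:
  assumes z: "center i f z" and z': "center j f z'" and k: "weight i = weight j"
  shows "z = z'"
proof -
  have v: "Im z > 0" "Im z' > 0" using z z' by (auto simp: center_def)
  let ?g = "subst_form (Im z) 0 (Re z) 1 f"
  have *: "(z * of_real 1 - of_real (Re z)) / (of_real (Im z) - z * of_real 0) = \<i>"
    using v by (simp add: complex_eq_iff Re_divide Im_divide power2_eq_square)
  have pos: "Im z * 1 - 0 * Re z > 0" using v by simp
  have 1: "center i ?g \<i>" using center_subst_pos[OF z pos] unfolding * .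
  let ?w = "(z' * of_real 1 - of_real (Re z)) / (of_real (Im z) - z' * of_real 0)"
  have 2: "center j ?g ?w" by (rule center_subst_pos[OF z' pos])
  have "?w = \<i>"
  proof -
    obtain w0 w where w: "admissible i w0 w" "?g = base_form (weight i) w0 w"
      using 1 by (auto simp: center_iff_Psi Psi_i)
    obtain w0' w' where w': "Im ?w > 0" "?g = Psi (weight i) ?w w0' w'"
      using 2 k unfolding center_iff_Psi by metis
    have e: "base_form (weight i) w0 w = Psi (weight i) ?w w0' w'" using w w' by simp
    show ?thesis
    proof (cases "i = 1")
      case True
      then show ?thesis
        using Psi2_center_unique_at_i[OF _ w'(1)] e w(1) by (simp add: weight_def admissible_def)
    next
      case False
      have "cmod w \<noteq> \<bar>w0\<bar>" using w(1) by (auto simp: admissible_def split: if_splits)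
      then show ?thesis
        using Psi4_center_unique_at_i[OF _ w'(1)] e False by (simp add: weight_def)
    qed
  qed
  then show ?thesis using v by (simp add: field_simps) (simp add: complex_eq_iff)
qed

text \<open>The sign of the discriminant separates type 1 from the others. Types 0 and 2 have the
  same weight, hence would share the center, \<open>w0\<close> and \<open>w\<close>, but they
  require opposite inequalities.\<close>

lemma center_type_unique:
  assumes z: "center i f z" and z': "center j f z'" and ij: "i \<in> {0,1,2}" "j \<in> {0,1,2}"
  shows "i = j"
proof -
  have disc1: "form_disc f < 0" if c: "center 1 f z" for z
  proof -
    obtain w0 w where w: "Im z > 0" "\<bar>w0\<bar> < cmod w" "f = Psi 2 z w0 w"
      using c by (auto simp: center_iff_Psi weight_def admissible_def)
    have "w0^2 < (cmod w)^2" using power_strict_mono[OF w(2), of 2] by simp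
    then have "((Im z)^2 * w0)^2 < ((Im z)^2 * cmod w)^2"
      using w(1) by (simp add: power_mult_distrib)
    moreover have "cmod w \<noteq> 0" using w(2) by auto
    then have "0 < ((Im z)^2 * cmod w)^4" using w(1) by simp
    ultimately show ?thesis unfolding w(3) form_disc_Psi[of 2, simplified] by (simp add: mult_pos_neg)
  qed
  have disc4: "form_disc f \<ge> 0" if c: "center i f z" "i \<noteq> 1" for i z
  proof -
    obtain w0 w where "f = Psi 4 z w0 w"
      using c by (auto simp: center_iff_Psi weight_def)
    then show ?thesis by (simp add: form_disc_Psi[of 4, simplified])
  qed
  show ?thesis
  proof (cases "weight i = weight j")
    case True
    then have "z = z'" using center_unique_weight z z' by blast
    then obtain w0 w w0' w' where w: "Im z > 0" "admissible i w0 w" "admissible j w0' w'"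
      "Psi (weight i) z w0 w = Psi (weight i) z w0' w'"
      using z z' True unfolding center_iff_Psi by metis
    have "w0 = w0' \<and> w = w'" using Psi_inject[OF w(4)] w(1) by simp
    then have "w0' = w0" "w' = w" by simp_all
    then show ?thesis using w True ij by (auto simp: admissible_def weight_def split: if_splits)
  next
    case False
    then show ?thesis using disc1 disc4 z z' ij
      by (metis less_le_not_le weight_def)
  qed
qed

lemma center_unique:
  assumes "center i f z" "center i f z'" shows "z = z'"
  using center_unique_weight[OF assms] by simp

section \<open>Size of the coefficients in terms of the center\<close>

text \<open>If l^6 bounds the height, then |I| <= l^2 and |J| <= 2 l^3. For weight 4 the invariant I
  is positive definite in (Im z)^2 w0 and (Im z)^2 |w|, which settles this case. For weight 2 it is
  indefinite, and J has to be used as well.\<close>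

lemma center_parameter_bounds:
  assumes H: "form_height (Psi k z w0 w) \<le> l^6" and l: "l \<ge> 0" and k: "k = 2 \<or> k = 4"
  shows "(Im z)^2 * \<bar>w0\<bar> \<le> l" "(Im z)^2 * cmod w \<le> l"
proof -
  define \<sigma> \<tau> where "\<sigma> = (Im z)^2 * w0" and "\<tau> = (Im z)^2 * cmod w"
  define I J where "I = form_I (Psi k z w0 w)" and "J = form_J (Psi k z w0 w)"
  have I: "I = (if k = 4 then 16 * \<sigma>^2 + 48 * \<tau>^2 else 16 * \<sigma>^2 - 12 * \<tau>^2)"
    and J: "J = (if k = 4 then 128 * \<sigma>^3 - 1152 * \<sigma> * \<tau>^2 else 128 * \<sigma>^3 - 144 * \<sigma> * \<tau>^2)"
    unfolding I_def J_def \<sigma>_def \<tau>_def by (rule form_invariants_Psi[OF k])+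
  have "\<bar>I\<bar>^3 \<le> (l^2)^3" "J^2 \<le> (2 * l^3)^2"
    using H unfolding form_height_def I_def[symmetric] J_def[symmetric]
    by (simp_all add: power_mult_distrib flip: power_mult)
  then have Ib: "\<bar>I\<bar> \<le> l^2" and Jb: "\<bar>J\<bar> \<le> 2 * l^3"
    using l by (metis power_mono_iff abs_ge_zero zero_le_power pos2 zero_less_numeral,
       metis abs_le_square_iff abs_of_nonneg mult_nonneg_nonneg zero_le_numeral zero_le_power)
  have "\<bar>\<sigma>\<bar> \<le> l \<and> \<tau>^2 \<le> l^2"
  proof (cases "k = 4")
    case True
    have "\<sigma>^2 \<ge> 0" "\<tau>^2 \<ge> 0" "16 * \<sigma>^2 + 48 * \<tau>^2 \<le> l^2" using Ib I True by auto
    then have "\<sigma>^2 \<le> l^2" "\<tau>^2 \<le> l^2" by linarith+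
    then show ?thesis using l abs_le_square_iff[of \<sigma> l] by simp
  next
    case False
    \<comment> \<open>Eliminating \<tau> leaves a cubic inequality for |\<sigma>|; the difference of
      its two sides is 2 |\<sigma>| - l times a square.\<close>
    have "J = 12 * \<sigma> * I - 64 * \<sigma>^3" 
    proof -
      have "I = 16 * \<sigma>^2 - 12 * \<tau>^2" "J = 128 * \<sigma>^3 - 144 * \<sigma> * \<tau>^2" using I J False by simp_all
      then show ?thesis by algebra
    qed
    then have "64 * \<bar>\<sigma>\<bar>^3 = \<bar>12 * \<sigma> * I - J\<bar>" by (simp add: power_abs abs_mult)
    also have "\<dots> \<le> 12 * \<bar>\<sigma>\<bar> * \<bar>I\<bar> + \<bar>J\<bar>" by (rule order_trans[OF abs_triangle_ineq4]) (simp add: abs_mult)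
    also have "\<dots> \<le> 12 * \<bar>\<sigma>\<bar> * l^2 + 2 * l^3"
      using Ib Jb by (intro add_mono mult_left_mono) auto
    finally have le: "64 * \<bar>\<sigma>\<bar>^3 \<le> 12 * \<bar>\<sigma>\<bar> * l^2 + 2 * l^3" .
    have s: "\<bar>\<sigma>\<bar> \<le> l / 2"
    proof (rule ccontr)
      assume n: "\<not> \<bar>\<sigma>\<bar> \<le> l / 2"
      have "2 * (2 * \<bar>\<sigma>\<bar> - l) * (4 * \<bar>\<sigma>\<bar> + l)^2 > 0" using n l by (intro mult_pos_pos) auto
      moreover have "2 * (2 * \<bar>\<sigma>\<bar> - l) * (4 * \<bar>\<sigma>\<bar> + l)^2 = 64 * \<bar>\<sigma>\<bar>^3 - (12 * \<bar>\<sigma>\<bar> * l^2 + 2 * l^3)"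
        by algebra
      ultimately show False using le by linarith
    qed
    have "\<sigma>^2 \<le> (l/2)^2" using s l by (metis abs_le_square_iff abs_of_nonneg divide_nonneg_nonneg zero_le_numeral)
    then have "12 * \<tau>^2 \<le> 5 * l^2" using I False Ib by (auto simp: power_divide)
    then have "\<tau>^2 \<le> l^2" using zero_le_power2[of l] by linarith
    then show ?thesis using s l by simp
  qed
  moreover have "\<tau> \<ge> 0" by (simp add: \<tau>_def)
  ultimately show "(Im z)^2 * \<bar>w0\<bar> \<le> l" "(Im z)^2 * cmod w \<le> l"
    using l by (auto simp: \<sigma>_def \<tau>_def abs_mult power2_le_iff_abs_le abs_le_square_iff[symmetric])
qed

lemma base_form_bound:
  assumes "\<bar>w0\<bar> \<le> M" "cmod w \<le> M"
  shows "\<bar>base_form k w0 w $ j\<bar> \<le> 8 * M"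
proof -
  have "\<bar>Re w\<bar> \<le> M" "\<bar>Im w\<bar> \<le> M" using assms abs_Re_le_cmod[of w] abs_Im_le_cmod[of w] by linarith+
  then show ?thesis using assms exhaust_5[of j] by (auto simp: base_form_def vector_5)
qed

lemma subst_form_triangular:
  "subst_form 1 0 (t * v) v g = vector [g$1, v * (4 * (t * g$1) + g$2),
    v^2 * (6 * (t^2 * g$1) + 3 * (t * g$2) + g$3),
    v^3 * (4 * (t^3 * g$1) + 3 * (t^2 * g$2) + 2 * (t * g$3) + g$4),
    v^4 * (t^4 * g$1 + t^3 * g$2 + t^2 * g$3 + t * g$4 + g$5)]"
  by (simp add: vec5_eq_iff subst_form_def vector_5 power_mult_distrib algebra_simps
      power2_eq_square power3_eq_cube power4_eq_xxxx)

text \<open>f arises from a form of size l / v^2 with center \<open>\<i>\<close> by a shear with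
  bounded parameter \<open>t\<close> and the scaling of y by v. So the coefficient of x^(4-j) y^j
  has size v^(j-2) l.\<close>

lemma center_box:
  assumes c: "center i f z" and H: "form_height f \<le> l^6" and l: "l \<ge> 0" and u: "\<bar>Re z\<bar> \<le> 2 * Im z"
  shows "(Im z)^2 * \<bar>f$1\<bar> \<le> 400 * l" "Im z * \<bar>f$2\<bar> \<le> 400 * l" "\<bar>f$3\<bar> \<le> 400 * l"
    "\<bar>f$4\<bar> \<le> 400 * l * Im z" "\<bar>f$5\<bar> \<le> 400 * l * (Im z)^2"
proof -
  obtain w0 w where v: "Im z > 0" and f: "f = Psi (weight i) z w0 w"
    using c by (auto simp: center_iff_Psi)
  define v where "v = Im z"
  define t where "t = - Re z / v"
  define M where "M = l / v^2"
  have v0: "v > 0" using v by (simp add: v_def)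
  have t: "\<bar>t\<bar> \<le> 2" "- Re z = t * v" using u v by (simp_all add: t_def v_def divide_le_eq)
  have "v^2 * \<bar>w0\<bar> \<le> l" "v^2 * cmod w \<le> l"
    using center_parameter_bounds[OF H[unfolded f] l weight_cases] by (simp_all add: v_def)
  then have "\<bar>w0\<bar> \<le> M" "cmod w \<le> M" using v0 by (simp_all add: M_def field_simps)
  then have g: "\<bar>base_form (weight i) w0 w $ j\<bar> \<le> 8 * M" for j by (rule base_form_bound)
  define g where "g = base_form (weight i) w0 w"
  have M0: "M \<ge> 0" using l by (simp add: M_def)
  have pt: "\<bar>t^n * x\<bar> \<le> 2^n * \<bar>x\<bar>" for n x
    using power_mono[OF t(1), of n] by (simp add: abs_mult power_abs mult_right_mono)
  have gb: "\<bar>g$j\<bar> \<le> 8 * M" for j using g by (simp add: g_def)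
  have "f = subst_form 1 0 (t * v) v g"
    unfolding f Psi_def t(2) g_def by (simp add: v_def)
  then have fs: "f$1 = g$1" "f$2 = v * (4 * (t * g$1) + g$2)"
    "f$3 = v^2 * (6 * (t^2 * g$1) + 3 * (t * g$2) + g$3)"
    "f$4 = v^3 * (4 * (t^3 * g$1) + 3 * (t^2 * g$2) + 2 * (t * g$3) + g$4)"
    "f$5 = v^4 * (t^4 * g$1 + t^3 * g$2 + t^2 * g$3 + t * g$4 + g$5)"
    by (simp_all only: subst_form_triangular vector_5)
  have pg: "\<bar>t^n * g$j\<bar> \<le> 2^n * (8 * M)" for n j
    using order_trans[OF pt mult_left_mono[OF gb[of j]]] by simp
  note ab = pg[of 1, unfolded abs_le_iff] pg[of 2, unfolded abs_le_iff] pg[of 3, unfolded abs_le_iff]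
    pg[of 4, unfolded abs_le_iff] gb[unfolded abs_le_iff]
  have M: "v^2 * M = l" using v0 by (simp add: M_def)
  have b1: "\<bar>f$1\<bar> \<le> 400 * M" using gb[of 1] M0 fs by linarith
  have b2: "\<bar>4 * (t * g$1) + g$2\<bar> \<le> 400 * M"
    using ab(1)[of 1] ab(5)[of 2] M0 unfolding abs_le_iff by simp
  have b3: "\<bar>6 * (t^2 * g$1) + 3 * (t * g$2) + g$3\<bar> \<le> 400 * M"
    using ab(1)[of 2] ab(2)[of 1] ab(5)[of 3] M0 unfolding abs_le_iff by simp
  \<comment> \<open>The largest of the five bounds, 392 M, obtained from |t| <= 2 and coefficients
    of size at most 8 M; hence the constant 400.\<close>
  have b4: "\<bar>4 * (t^3 * g$1) + 3 * (t^2 * g$2) + 2 * (t * g$3) + g$4\<bar> \<le> 400 * M"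
    using ab(3)[of 1] ab(2)[of 2] ab(1)[of 3] ab(5)[of 4] M0 unfolding abs_le_iff by simp
  have b5: "\<bar>t^4 * g$1 + t^3 * g$2 + t^2 * g$3 + t * g$4 + g$5\<bar> \<le> 400 * M"
    using ab(4)[of 1] ab(3)[of 2] ab(2)[of 3] ab(1)[of 4] ab(5)[of 5] M0 unfolding abs_le_iff by simp
  have c: "\<bar>v^n * x\<bar> \<le> v^n * (400 * M)" if "\<bar>x\<bar> \<le> 400 * M" for n x
    using that v0 by (simp add: abs_mult)
  show "(Im z)^2 * \<bar>f$1\<bar> \<le> 400 * l"
    using mult_left_mono[OF b1, of "v^2"] M by (simp add: v_def)
  have "\<bar>f$2\<bar> \<le> v * (400 * M)" using c[OF b2, of 1] fs by simp
  then have "v * \<bar>f$2\<bar> \<le> v * (v * (400 * M))" using v0 by simp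
  then show "Im z * \<bar>f$2\<bar> \<le> 400 * l" using M by (simp add: v_def power2_eq_square)
  show "\<bar>f$3\<bar> \<le> 400 * l" using c[OF b3, of 2] fs M by simp
  have "\<bar>f$4\<bar> \<le> v^3 * (400 * M)" using c[OF b4, of 3] fs by simp
  also have "v^3 * (400 * M) = 400 * (v^2 * M) * v" by (simp add: power2_eq_square power3_eq_cube)
  finally show "\<bar>f$4\<bar> \<le> 400 * l * Im z" unfolding M by (simp add: v_def)
  have "\<bar>f$5\<bar> \<le> v^4 * (400 * M)" using c[OF b5, of 4] fs by simp
  also have "v^4 * (400 * M) = 400 * (v^2 * M) * v^2" by (simp add: power2_eq_square power4_eq_xxxx)
  finally show "\<bar>f$5\<bar> \<le> 400 * l * (Im z)^2" unfolding M by (simp add: v_def)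
qed

text \<open>
  If \<open>z = \<i> t\<close> then \<open>e = a t^4\<close> and \<open>d = - b t^2\<close> for \<open>k = 4\<close>, while \<open>a t^4 - c t^2 + e = 0\<close> and \<open>d = b t^2\<close> for
  \<open>k = 2\<close>. Eliminating \<open>t\<close> gives the following polynomials.
\<close>

definition axis_poly :: "nat \<Rightarrow> real ^ 5 \<Rightarrow> real" where
  "axis_poly k f = (if k = 4 then f$1 * (f$4)^2 - (f$2)^2 * f$5
     else f$1 * (f$4)^2 - f$2 * f$3 * f$4 + f$5 * (f$2)^2)"

lemma axis_poly_eq_0:
  assumes "rep k f z w0 w" "k = 2 \<or> k = 4" "Re z = 0"
  shows "axis_poly k f = 0"
proof -
  have f: "f = Psi k z w0 w" using assms rep_iff by blast
  from assms(2) show ?thesis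
  proof
    assume k: "k = 2"
    show ?thesis unfolding f Psi_def assms(3) axis_poly_def subst_form_def base_form_def k
      by (simp add: vector_5) algebra
  next
    assume k: "k = 4"
    show ?thesis unfolding f Psi_def assms(3) axis_poly_def subst_form_def base_form_def k
      by (simp add: vector_5 power_mult_distrib flip: power_mult power_add)
  qed
qed

lemma axis_poly_vertical:
  assumes "center i f z" "Re z = \<kappa>"
  shows "axis_poly (weight i) (subst_form 1 0 \<kappa> 1 f) = 0"
proof -
  obtain w0 w where r: "rep (weight i) f z w0 w" using assms by (auto simp: center_def)
  have k: "weight i \<le> 4" by (simp add: weight_def)
  show ?thesis
    by (rule axis_poly_eq_0[OF rep_subst[OF r k] weight_cases]) (use assms in auto)
qed

text \<open>The substitution sends the end points \<kappa> - R and \<kappa> + R of the half circle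
  to 0 and infinity, hence the half circle to the imaginary axis.\<close>

lemma axis_poly_circle:
  assumes "center i f z" "cmod (z - of_real \<kappa>) = R" "R > 0"
  shows "axis_poly (weight i) (subst_form (R + \<kappa>) 1 (\<kappa> - R) 1 f) = 0"
proof -
  obtain w0 w where r: "rep (weight i) f z w0 w" and v: "Im z > 0" using assms by (auto simp: center_def)
  have k: "weight i \<le> 4" by (simp add: weight_def)
  have "(Re z - \<kappa>)^2 + (Im z)^2 = R^2" using assms(2) by (auto simp: cmod_power2 dest: arg_cong[where f = "\<lambda>x. x^2"])
  then have e: "(Re z - (\<kappa> - R)) * (R + \<kappa> - Re z) - Im z * Im z = 0" by algebra
  have nz: "complex_of_real (R + \<kappa>) - z * complex_of_real 1 \<noteq> 0"
    using v by (auto simp: complex_eq_iff)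
  show ?thesis
    by (rule axis_poly_eq_0[OF rep_subst[OF r k nz] weight_cases])
      (use e in \<open>simp add: Re_divide diff_divide_distrib[symmetric] add_divide_distrib[symmetric]\<close>)
qed

section \<open>Crossings along lattice lines\<close>

text \<open>Polynomials in the five coefficients enter only through their restrictions to coordinate
  lines, for which a degree bound is all that counts.\<close>

definition line_poly :: "nat \<Rightarrow> (real ^ 5 \<Rightarrow> real) \<Rightarrow> bool" where
  "line_poly n Q \<longleftrightarrow> (\<forall>f k. \<exists>p. degree p \<le> n \<and> (\<forall>s. Q (f + s *\<^sub>R axis k 1) = poly p s))"

lemma line_polyE:
  assumes "line_poly n Q"
  obtains p where "degree p \<le> n" "\<And>s. Q (f + s *\<^sub>R axis k 1) = poly p s"
  using assms unfolding line_poly_def by metis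

lemma line_poly_mono: "line_poly m Q \<Longrightarrow> m \<le> n \<Longrightarrow> line_poly n Q"
  unfolding line_poly_def by (meson le_trans)

lemma line_poly_const: "line_poly 0 (\<lambda>f. c)"
  unfolding line_poly_def by (intro allI exI[of _ "[:c:]"]) simp

lemma line_poly_nth: "line_poly 1 (\<lambda>f. f $ j)"
  unfolding line_poly_def
  by (intro allI, rule_tac x = "[:f $ j, axis k 1 $ j:]" in exI) simp

lemma line_poly_add:
  assumes "line_poly n P" "line_poly n Q" shows "line_poly n (\<lambda>f. P f + Q f)"
  unfolding line_poly_def
proof (intro allI)
  fix f k
  obtain p q where "degree p \<le> n" "\<And>s. P (f + s *\<^sub>R axis k 1) = poly p s"
    "degree q \<le> n" "\<And>s. Q (f + s *\<^sub>R axis k 1) = poly q s"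
    using assms by (metis line_polyE)
  then show "\<exists>p. degree p \<le> n \<and> (\<forall>s. P (f + s *\<^sub>R axis k 1) + Q (f + s *\<^sub>R axis k 1) = poly p s)"
    by (intro exI[of _ "p + q"]) (simp add: degree_add_le)
qed

lemma line_poly_mult:
  assumes "line_poly m P" "line_poly n Q" shows "line_poly (m + n) (\<lambda>f. P f * Q f)"
  unfolding line_poly_def
proof (intro allI)
  fix f k
  obtain p q where "degree p \<le> m" "\<And>s. P (f + s *\<^sub>R axis k 1) = poly p s"
    "degree q \<le> n" "\<And>s. Q (f + s *\<^sub>R axis k 1) = poly q s"
    using assms by (metis line_polyE)
  then show "\<exists>p. degree p \<le> m + n \<and> (\<forall>s. P (f + s *\<^sub>R axis k 1) * Q (f + s *\<^sub>R axis k 1) = poly p s)"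
    by (intro exI[of _ "p * q"]) (simp add: order_trans[OF degree_mult_le] add_mono)
qed

lemma line_poly_cmult: "line_poly n P \<Longrightarrow> line_poly n (\<lambda>f. c * P f)"
  using line_poly_mult[OF line_poly_const] by fastforce

lemma line_poly_diff: "line_poly n P \<Longrightarrow> line_poly n Q \<Longrightarrow> line_poly n (\<lambda>f. P f - Q f)"
  using line_poly_add[OF _ line_poly_cmult[of n Q "-1"]] by simp

lemma line_poly_power: "line_poly n P \<Longrightarrow> line_poly (m * n) (\<lambda>f. P f ^ m)"
  by (induction m) (auto intro: line_poly_mult simp: line_poly_const)

lemma line_poly_form_I: "line_poly 2 form_I"
proof -
  have "line_poly 2 (\<lambda>f. f $ a * f $ b)" for a b
    using line_poly_mult[OF line_poly_nth line_poly_nth] by (simp add: numeral_2_eq_2)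
  then have "line_poly 2 (\<lambda>f. 12 * (f$1 * f$5) - 3 * (f$2 * f$4) + f$3 * f$3)"
    by (intro line_poly_add line_poly_diff line_poly_cmult)
  then show ?thesis by (simp add: form_I_def[abs_def] power2_eq_square mult.assoc)
qed

lemma line_poly_cubic: "line_poly 1 P \<Longrightarrow> line_poly 1 Q \<Longrightarrow> line_poly 1 R \<Longrightarrow> line_poly 3 (\<lambda>f. P f * Q f * R f)"
  using line_poly_mult[OF line_poly_mult, of 1 P 1 Q 1 R] by (simp add: numeral_3_eq_3)

lemma line_poly_form_J: "line_poly 3 form_J"
proof -
  have "line_poly 3 (\<lambda>f. 72 * (f$1 * f$3 * f$5) + 9 * (f$2 * f$3 * f$4)
     - 27 * (f$1 * f$4 * f$4) - 27 * (f$5 * f$2 * f$2) - 2 * (f$3 * f$3 * f$3))"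
    by (intro line_poly_add line_poly_diff line_poly_cmult line_poly_cubic line_poly_nth)
  then show ?thesis by (simp add: form_J_def[abs_def] power2_eq_square power3_eq_cube mult.assoc)
qed

lemma line_poly_subst_form: "line_poly 1 (\<lambda>f. subst_form p q r s f $ j)"
proof -
  have "line_poly 1 (\<lambda>f. a1 * f$1 + a2 * f$2 + a3 * f$3 + a4 * f$4 + a5 * f$5)" for a1 a2 a3 a4 a5
    by (intro line_poly_add line_poly_cmult line_poly_nth)
  then have "line_poly 1 (\<lambda>f. f$1 * a1 + f$2 * a2 + f$3 * a3 + f$4 * a4 + f$5 * a5)" for a1 a2 a3 a4 a5
    by (simp add: mult.commute)
  then show ?thesis using exhaust_5[of j] by (auto simp: subst_form_def vector_5 mult.assoc)
qed

lemma line_poly_axis_poly: "line_poly 3 (\<lambda>f. axis_poly k (subst_form p q r s f))"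
proof -
  let ?g = "\<lambda>j f. subst_form p q r s f $ j"
  have "line_poly 3 (\<lambda>f. ?g 1 f * ?g 4 f * ?g 4 f - ?g 2 f * ?g 2 f * ?g 5 f)"
    "line_poly 3 (\<lambda>f. ?g 1 f * ?g 4 f * ?g 4 f - ?g 2 f * ?g 3 f * ?g 4 f + ?g 5 f * ?g 2 f * ?g 2 f)"
    by (intro line_poly_add line_poly_diff line_poly_cubic line_poly_subst_form)+
  then show ?thesis unfolding axis_poly_def by (cases "k = 4") (simp_all add: power2_eq_square mult.assoc)
qed

lemma line_eqI:
  assumes "\<forall>j. j \<noteq> k \<longrightarrow> f $ j = g $ j" "\<forall>j. j \<noteq> k \<longrightarrow> f' $ j = g $ j" "f $ k = f' $ k"
  shows "f $ i = f' $ i"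
  using assms by (cases "i = k") auto

lemma card_le_of_fibers:
  fixes A :: "5 \<Rightarrow> int set"
  assumes M: "M \<subseteq> {f. \<forall>j. f$j \<in> A j}" and fin: "\<And>j. finite (A j)"
    and c: "\<And>g. card {f \<in> M. \<forall>j. j \<noteq> k \<longrightarrow> f$j = g$j} \<le> c"
  shows "card M \<le> c * (\<Prod>j\<in>UNIV - {k}. card (A j))"
proof -
  let ?P = "PiE (UNIV - {k}) A"
  let ?F = "\<lambda>h. {f \<in> M. \<forall>j. j \<noteq> k \<longrightarrow> f$j = h j}"
  have finP: "finite ?P" by (intro finite_PiE) (use fin in auto)
  have finM: "finite M"
  proof (rule finite_subset[OF M])
    show "finite {f :: int ^ 5. \<forall>j. f$j \<in> A j}"
      by (rule finite_subset[OF _ finite_bounded_vec[of "\<Union>j. A j"]]) (use fin in auto)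
  qed
  have "M \<subseteq> (\<Union>h\<in>?P. ?F h)"
  proof
    fix f assume f: "f \<in> M"
    then have "restrict (\<lambda>j. f$j) (UNIV - {k}) \<in> ?P" using M by auto
    then show "f \<in> (\<Union>h\<in>?P. ?F h)"
      by (rule UN_I) (use f in auto)
  qed
  then have "card M \<le> card (\<Union>h\<in>?P. ?F h)" by (intro card_mono) (use finP finM in auto)
  also have "\<dots> \<le> (\<Sum>h\<in>?P. card (?F h))" by (rule card_UN_le[OF finP])
  also have "\<dots> \<le> (\<Sum>h\<in>?P. c)"
  proof (rule sum_mono)
    fix h
    show "card (?F h) \<le> c" using c[of "\<chi> j. h j"] by simp
  qed
  also have "\<dots> = c * (\<Prod>j\<in>UNIV - {k}. card (A j))"
    by (simp add: card_PiE mult.commute)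
  finally show ?thesis .
qed

text \<open>The number of coordinate lines, in all five directions, that meet the box.\<close>

definition faces :: "(5 \<Rightarrow> int set) \<Rightarrow> nat" where
  "faces A = (\<Sum>i\<in>UNIV. \<Prod>j\<in>UNIV - {i}. card (A j))"

text \<open>Zeros are counted by moving to the point \<open>p\<close> one coordinate at a time: the step that leaves
  the zero set happens along a line on which \<open>Q\<close> does not vanish identically.\<close>

lemma card_zeros_le:
  fixes A :: "5 \<Rightarrow> int set"
  assumes Q: "line_poly n Q" "Q p \<noteq> 0" and fin: "\<And>j. finite (A j)"
  shows "card {f. (\<forall>j. f$j \<in> A j) \<and> Q (real_form f) = 0} \<le> n * faces A"
proof -
  define mix where "mix J f = (\<chi> j. if j \<in> J then p$j else real_of_int (f$j))" for J and f :: quartic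
  define B where "B = {f :: quartic. \<forall>j. f$j \<in> A j}"
  have finB: "finite B" unfolding B_def
    by (rule finite_subset[OF _ finite_bounded_vec[of "\<Union>j. A j"]]) (use fin in auto)
  let ?pr = "\<lambda>i. \<Prod>j\<in>UNIV - {i}. card (A j)"
  have main: "card {f \<in> B. Q (mix (- I) f) = 0} \<le> n * (\<Sum>i\<in>I. ?pr i)" if "finite I" for I
    using that
  proof (induction I)
    case empty
    have "mix (- {}) f = p" for f by (simp add: mix_def vec_eq_iff)
    then show ?case using Q(2) by simp
  next
    case (insert i I)
    let ?M = "{f \<in> B. Q (mix (- insert i I) f) = 0 \<and> Q (mix (- I) f) \<noteq> 0}"
    have "card ?M \<le> n * ?pr i"
    proof (rule card_le_of_fibers)
      fix g
      let ?F = "{f \<in> ?M. \<forall>j. j \<noteq> i \<longrightarrow> f$j = g$j}"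
      show "card ?F \<le> n"
      proof (cases "?F = {}")
        case False
        then obtain f0 where f0: "f0 \<in> ?F" by blast
        define h where "h = mix (- insert i I) f0 - (f0$i) *\<^sub>R axis i 1"
        obtain q where q: "degree q \<le> n" "\<And>s. Q (h + s *\<^sub>R axis i 1) = poly q s"
          using line_polyE[OF Q(1)] by blast
        have ni: "i \<notin> I" using insert by simp
        have hi: "h$i = 0" using ni by (simp add: h_def mix_def)
        have "mix (- I) f0 = h + (p$i) *\<^sub>R axis i 1"
          using ni by (auto simp: h_def mix_def vec_eq_iff axis_def)
        then have "poly q (p$i) \<noteq> 0" using f0 q(2)[of "p$i"] by auto
        then have q0: "q \<noteq> 0" by auto
        have inj: "inj_on (\<lambda>f. real_of_int (f$i)) ?F"
          by (rule inj_onI) (auto simp: vec_eq_iff intro: line_eqI[of i])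
        have "(\<lambda>f. real_of_int (f$i)) ` ?F \<subseteq> {x. poly q x = 0}"
        proof clarify
          fix f assume f: "f \<in> B" "Q (mix (- insert i I) f) = 0" "\<forall>j. j \<noteq> i \<longrightarrow> f$j = g$j"
          have "mix (- insert i I) f = h + (f$i) *\<^sub>R axis i 1"
            using f(3) f0 by (auto simp: h_def mix_def vec_eq_iff axis_def)
          then show "poly q (f$i) = 0" using q(2)[of "f$i"] f(2) by simp
        qed
        then have "card ?F \<le> card {x. poly q x = 0}"
          by (rule card_inj_on_le[OF inj]) (rule poly_roots_finite[OF q0])
        also have "\<dots> \<le> n" using card_poly_roots_bound[OF q0] q(1) by linarith
        finally show ?thesis .
      next
        case True
        show ?thesis unfolding True by simp
      qed
    qed (use fin in \<open>auto simp: B_def\<close>)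
    moreover have "{f \<in> B. Q (mix (- insert i I) f) = 0} \<subseteq> ?M \<union> {f \<in> B. Q (mix (- I) f) = 0}" by blast
    then have "card {f \<in> B. Q (mix (- insert i I) f) = 0} \<le> card ?M + card {f \<in> B. Q (mix (- I) f) = 0}"
      using finB by (intro order_trans[OF card_mono card_Un_le]) auto
    ultimately show ?case using insert by (simp add: distrib_left)
  qed
  have "mix {} f = real_form f" for f by (simp add: mix_def real_form_def)
  with main[of UNIV] show ?thesis by (simp add: B_def faces_def)
qed

text \<open>If Q vanishes on the whole line through f in direction k, then f itself is a zero, and
  \<open>card_zeros_le\<close> gives \<open>n * faces A\<close>. Any other line carries at most n
  roots, and each root lies on at most two of the unit segments; this gives the remaining 2
  n.\<close>

lemma card_crossings_le:
  fixes A :: "5 \<Rightarrow> int set"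
  assumes Q: "line_poly n Q" "Q p \<noteq> 0" and fin: "\<And>j. finite (A j)"
  shows "card {f. (\<forall>j. f$j \<in> A j) \<and> (\<exists>s\<in>{0..1}. Q (real_form f + s *\<^sub>R axis k 1) = 0)} \<le> 3 * n * faces A"
proof -
  define B where "B = {f :: quartic. \<forall>j. f$j \<in> A j}"
  have finB: "finite B" unfolding B_def
    by (rule finite_subset[OF _ finite_bounded_vec[of "\<Union>j. A j"]]) (use fin in auto)
  define Z where "Z = {f. (\<forall>j. f$j \<in> A j) \<and> Q (real_form f) = 0}"
  define M where "M = {f \<in> B. (\<exists>s. Q (real_form f + s *\<^sub>R axis k 1) \<noteq> 0)
     \<and> (\<exists>s\<in>{0..1}. Q (real_form f + s *\<^sub>R axis k 1) = 0)}"
  have "card M \<le> (2 * n) * (\<Prod>j\<in>UNIV - {k}. card (A j))"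
  proof (rule card_le_of_fibers)
    fix g
    let ?F = "{f \<in> M. \<forall>j. j \<noteq> k \<longrightarrow> f$j = g$j}"
    show "card ?F \<le> 2 * n"
    proof (cases "?F = {}")
      case False
      then obtain f0 where f0: "f0 \<in> ?F" by blast
      obtain q where q: "degree q \<le> n" "\<And>s. Q (real_form f0 + s *\<^sub>R axis k 1) = poly q s"
        using line_polyE[OF Q(1)] by blast
      have q0: "q \<noteq> 0" using f0 q(2) by (auto simp: M_def)
      let ?R = "{x. poly q x = 0}"
      \<comment> \<open>A root lies on the segment that starts at its floor, and also on the
        preceding one if it is an integer.\<close>
      let ?G = "(\<lambda>x. \<lfloor>x\<rfloor>) ` ?R \<union> (\<lambda>x. \<lfloor>x\<rfloor> - 1) ` ?R"
      have inj: "inj_on (\<lambda>f. f$k - f0$k) ?F"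
        by (rule inj_onI) (auto simp: vec_eq_iff intro: line_eqI[of k])
      have "(\<lambda>f. f$k - f0$k) ` ?F \<subseteq> ?G"
      proof (rule image_subsetI)
        fix f assume f: "f \<in> ?F"
        then obtain s where s: "0 \<le> s" "s \<le> 1" "Q (real_form f + s *\<^sub>R axis k 1) = 0"
          by (auto simp: M_def)
        have "real_form f + s *\<^sub>R axis k 1 = real_form f0 + (of_int (f$k - f0$k) + s) *\<^sub>R axis k 1"
          using f f0 by (auto simp: vec_eq_iff axis_def)
        then have r: "of_int (f$k - f0$k) + s \<in> ?R" using s q(2) by simp
        show "f$k - f0$k \<in> ?G"
        proof (cases "s = 1")
          case True
          have "f$k - f0$k = \<lfloor>of_int (f$k - f0$k) + s\<rfloor> - 1" using True by simp
          then show ?thesis using r by blast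
        next
          case False
          have "f$k - f0$k = \<lfloor>of_int (f$k - f0$k) + s\<rfloor>" using False s by linarith
          then show ?thesis using r by blast
        qed
      qed
      then have "card ?F \<le> card ?G"
        by (rule card_inj_on_le[OF inj]) (simp add: poly_roots_finite[OF q0])
      also have "\<dots> \<le> card ?R + card ?R"
        by (rule order_trans[OF card_Un_le]) (intro add_mono card_image_le poly_roots_finite q0)
      also have "\<dots> \<le> 2 * n" using card_poly_roots_bound[OF q0] q(1) by linarith
      finally show ?thesis .
    next
      case True
      show ?thesis unfolding True by simp
    qed
  qed (use fin in \<open>auto simp: B_def M_def\<close>)
  moreover have "(\<Prod>j\<in>UNIV - {k}. card (A j)) \<le> faces A"
    unfolding faces_def by (rule member_le_sum) auto
  ultimately have M: "card M \<le> 2 * n * faces A" by (meson le_trans mult_le_mono2)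
  have "Q (real_form f) = 0" if "\<forall>s. Q (real_form f + s *\<^sub>R axis k 1) = 0" for f
    using that[rule_format, of 0] by simp
  then have "{f. (\<forall>j. f$j \<in> A j) \<and> (\<exists>s\<in>{0..1}. Q (real_form f + s *\<^sub>R axis k 1) = 0)} \<subseteq> M \<union> Z"
    unfolding M_def Z_def B_def by blast
  moreover have "finite M" "finite Z" using finB by (auto simp: M_def Z_def B_def)
  ultimately have "card {f. (\<forall>j. f$j \<in> A j) \<and> (\<exists>s\<in>{0..1}. Q (real_form f + s *\<^sub>R axis k 1) = 0)} \<le> card M + card Z"
    by (intro order_trans[OF card_mono card_Un_le]) auto
  moreover have "card Z \<le> n * faces A" unfolding Z_def by (rule card_zeros_le[OF Q fin])
  ultimately show ?thesis using M by linarith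
qed

section \<open>Frontiers of sets of forms with prescribed centers\<close>

lemma continuous_on_vec5:
  fixes f :: "'b::topological_space \<Rightarrow> real ^ 5"
  assumes "\<And>j. continuous_on S (\<lambda>x. f x $ j)"
  shows "continuous_on S f"
proof -
  show ?thesis using continuous_on_vec_lambda[of S "\<lambda>i x. f x $ i"] assms by (simp add: vec_lambda_eta)
qed

lemma continuous_on_subst_form:
  fixes g :: "'b::topological_space \<Rightarrow> real ^ 5"
  assumes r: "continuous_on S r" and s: "continuous_on S s" and g: "\<And>j. continuous_on S (\<lambda>x. g x $ j)"
  shows "continuous_on S (\<lambda>x. subst_form 1 0 (r x) (s x) (g x) $ j)"
proof -
  note rules = continuous_on_add continuous_on_mult continuous_on_power continuous_on_const r s
    g[of 1] g[of 2] g[of 3] g[of 4] g[of 5]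
  show ?thesis using exhaust_5[of j]
  proof (elim disjE)
    assume "j = 1" show ?thesis unfolding \<open>j = 1\<close> subst_form_def vector_5 by (intro rules)
  next
    assume "j = 2" show ?thesis unfolding \<open>j = 2\<close> subst_form_def vector_5 by (intro rules)
  next
    assume "j = 3" show ?thesis unfolding \<open>j = 3\<close> subst_form_def vector_5 by (intro rules)
  next
    assume "j = 4" show ?thesis unfolding \<open>j = 4\<close> subst_form_def vector_5 by (intro rules)
  next
    assume "j = 5" show ?thesis unfolding \<open>j = 5\<close> subst_form_def vector_5 by (intro rules)
  qed
qed

lemma continuous_on_Psi: "continuous_on S (\<lambda>(z, w0, w). Psi k z w0 w)"
proof (rule continuous_on_vec5)
  fix j :: 5
  note rules = continuous_on_add continuous_on_diff continuous_on_minus continuous_on_mult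
    continuous_on_power continuous_on_const
  have c: "continuous_on S (\<lambda>x. Re (fst x))" "continuous_on S (\<lambda>x. Im (fst x))"
    "continuous_on S (\<lambda>x. fst (snd x))" "continuous_on S (\<lambda>x. Re (snd (snd x)))"
    "continuous_on S (\<lambda>x. Im (snd (snd x)))" for S :: "(complex \<times> real \<times> complex) set"
    by (intro continuous_on_Re continuous_on_Im continuous_on_fst continuous_on_snd continuous_on_id)+
  have b: "continuous_on S (\<lambda>x. base_form k (fst (snd x)) (snd (snd x)) $ j)"
    for j :: 5 and S :: "(complex \<times> real \<times> complex) set"
  proof (cases "k = 4")
    case True
    show ?thesis using exhaust_5[of j] unfolding base_form_def if_P[OF True]
      by (elim disjE; hypsubst; simp only: vector_5; intro rules c)
  next
    case False
    show ?thesis using exhaust_5[of j] unfolding base_form_def if_not_P[OF False]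
      by (elim disjE; hypsubst; simp only: vector_5; intro rules c)
  qed
  have "continuous_on S (\<lambda>x. Psi k (fst x) (fst (snd x)) (snd (snd x)) $ j)"
    unfolding Psi_def
    by (rule continuous_on_subst_form[OF continuous_on_minus[OF c(1)] c(2) b])
  then show "continuous_on S (\<lambda>x. (case x of (z, w0, w) \<Rightarrow> Psi k z w0 w) $ j)"
    by (simp only: split_beta')
qed

lemma continuous_on_form_height: "continuous_on S form_height"
proof -
  have n: "continuous_on S (\<lambda>f :: real ^ 5. f $ j)" for j S
    by (rule continuous_on_component[OF continuous_on_id])
  note rules = continuous_on_add continuous_on_diff continuous_on_mult continuous_on_power continuous_on_const
    n[of _ 1] n[of _ 2] n[of _ 3] n[of _ 4] n[of _ 5]
  have "continuous_on S form_I" "continuous_on S form_J"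
    unfolding form_I_def[abs_def] form_J_def[abs_def] by (intro rules)+
  then show ?thesis unfolding form_height_def[abs_def]
    by (intro continuous_on_max continuous_on_rabs continuous_on_power continuous_on_divide continuous_on_const) auto
qed

text \<open>The set \<open>Om\<close> is the image of the open parameter set \<open>U\<close> under
  the injective map \<open>PP\<close>, hence open by invariance of domain. The bounds on height and
  center make the closure of \<open>U\<close> compact, so a frontier point of \<open>Om\<close> on
  the segment still has parameters. They lie outside \<open>U\<close>, so one of the strict
  inequalities defining \<open>U\<close> is an equality there; for the admissibility condition this
  means discriminant 0.\<close>

lemma segment_meets_boundary:
  assumes D: "open D" "D \<subseteq> {z. Im z > 0}"
    and \<delta>: "\<delta> > 0" "\<And>z. z \<in> D \<Longrightarrow> \<delta> \<le> Im z" "\<And>z. z \<in> D \<Longrightarrow> cmod z \<le> B"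
    and F: "form_height F < X" "\<exists>z\<in>D. center i F z"
    and G: "\<not> (form_height G < X \<and> (\<exists>z\<in>D. center i G z))"
  shows "\<exists>h\<in>closed_segment F G. form_disc h = 0 \<or> form_height h = X
    \<or> (\<exists>z\<in>closure D - D. center i h z)"
proof -
  define k where "k = weight i"
  have k: "k = 2 \<or> k = 4" using weight_cases by (simp add: k_def)
  define PP where "PP = (\<lambda>(z, w0, w). Psi k z w0 w)"
  define adm where "adm = {(z :: complex, w0, w). admissible i w0 w}"
  define adm' where "adm' = {(z :: complex, w0, w). if i = 2 then cmod w \<le> \<bar>w0\<bar> else \<bar>w0\<bar> \<le> cmod w}"
  define U where "U = (D \<times> UNIV) \<inter> adm \<inter> {x. form_height (PP x) < X}"
  define Om where "Om = PP ` U"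
  have cPP: "continuous_on S PP" for S unfolding PP_def by (rule continuous_on_Psi)
  have cH: "continuous_on S (\<lambda>x. form_height (PP x))" for S
    using continuous_on_compose[OF cPP continuous_on_form_height] by (simp add: o_def)
  have opadm: "open adm"
    unfolding adm_def admissible_def case_prod_beta
    by (cases "i = 2") (simp_all, (intro open_Collect_less continuous_intros)+)
  have cladm: "closed adm'"
    unfolding adm'_def case_prod_beta
    by (cases "i = 2") (simp_all, (intro closed_Collect_le continuous_intros)+)
  have opU: "open U" unfolding U_def
    by (intro open_Int open_Times open_Collect_less opadm cH continuous_intros D open_UNIV)
  have Om_iff: "f \<in> Om \<longleftrightarrow> form_height f < X \<and> (\<exists>z\<in>D. center i f z)" for f
  proof
    assume "f \<in> Om"
    then show "form_height f < X \<and> (\<exists>z\<in>D. center i f z)"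
      unfolding Om_def U_def adm_def PP_def center_iff_Psi k_def[symmetric] using D(2) by auto
  next
    assume "form_height f < X \<and> (\<exists>z\<in>D. center i f z)"
    then obtain z w0 w where "form_height f < X" "z \<in> D" "admissible i w0 w" "f = Psi k z w0 w"
      unfolding center_iff_Psi k_def[symmetric] by blast
    then show "f \<in> Om"
      unfolding Om_def by (intro image_eqI[of _ _ "(z, w0, w)"]) (simp_all add: U_def adm_def PP_def)
  qed
  have "inj_on PP U"
  proof (rule inj_onI)
    fix x y assume xy: "x \<in> U" "y \<in> U" "PP x = PP y"
    obtain z w0 w z' w0' w' where [simp]: "x = (z, w0, w)" "y = (z', w0', w')" by (metis surj_pair)
    have "center i (PP x) z" "center i (PP y) z'"
      using xy(1,2) D(2) by (auto simp: U_def adm_def PP_def center_iff_Psi k_def)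
    then have c: "center i (PP x) z" "center i (PP x) z'" using xy(3) by simp_all
    then have "z = z'" by (rule center_unique)
    moreover have "Im z \<noteq> 0" using c by (auto simp: center_def)
    ultimately show "x = y" using Psi_inject xy(3) by (auto simp: PP_def)
  qed
  \<comment> \<open>Parameters and forms both make up spaces of real dimension 5.\<close>
  then have opO: "open Om"
    unfolding Om_def by (intro invariance_of_domain_gen opU cPP) simp_all
  define l where "l = root 6 \<bar>X\<bar>"
  have l: "l \<ge> 0" "l^6 = \<bar>X\<bar>" by (simp_all add: l_def)
  have "U \<subseteq> cball 0 B \<times> cball 0 (l / \<delta>^2) \<times> cball 0 (l / \<delta>^2)"
  proof
    fix x assume x: "x \<in> U"
    obtain z w0 w where [simp]: "x = (z, w0, w)" by (metis surj_pair)
    have z: "z \<in> D" "form_height (Psi k z w0 w) \<le> l^6" using x l by (auto simp: U_def PP_def)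
    have "\<delta>^2 \<le> (Im z)^2" using \<delta>(1) \<delta>(2)[OF z(1)] by (simp add: power_mono)
    then have "\<delta>^2 * a \<le> (Im z)^2 * a" if "a \<ge> 0" for a using that by (rule mult_right_mono)
    then have "\<delta>^2 * \<bar>w0\<bar> \<le> l" "\<delta>^2 * cmod w \<le> l"
      using center_parameter_bounds[OF z(2) l(1) k] by (meson abs_ge_zero norm_ge_zero order_trans)+
    then show "x \<in> cball 0 B \<times> cball 0 (l / \<delta>^2) \<times> cball 0 (l / \<delta>^2)"
      using \<delta>(1) \<delta>(3)[OF z(1)] by (simp add: field_simps)
  qed
  then have "bounded U" by (rule bounded_subset[rotated]) (intro bounded_Times bounded_cball)
  then have cK: "compact (closure U)" by simp
  have "closed (PP ` closure U)"
    by (intro compact_imp_closed compact_continuous_image cPP cK)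
  then have clO: "closure Om \<subseteq> PP ` closure U"
    unfolding Om_def by (intro closure_minimal image_mono closure_subset)
  have "F \<in> Om" "G \<notin> Om" using F G by (auto simp: Om_iff)
  then have "closed_segment F G \<inter> frontier Om \<noteq> {}"
    by (intro connected_Int_frontier) (auto intro: connected_segment)
  then obtain h where h: "h \<in> closed_segment F G" "h \<in> frontier Om" by blast
  then have "h \<in> closure Om" "h \<notin> Om" using opO by (auto simp: frontier_def interior_open)
  then obtain x where x: "x \<in> closure U" "h = PP x" using clO by blast
  then have xU: "x \<notin> U" using \<open>h \<notin> Om\<close> by (auto simp: Om_def)
  obtain z w0 w where xz: "x = (z, w0, w)" by (metis surj_pair)
  have hP: "h = Psi k z w0 w" using x(2) by (simp add: xz PP_def)
  \<comment> \<open>The strict inequalities are relaxed to closed ones; the lower bound \<delta>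
    keeps limits of centers off the real axis.\<close>
  define C where "C = (closure D \<inter> {z. \<delta> \<le> Im z}) \<times> UNIV \<inter> adm' \<inter> {x. form_height (PP x) \<le> X}"
  have "closed C" unfolding C_def
    by (intro closed_Int closed_Times closed_Collect_le cH continuous_intros cladm closed_closure closed_UNIV)
  moreover have "U \<subseteq> C"
    unfolding U_def C_def adm_def adm'_def admissible_def using closure_subset[of D] \<delta>(2)
    by (auto split: if_splits)
  ultimately have "closure U \<subseteq> C" by (rule closure_minimal[rotated])
  then have xC: "z \<in> closure D" "\<delta> \<le> Im z" "if i = 2 then cmod w \<le> \<bar>w0\<bar> else \<bar>w0\<bar> \<le> cmod w"
    "form_height h \<le> X"
    using x(1) hP by (auto simp: C_def adm'_def xz PP_def)
  show ?thesis
  proof (rule bexI[OF _ h(1)], rule ccontr)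
    assume n: "\<not> (form_disc h = 0 \<or> form_height h = X \<or> (\<exists>z\<in>closure D - D. center i h z))"
    have "\<bar>w0\<bar> \<noteq> cmod w"
    proof
      assume e: "\<bar>w0\<bar> = cmod w"
      have "((Im z)^2 * w0)^2 = ((Im z)^2 * cmod w)^2" unfolding e[symmetric] by (simp add: power_mult_distrib)
      then have "form_disc h = 0" unfolding hP form_disc_Psi[OF k] by simp
      then show False using n by blast
    qed
    then have a: "admissible i w0 w" using xC(3) by (auto simp: admissible_def split: if_splits)
    then have c: "center i h z" unfolding center_iff_Psi using hP xC(2) \<delta>(1) by (auto simp: k_def)
    then have "z \<in> D" using n xC(1) by blast
    moreover have "form_height h < X" using n xC(4) by auto
    ultimately have "x \<in> U" using a hP by (simp add: xz U_def adm_def PP_def)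
    then show False using xU by blast
  qed
qed

section \<open>The dyadic pieces of the cusp and the polynomials on their boundary\<close>

text \<open>The strip of width 2 L above the circles of radius L around -L, 0 and L, without the
  part above the circle of radius 2 L. All its points have imaginary part comparable to L. The
  half-open inequalities let the pieces fit together without overlap.\<close>

definition wedge :: "real \<Rightarrow> complex set" where
  "wedge L = {z. Im z > 0 \<and> - L \<le> Re z \<and> Re z < L \<and> L \<le> cmod z \<and> L \<le> cmod (z - of_real L)
     \<and> L \<le> cmod (z + of_real L) \<and> cmod z < 2 * L}"

text \<open>One of -L, 0 and L lies within L / 2 of Re z; the circle around it gives the
  bound.\<close>

lemma wedge_Im_ge:
  assumes "L > 0" "\<bar>Re z\<bar> \<le> L" "L \<le> cmod z" "L \<le> cmod (z - of_real L)" "L \<le> cmod (z + of_real L)" "Im z \<ge> 0"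
  shows "L / 2 \<le> Im z"
proof -
  have sq: "L^2 \<le> (Re z)^2 + (Im z)^2" "L^2 \<le> (Re z - L)^2 + (Im z)^2" "L^2 \<le> (Re z + L)^2 + (Im z)^2"
    using assms power_mono[of L "cmod z" 2] power_mono[of L "cmod (z - of_real L)" 2]
      power_mono[of L "cmod (z + of_real L)" 2] by (simp_all add: cmod_power2)
  have key: "(L/2)^2 \<le> (Im z)^2" if "\<bar>x\<bar> \<le> L/2" "L^2 \<le> x^2 + (Im z)^2" for x
  proof -
    have "x^2 \<le> (L/2)^2" using that(1) assms(1) by (simp add: abs_le_square_iff[symmetric])
    then show ?thesis using that(2) by (simp add: power_divide) (use zero_le_power2[of L] in linarith)
  qed
  have "(L/2)^2 \<le> (Im z)^2"
  proof (cases "\<bar>Re z\<bar> \<le> L/2")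
    case True then show ?thesis using key sq(1) by blast
  next
    case False
    show ?thesis
    proof (cases "Re z > 0")
      case True
      then show ?thesis using key[of "Re z - L"] sq(2) False assms(2) by force
    next
      case f: False
      then show ?thesis using key[of "Re z + L"] sq(3) False assms(2) by force
    qed
  qed
  then show ?thesis using assms(1,6) by (simp add: power_mono_iff)
qed

text \<open>Leading coefficient, height (three equations), discriminant, and the center on one of
  the six geodesics that bound \<open>wedge L\<close>. Terms such as \<open>L + 0\<close> keep the
  shape of \<open>axis_poly_circle\<close> with \<kappa> = 0.\<close>

definition boundary_polys :: "nat \<Rightarrow> real \<Rightarrow> real \<Rightarrow> (real ^ 5 \<Rightarrow> real) list" where
  "boundary_polys k L X =
    [\<lambda>f. f$1, \<lambda>f. form_I f ^ 3 - X, \<lambda>f. form_I f ^ 3 + X, \<lambda>f. form_J f ^ 2 - 4 * X, form_disc,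
     \<lambda>f. axis_poly k (subst_form 1 0 L 1 f), \<lambda>f. axis_poly k (subst_form 1 0 (- L) 1 f),
     \<lambda>f. axis_poly k (subst_form (L + 0) 1 (0 - L) 1 f), \<lambda>f. axis_poly k (subst_form (L + L) 1 (L - L) 1 f),
     \<lambda>f. axis_poly k (subst_form (L + - L) 1 (- L - L) 1 f),
     \<lambda>f. axis_poly k (subst_form (2 * L + 0) 1 (0 - 2 * L) 1 f)]"

lemma boundary_polys_line_poly: "Q \<in> set (boundary_polys k L X) \<Longrightarrow> line_poly 6 Q"
proof -
  have "line_poly 6 (\<lambda>f. f$1)" by (rule line_poly_mono[OF line_poly_nth]) simp
  moreover have I: "line_poly 6 (\<lambda>f. form_I f ^ 3)" using line_poly_power[OF line_poly_form_I, of 3] by simp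
  moreover have J: "line_poly 6 (\<lambda>f. form_J f ^ 2)" using line_poly_power[OF line_poly_form_J, of 2] by simp
  moreover have c: "line_poly 6 (\<lambda>f. c)" for c by (rule line_poly_mono[OF line_poly_const]) simp
  moreover have "line_poly 6 form_disc"
    unfolding form_disc_def[abs_def] by (intro line_poly_diff line_poly_cmult I J)
  moreover have "line_poly 6 (\<lambda>f. axis_poly k (subst_form p q r s f))" for p q r s
    by (rule line_poly_mono[OF line_poly_axis_poly]) simp
  ultimately show "Q \<in> set (boundary_polys k L X) \<Longrightarrow> line_poly 6 Q"
    unfolding boundary_polys_def by (auto intro!: line_poly_diff line_poly_add)
qed

lemma boundary_polys_nonzero:
  assumes "Q \<in> set (boundary_polys k L X)" "L > 0" "X > 0"
  shows "\<exists>p. Q p \<noteq> 0"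
proof -
  \<comment> \<open>The form x^4 + x y^3 has I = 0 and J = -27, and its \<open>axis_poly\<close> is
    1 for both weights; invertible substitutions carry the last value over to the other
    geodesics.\<close>
  define w :: "real ^ 5" where "w = vector [1, 0, 0, 1, 0]"
  have w: "axis_poly k w \<noteq> 0" "w$1 \<noteq> 0" "form_J w = -27" "form_I w = 0"
    by (simp_all add: w_def axis_poly_def form_I_def form_J_def vector_5)
  have ax: "\<exists>f. axis_poly k (subst_form p q r s f) \<noteq> 0" if "p * s - q * r \<noteq> 0" for p q r s
    using w(1) subst_form_inverse(1)[OF that] by metis
  have "\<exists>f. form_J f ^ 2 - 4 * X \<noteq> 0"
    using w(3) assms(3) by (intro exI[of _ 0]) (simp add: form_J_def)
  moreover have "\<exists>f. form_disc f \<noteq> 0" using w by (intro exI[of _ w]) (simp add: form_disc_def)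
  ultimately show ?thesis
    using assms w ax unfolding boundary_polys_def by (auto intro: exI[of _ w])
qed

text \<open>The wedge is neither open nor closed, so it is compared with an open set
  \<open>D\<close> and a closed set \<open>E\<close> that differ only by points on the six
  geodesics. If the center of F lies in \<open>D\<close>, then either G has small height and its
  center in \<open>D\<close> and fails only by \<open>G$1 = 0\<close>, or the segment meets the
  frontier of the forms with center in \<open>D\<close>.\<close>

lemma region_change:
  fixes F G :: "real ^ 5"
  assumes L: "L > 0" and X: "X > 0"
    and F: "F$1 \<noteq> 0" "form_height F < X" "\<exists>z\<in>wedge L. center i F z"
    and G: "\<not> (G$1 \<noteq> 0 \<and> form_height G < X \<and> (\<exists>z\<in>wedge L. center i G z))"
  shows "\<exists>h\<in>closed_segment F G. \<exists>Q\<in>set (boundary_polys (weight i) L X). Q h = 0"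
proof -
  define D where "D = {z. Im z > 0 \<and> - L < Re z \<and> Re z < L \<and> L < cmod z \<and> L < cmod (z - of_real L)
     \<and> L < cmod (z + of_real L) \<and> cmod z < 2 * L}"
  define E where "E = {z. Im z \<ge> 0 \<and> - L \<le> Re z \<and> Re z \<le> L \<and> L \<le> cmod z \<and> L \<le> cmod (z - of_real L)
     \<and> L \<le> cmod (z + of_real L) \<and> cmod z \<le> 2 * L}"
  have Im: "L / 2 \<le> Im z" if "z \<in> E" for z
    by (rule wedge_Im_ge) (use that L in \<open>auto simp: E_def\<close>)
  have opD: "open D" unfolding D_def
    by (intro open_Collect_conj open_Collect_less continuous_intros)
  have clE: "closed E" unfolding E_def
    by (intro closed_Collect_conj closed_Collect_le continuous_intros)
  have DE: "D \<subseteq> wedge L" "wedge L \<subseteq> E" by (auto simp: D_def E_def wedge_def)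
  have geod: "\<exists>Q\<in>set (boundary_polys (weight i) L X). Q h = 0"
    if c: "center i h z" and z: "z \<in> E - D" for h z
  proof -
    have "Im z > 0" using Im[of z] z L by auto
    then consider "Re z = L" | "Re z = - L" | "cmod (z - of_real 0) = L" | "cmod (z - of_real L) = L"
      | "cmod (z - of_real (- L)) = L" | "cmod (z - of_real 0) = 2 * L"
      using z unfolding E_def D_def by force
    then show ?thesis
    proof cases
      case 1 then show ?thesis using axis_poly_vertical[OF c] by (simp add: boundary_polys_def)
    next
      case 2 then show ?thesis using axis_poly_vertical[OF c] by (simp add: boundary_polys_def)
    next
      case 3 then show ?thesis using axis_poly_circle[OF c 3 L] unfolding boundary_polys_def by simp
    next
      case 4 then show ?thesis using axis_poly_circle[OF c 4 L] unfolding boundary_polys_def by simp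
    next
      case 5 then show ?thesis using axis_poly_circle[OF c 5 L] unfolding boundary_polys_def by simp
    next
      case 6 then show ?thesis using axis_poly_circle[OF c 6] L unfolding boundary_polys_def by simp
    qed
  qed
  have ends: "F \<in> closed_segment F G" "G \<in> closed_segment F G" by auto
  obtain z where z: "z \<in> wedge L" "center i F z" using F(3) by blast
  show ?thesis
  proof (cases "z \<in> D")
    case False
    then show ?thesis using geod[OF z(2)] z(1) DE ends by blast
  next
    case True
    show ?thesis
    proof (cases "form_height G < X \<and> (\<exists>z\<in>D. center i G z)")
      case True
      then have "G$1 = 0" using G DE by blast
      then show ?thesis using ends by (intro bexI[of _ G]) (simp_all add: boundary_polys_def)
    next
      case nG: False
      have "\<exists>h\<in>closed_segment F G. form_disc h = 0 \<or> form_height h = X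
        \<or> (\<exists>z\<in>closure D - D. center i h z)"
      proof (rule segment_meets_boundary[OF opD])
        show "D \<subseteq> {z. Im z > 0}" by (auto simp: D_def)
        show "L / 2 > 0" using L by simp
        show "L / 2 \<le> Im z" if "z \<in> D" for z using Im that DE by blast
        show "cmod z \<le> 2 * L" if "z \<in> D" for z using that by (simp add: D_def)
      qed (use F(2) True z(2) nG in auto)
      then obtain h where h: "h \<in> closed_segment F G" "form_disc h = 0 \<or> form_height h = X
        \<or> (\<exists>z\<in>closure D - D. center i h z)" by blast
      have "closure D \<subseteq> E" using DE clE by (intro closure_minimal) auto
      moreover have "\<exists>Q\<in>set (boundary_polys (weight i) L X). Q h = 0" if "form_height h = X"
      proof -
        have "\<bar>form_I h ^ 3\<bar> = X \<or> (form_J h)^2 = 4 * X"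
          using that by (auto simp: form_height_def max_def power_abs split: if_splits)
        then have "form_I h ^ 3 - X = 0 \<or> form_I h ^ 3 + X = 0 \<or> (form_J h)^2 - 4 * X = 0" by linarith
        then show ?thesis unfolding boundary_polys_def by auto
      qed
      moreover have "\<exists>Q\<in>set (boundary_polys (weight i) L X). Q h = 0" if "form_disc h = 0"
        using that by (simp add: boundary_polys_def)
      ultimately show ?thesis using h geod by blast
    qed
  qed
qed

section \<open>Irreducibility and integral factorizations\<close>

text \<open>By Gauss's lemma this is reducibility over the rationals, in a form that exhibits
  integers to be counted. The linear factor may be y, so that leading coefficient 0 is
  included.\<close>

definition splits :: "quartic \<Rightarrow> bool" where
  "splits f \<longleftrightarrow> (\<exists>p q c0 c1 c2 c3. f = vector [p * c0, p * c1 + q * c0, p * c2 + q * c1, p * c3 + q * c2, q * c3])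
     \<or> (\<exists>p q r s t u. f = vector [p * s, p * t + q * s, p * u + q * t + r * s, q * u + r * t, r * u])"

lemma splits_iff_eval:
  "splits f \<longleftrightarrow> (\<exists>p q c0 c1 c2 c3. \<forall>x y :: int. quartic_eval f x y =
        (p * x + q * y) * (c0 * x^3 + c1 * x^2 * y + c2 * x * y^2 + c3 * y^3))
     \<or> (\<exists>p q r s t u. \<forall>x y :: int. quartic_eval f x y =
        (p * x^2 + q * x * y + r * y^2) * (s * x^2 + t * x * y + u * y^2))"
proof -
  have 1: "f = vector [p * c0, p * c1 + q * c0, p * c2 + q * c1, p * c3 + q * c2, q * c3] \<longleftrightarrow>
    (\<forall>x y :: int. quartic_eval f x y = (p * x + q * y) * (c0 * x^3 + c1 * x^2 * y + c2 * x * y^2 + c3 * y^3))"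
    for p q c0 c1 c2 c3
  proof -
    let ?g = "vector [p * c0, p * c1 + q * c0, p * c2 + q * c1, p * c3 + q * c2, q * c3] :: quartic"
    have "quartic_eval ?g x y = (p * x + q * y) * (c0 * x^3 + c1 * x^2 * y + c2 * x * y^2 + c3 * y^3)" for x y :: int
      unfolding quartic_eval_def vector_5 of_int_eq_id id_apply by algebra
    then show ?thesis using quartic_eval_inject[of f ?g] by auto
  qed
  have 2: "f = vector [p * s, p * t + q * s, p * u + q * t + r * s, q * u + r * t, r * u] \<longleftrightarrow>
    (\<forall>x y :: int. quartic_eval f x y = (p * x^2 + q * x * y + r * y^2) * (s * x^2 + t * x * y + u * y^2))"
    for p q r s t u
  proof -
    let ?g = "vector [p * s, p * t + q * s, p * u + q * t + r * s, q * u + r * t, r * u] :: quartic"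
    have "quartic_eval ?g x y = (p * x^2 + q * x * y + r * y^2) * (s * x^2 + t * x * y + u * y^2)" for x y :: int
      unfolding quartic_eval_def vector_5 of_int_eq_id id_apply by algebra
    then show ?thesis using quartic_eval_inject[of f ?g] by auto
  qed
  show ?thesis unfolding splits_def 1 2 ..
qed

lemma quartic_eval_act_entries:
  "quartic_eval (quartic_act \<gamma> f) x y =
     quartic_eval f (\<gamma>$1$1 * x + \<gamma>$2$1 * y) (\<gamma>$1$2 * x + \<gamma>$2$2 * y)" for x y :: int
  by (simp add: quartic_eval_act Let_def vector_matrix_mult_def sum_2 mult.commute)

lemma splits_act:
  assumes "splits f"
  shows "splits (quartic_act \<gamma> f)"
proof -
  define P Q R S where "P = \<gamma>$1$1" and "Q = \<gamma>$1$2" and "R = \<gamma>$2$1" and "S = \<gamma>$2$2"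
  have ev: "quartic_eval (quartic_act \<gamma> f) x y = quartic_eval f (P * x + R * y) (Q * x + S * y)" for x y :: int
    by (simp add: quartic_eval_act_entries P_def Q_def R_def S_def)
  from assms consider (lin) p q c0 c1 c2 c3 where "\<And>x y :: int. quartic_eval f x y =
        (p * x + q * y) * (c0 * x^3 + c1 * x^2 * y + c2 * x * y^2 + c3 * y^3)"
    | (quad) p q r s t u where "\<And>x y :: int. quartic_eval f x y =
        (p * x^2 + q * x * y + r * y^2) * (s * x^2 + t * x * y + u * y^2)"
    unfolding splits_iff_eval by metis
  then show ?thesis
  proof cases
    case lin
    have "quartic_eval (quartic_act \<gamma> f) x y = ((p*P + q*Q) * x + (p*R + q*S) * y) *
      ((c0*P^3 + c1*P^2*Q + c2*P*Q^2 + c3*Q^3) * x^3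
       + (3*c0*P^2*R + c1*(P^2*S + 2*P*Q*R) + c2*(2*P*Q*S + Q^2*R) + 3*c3*Q^2*S) * x^2 * y
       + (3*c0*P*R^2 + c1*(2*P*R*S + Q*R^2) + c2*(P*S^2 + 2*Q*R*S) + 3*c3*Q*S^2) * x * y^2
       + (c0*R^3 + c1*R^2*S + c2*R*S^2 + c3*S^3) * y^3)" for x y
      unfolding ev lin by algebra
    then show ?thesis unfolding splits_iff_eval by blast
  next
    case quad
    have "quartic_eval (quartic_act \<gamma> f) x y =
      ((p*P^2 + q*P*Q + r*Q^2) * x^2 + (2*p*P*R + q*(P*S + Q*R) + 2*r*Q*S) * x * y + (p*R^2 + q*R*S + r*S^2) * y^2)
     * ((s*P^2 + t*P*Q + u*Q^2) * x^2 + (2* s*P*R + t*(P*S + Q*R) + 2*u*Q*S) * x * y + (s*R^2 + t*R*S + u*S^2) * y^2)"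
      for x y
      unfolding ev quad by algebra
    then show ?thesis unfolding splits_iff_eval by blast
  qed
qed

lemma splits_if_leading_0:
  assumes "f$1 = 0"
  shows "splits f"
proof -
  have "f = vector [0 * f$2, 0 * f$3 + 1 * f$2, 0 * f$4 + 1 * f$3, 0 * f$5 + 1 * f$4, 1 * f$5]"
    using assms by (simp add: vec5_eq_iff vector_5)
  then show ?thesis unfolding splits_def by blast
qed

lemma map_poly_hom_mult:
  fixes h :: "'a::comm_semiring_1 \<Rightarrow> 'b::comm_semiring_1"
  assumes h: "h 0 = 0" "\<And>a b. h (a + b) = h a + h b" "\<And>a b. h (a * b) = h a * h b"
  shows "map_poly h (p * q) = map_poly h p * map_poly h q"
proof (rule poly_eqI)
  fix n
  have s: "h (sum g A) = (\<Sum>a\<in>A. h (g a))" for g :: "nat \<Rightarrow> 'a" and A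
    by (induction A rule: infinite_finite_induct) (auto simp: h)
  show "coeff (map_poly h (p * q)) n = coeff (map_poly h p * map_poly h q) n"
    by (simp add: coeff_map_poly coeff_mult h s)
qed

lemma map_poly_hom_add:
  assumes h: "h 0 = 0" "\<And>a b. h (a + b) = h a + h b"
  shows "map_poly h (p + q) = map_poly h p + map_poly h q"
  by (rule poly_eqI) (simp add: coeff_map_poly h)

text \<open>Homogeneous factors of positive degree vanish at (0, 0), which no unit does;
  \<open>ev\<close> is the evaluation there.\<close>

lemma not_splits_if_irreducible:
  assumes "irreducible_over_Q f"
  shows "\<not> splits f"
proof
  define X Y :: "rat poly poly" where "X = [:0, 1:]" and "Y = [:[:0, 1:]:]"
  define ev :: "rat poly poly \<Rightarrow> rat" where "ev U = poly (poly U 0) 0" for U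
  have ev: "ev (U * V) = ev U * ev V" "ev (U + V) = ev U + ev V" "ev (of_int n) = of_int n" "ev 1 = 1"
    "ev X = 0" "ev Y = 0" "ev (U ^ Suc m) = ev U ^ Suc m" for U V n m
    by (simp_all add: ev_def X_def Y_def)
  have nonunit: "\<not> U dvd 1" if "ev U = 0" for U
    using that ev(1,4) by (metis dvd_def mult_zero_left zero_neq_one)
  have irr: "irreducible (quartic_eval f X Y)" using assms by (simp add: irreducible_over_Q_def X_def Y_def)
  assume "splits f"
  then show False unfolding splits_def
  proof (elim disjE exE)
    fix p q c0 c1 c2 c3
    assume f: "f = vector [p * c0, p * c1 + q * c0, p * c2 + q * c1, p * c3 + q * c2, q * c3]"
    let ?A = "of_int p * X + of_int q * Y"
    let ?B = "of_int c0 * X^3 + of_int c1 * X^2 * Y + of_int c2 * X * Y^2 + of_int c3 * Y^3"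
    have "quartic_eval f X Y = ?A * ?B"
      unfolding f quartic_eval_def vector_5 of_int_add of_int_mult by algebra
    moreover have "ev ?A = 0" "ev ?B = 0"
      by (simp_all add: ev power2_eq_square power3_eq_cube)
    ultimately show False using irreducibleD[OF irr] nonunit by blast
  next
    fix p q r s t u
    assume f: "f = vector [p * s, p * t + q * s, p * u + q * t + r * s, q * u + r * t, r * u]"
    let ?A = "of_int p * X^2 + of_int q * X * Y + of_int r * Y^2"
    let ?B = "of_int s * X^2 + of_int t * X * Y + of_int u * Y^2"
    have "quartic_eval f X Y = ?A * ?B"
      unfolding f quartic_eval_def vector_5 of_int_add of_int_mult by algebra
    moreover have "ev ?A = 0" "ev ?B = 0"
      by (simp_all add: ev power2_eq_square)
    ultimately show False using irreducibleD[OF irr] nonunit by blast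
  qed
qed

section \<open>Gauss's lemma and simple roots\<close>

definition dehom :: "quartic \<Rightarrow> int poly" where
  "dehom f = [:f$5, f$4, f$3, f$2, f$1:]"

lemma coeff_mult_low:
  fixes G H :: "int poly"
  shows "coeff (G * H) 0 = coeff G 0 * coeff H 0"
    "coeff (G * H) 1 = coeff G 0 * coeff H 1 + coeff G 1 * coeff H 0"
    "coeff (G * H) 2 = coeff G 0 * coeff H 2 + coeff G 1 * coeff H 1 + coeff G 2 * coeff H 0"
    "coeff (G * H) 3 = coeff G 0 * coeff H 3 + coeff G 1 * coeff H 2 + coeff G 2 * coeff H 1 + coeff G 3 * coeff H 0"
    "coeff (G * H) 4 = coeff G 0 * coeff H 4 + coeff G 1 * coeff H 3 + coeff G 2 * coeff H 2
       + coeff G 3 * coeff H 1 + coeff G 4 * coeff H 0"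
  by (simp_all add: coeff_mult eval_nat_numeral)

lemma splits_if_int_factors:
  assumes "dehom f = G * H" "degree G = 1 \<and> degree H = 3 \<or> degree G = 2 \<and> degree H = 2"
  shows "splits f"
proof -
  have c: "coeff (dehom f) 0 = f$5" "coeff (dehom f) 1 = f$4" "coeff (dehom f) 2 = f$3"
    "coeff (dehom f) 3 = f$2" "coeff (dehom f) 4 = f$1"
    by (simp_all add: dehom_def eval_nat_numeral)
  note f = c[unfolded assms(1) coeff_mult_low, symmetric]
  from assms(2) show ?thesis
  proof (elim disjE conjE)
    assume d: "degree G = 1" "degree H = 3"
    have z: "coeff G 2 = 0" "coeff G 3 = 0" "coeff G 4 = 0" "coeff H 4 = 0"
      by (rule coeff_eq_0, use d in simp)+
    have "f = vector [coeff G 1 * coeff H 3, coeff G 1 * coeff H 2 + coeff G 0 * coeff H 3,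
      coeff G 1 * coeff H 1 + coeff G 0 * coeff H 2, coeff G 1 * coeff H 0 + coeff G 0 * coeff H 1,
      coeff G 0 * coeff H 0]"
      using f z by (simp add: vec5_eq_iff vector_5 mult.commute add.commute)
    then show ?thesis unfolding splits_def by blast
  next
    assume d: "degree G = 2" "degree H = 2"
    have z: "coeff G 3 = 0" "coeff G 4 = 0" "coeff H 3 = 0" "coeff H 4 = 0"
      by (rule coeff_eq_0, use d in simp)+
    have "f = vector [coeff G 2 * coeff H 2, coeff G 2 * coeff H 1 + coeff G 1 * coeff H 2,
      coeff G 2 * coeff H 0 + coeff G 1 * coeff H 1 + coeff G 0 * coeff H 2,
      coeff G 1 * coeff H 0 + coeff G 0 * coeff H 1, coeff G 0 * coeff H 0]"
      using f z by (simp add: vec5_eq_iff vector_5)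
    then show ?thesis unfolding splits_def by blast
  qed
qed

lemma clear_denominators:
  fixes g :: "rat poly"
  shows "\<exists>N (G :: int poly). N \<noteq> 0 \<and> smult (of_int N) g = map_poly of_int G"
proof (induction g)
  case 0
  show ?case by (intro exI[of _ 1] exI[of _ 0]) simp
next
  case (pCons a g)
  then obtain N G where NG: "N \<noteq> 0" "smult (of_int N) g = map_poly of_int (G :: int poly)" by blast
  obtain r s where rs: "s > 0" "a = of_int r / of_int s" by (metis quotient_of_denom_pos quotient_of_div surj_pair)
  have e: "map_poly of_int (smult s G) = smult (of_int s) (map_poly of_int G :: rat poly)"
    by (rule poly_eqI) (simp add: coeff_map_poly)
  have "smult (of_int (N * s)) (pCons a g) = map_poly of_int (pCons (r * N) (smult s G))"
    using rs by (simp add: map_poly_pCons e flip: NG(2)) (simp add: mult.commute)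
  then show ?case using NG(1) rs(1) by (intro exI[of _ "N * s"] exI[of _ "pCons (r * N) (smult s G)"]) simp
qed

lemma degree_dehom: "f$1 \<noteq> 0 \<Longrightarrow> degree (dehom f) = 4"
  by (simp add: dehom_def)

text \<open>Gauss's lemma: after clearing denominators, the primitive parts of the two factors
  multiply to that of \<open>dehom f\<close> up to sign. The content of \<open>dehom f\<close> and
  the sign are then put into one factor.\<close>

lemma splits_if_rat_factors:
  fixes g h :: "rat poly"
  assumes f: "f$1 \<noteq> 0" and gh: "map_poly of_int (dehom f) = g * h" and deg: "degree g \<ge> 1" "degree h \<ge> 1"
  shows "splits f"
proof -
  obtain N G where G: "N \<noteq> 0" "smult (of_int N) g = map_poly of_int (G :: int poly)"
    using clear_denominators by blast
  obtain M H where H: "M \<noteq> 0" "smult (of_int M) h = map_poly of_int (H :: int poly)"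
    using clear_denominators by blast
  have inj: "p = q" if "map_poly of_int p = (map_poly of_int q :: rat poly)" for p q
    using that by (auto simp: poly_eq_iff coeff_map_poly)
  have "map_poly of_int (smult (N * M) (dehom f)) = smult (of_int (N * M)) (g * h)"
    unfolding gh[symmetric] by (rule poly_eqI) (simp add: coeff_map_poly)
  also have "\<dots> = smult (of_int N) g * smult (of_int M) h" by (simp add: mult.commute)
  also have "\<dots> = map_poly of_int (G * H)" unfolding G H by (rule map_poly_hom_mult[symmetric]) simp_all
  finally have e: "smult (N * M) (dehom f) = G * H" by (rule inj)
  have dg: "degree g = degree G" "degree h = degree H"
  proof -
    have "degree (smult (of_int N) g) = degree G" "degree (smult (of_int M) h) = degree H"
      unfolding G H by (simp_all add: degree_map_poly)
    then show "degree g = degree G" "degree h = degree H" using G(1) H(1) by (simp_all only: degree_smult_eq of_int_eq_0_iff if_False)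
  qed
  have "primitive_part (smult (N * M) (dehom f)) = primitive_part G * primitive_part H"
    unfolding e by (rule primitive_part_mult)
  then have pp: "smult (unit_factor (N * M)) (primitive_part (dehom f)) = primitive_part G * primitive_part H"
    by (simp add: primitive_part_smult)
  let ?s = "unit_factor (N * M)"
  have s: "?s * ?s = 1" using G(1) H(1) by (auto simp: sgn_if unit_factor_int_def)
  define G' where "G' = smult (content (dehom f) * ?s) (primitive_part G)"
  have "G' * primitive_part H = smult (content (dehom f) * ?s) (smult ?s (primitive_part (dehom f)))"
    unfolding G'_def pp by simp
  also have "\<dots> = smult (content (dehom f)) (primitive_part (dehom f))"
    using s by (simp add: mult.assoc)
  finally have fac: "dehom f = G' * primitive_part H" by simp
  have f0: "dehom f \<noteq> 0" using f by (simp add: dehom_def)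
  then have "G' \<noteq> 0" "primitive_part H \<noteq> 0" using fac by auto
  then have "degree G' + degree H = 4" using fac degree_dehom[OF f] by (metis degree_mult_eq degree_primitive_part)
  moreover have "degree G' = degree G" using \<open>G' \<noteq> 0\<close> unfolding G'_def by (metis degree_primitive_part degree_smult_eq smult_eq_0_iff)
  ultimately have "degree G' + degree H = 4" "degree G' \<ge> 1" "degree H \<ge> 1" using deg dg by auto
  then consider "degree G' = 1" "degree H = 3" | "degree G' = 2" "degree H = 2" | "degree H = 1" "degree G' = 3"
    by linarith
  then show ?thesis
  proof cases
    case 3
    have "dehom f = primitive_part H * G'" using fac by (simp add: mult.commute)
    then show ?thesis using splits_if_int_factors 3 by (metis degree_primitive_part)
  qed (use fac splits_if_int_factors in \<open>metis degree_primitive_part\<close>)+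
qed

text \<open>The leading coefficient of F in x is a nonzero constant, so those of its factors are
  constants as well. Hence the factors, not being units, have positive degree in x, and putting y =
  1 preserves these degrees.\<close>

lemma splits_if_reducible:
  assumes f: "f$1 \<noteq> 0" and r: "\<not> irreducible_over_Q f"
  shows "splits f"
proof -
  define X Y :: "rat poly poly" where "X = [:0, 1:]" and "Y = [:[:0, 1:]:]"
  define F where "F = quartic_eval f X Y"
  have F: "F = [:[:0,0,0,0,of_int (f$5):], [:0,0,0,of_int (f$4):], [:0,0,of_int (f$3):], [:0, of_int (f$2):], [:of_int (f$1):]:]"
    unfolding F_def quartic_eval_def X_def Y_def
    by (simp add: power2_eq_square power3_eq_cube power4_eq_xxxx of_int_poly)
  have F0: "F \<noteq> 0" "degree F = 4" "lead_coeff F = [:of_int (f$1):]" using f by (simp_all add: F)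
  have nu: "\<not> F dvd 1" using F0 by (auto simp: is_unit_poly_iff)
  have "\<not> irreducible F" using r by (simp add: irreducible_over_Q_def F_def X_def Y_def)
  then obtain A B where AB: "F = A * B" "\<not> A dvd 1" "\<not> B dvd 1"
    using F0 nu unfolding irreducible_def by blast
  define \<phi> where "\<phi> = map_poly (\<lambda>c :: rat poly. poly c 1)"
  have hom: "\<phi> (U * V) = \<phi> U * \<phi> V" for U V
    unfolding \<phi>_def by (rule map_poly_hom_mult) simp_all
  have "\<phi> F = map_poly of_int (dehom f)"
    by (simp add: \<phi>_def F dehom_def map_poly_pCons)
  then have fac: "map_poly of_int (dehom f) = \<phi> A * \<phi> B" using AB hom by simp
  have lc: "lead_coeff A * lead_coeff B = [:of_int (f$1):]" using F0(3) unfolding AB(1) lead_coeff_mult .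
  have d0: "degree (lead_coeff A) = 0 \<and> degree (lead_coeff B) = 0 \<and> lead_coeff A \<noteq> 0 \<and> lead_coeff B \<noteq> 0"
  proof -
    have nz: "lead_coeff A \<noteq> 0" "lead_coeff B \<noteq> 0" using AB(1) F0 by auto
    have "degree (lead_coeff A) + degree (lead_coeff B) = degree [:rat_of_int (f$1):]"
      using degree_mult_eq[OF nz] lc by simp
    then show ?thesis using nz by simp
  qed
  have key: "degree (\<phi> U) = degree U \<and> degree U \<ge> 1"
    if U: "degree (lead_coeff U) = 0" "lead_coeff U \<noteq> 0" "\<not> U dvd 1" for U
  proof -
    obtain c where c: "lead_coeff U = [:c:]" "c \<noteq> 0" using U by (metis degree_0_id pCons_eq_0_iff degree_eq_zeroE)
    have "coeff (\<phi> U) (degree U) = c" using c by (simp add: \<phi>_def coeff_map_poly)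
    then have "degree (\<phi> U) \<ge> degree U" using c by (intro le_degree) simp
    moreover have "degree (\<phi> U) \<le> degree U" unfolding \<phi>_def
      by (rule degree_le) (simp add: coeff_map_poly coeff_eq_0)
    moreover have "degree U \<noteq> 0"
    proof
      assume "degree U = 0"
      then have "U = [:[:c:]:]" using c(1) by (metis degree_0_id degree_eq_zeroE lead_coeff_pCons(2))
      moreover have "[:[:c:]:] * [:[:1/c:]:] = (1 :: rat poly poly)" using c(2) by (simp add: one_pCons)
      ultimately show False using U(3) by (metis dvd_triv_left)
    qed
    ultimately show ?thesis by simp
  qed
  show ?thesis
    by (rule splits_if_rat_factors[OF f fac]) (use key AB d0 in auto)
qed

lemma irreducible_over_Q_iff: "irreducible_over_Q f \<longleftrightarrow> \<not> splits f"
  using not_splits_if_irreducible splits_if_reducible splits_if_leading_0 by blast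

text \<open>A double root would have a minimal polynomial of degree at most \<open>3\<close> dividing \<open>f\<close>.\<close>

lemma no_double_root:
  fixes x :: real
  assumes f: "\<not> splits f" and x: "poly (map_poly of_int (dehom f)) x = 0"
    "poly (pderiv (map_poly of_int (dehom f))) x = 0"
  shows False
proof -
  have f1: "f$1 \<noteq> 0" using f splits_if_leading_0 by blast
  define r :: "rat poly \<Rightarrow> real poly" where "r = map_poly of_rat"
  define P :: "rat poly" where "P = map_poly of_int (dehom f)"
  have rP: "r P = map_poly of_int (dehom f)"
    unfolding r_def P_def by (rule poly_eqI) (simp add: coeff_map_poly)
  have rP': "r (pderiv P) = pderiv (r P)"
    unfolding r_def by (rule poly_eqI) (simp add: coeff_map_poly coeff_pderiv of_rat_mult of_rat_add)
  have P0: "P \<noteq> 0" and P4: "degree P = 4"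
    using degree_dehom[OF f1] f1 by (auto simp: P_def degree_map_poly dehom_def map_poly_pCons)
  have P'0: "pderiv P \<noteq> 0" using P4 by (simp add: pderiv_eq_0_iff)
  have P'3: "degree (pderiv P) = 3" using P4 by (simp add: degree_pderiv)
  let ?ok = "\<lambda>m. m \<noteq> 0 \<and> poly (r m) x = 0"
  have "?ok (pderiv P)" using P'0 x(2) rP rP' by simp
  then obtain m where m: "?ok m" and min: "\<And>m'. ?ok m' \<Longrightarrow> degree m \<le> degree m'"
    using exists_least_iff[of "\<lambda>n. \<exists>m. ?ok m \<and> degree m = n"] by (metis not_le_imp_less)
  have m3: "degree m \<le> 3" using min[OF \<open>?ok (pderiv P)\<close>] P'3 by simp
  have "poly (r (P mod m)) x = 0"
  proof -
    have "r (m * (P div m)) + r (P mod m) = r (m * (P div m) + P mod m)"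
      unfolding r_def by (rule map_poly_hom_add[symmetric]) (simp_all add: of_rat_add)
    also have "\<dots> = r P" by simp
    finally have "r (m * (P div m)) + r (P mod m) = r P" .
    moreover have "r (m * (P div m)) = r m * r (P div m)"
      unfolding r_def by (rule map_poly_hom_mult) (simp_all add: of_rat_add of_rat_mult)
    ultimately show ?thesis using m x(1) rP by (metis add.left_neutral mult_zero_left poly_add poly_mult)
  qed
  then have "P mod m = 0" using min[of "P mod m"] m degree_mod_less[of m P] by fastforce
  then have fac: "P = m * (P div m)" by (metis add.right_neutral mult_div_mod_eq)
  have "degree m \<noteq> 0"
  proof
    assume "degree m = 0"
    then obtain c where "m = [:c:]" by (metis degree_eq_zeroE)
    then show False using m by (simp add: r_def map_poly_pCons)
  qed
  moreover have "degree (P div m) \<ge> 1"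
  proof -
    have "P div m \<noteq> 0" using fac P0 by auto
    then have "degree m + degree (P div m) = 4" using fac P4 m degree_mult_eq by metis
    then show ?thesis using m3 by simp
  qed
  ultimately have "splits f" using splits_if_rat_factors[OF f1, of m "P div m"] fac by (simp add: P_def)
  then show False using f by blast
qed

section \<open>Existence of centers\<close>

text \<open>A form with coefficients A, B, C, -B, A is fixed by (x, y) -> (y, -x), the rotation by
  \<pi> about \<open>\<i>\<close>. Solving \<open>base_form\<close> for \<open>w0\<close> and
  \<open>w\<close> gives |w|^2 - w0^2 = (B^2 - 8 A^2 - 4 A C) / 16, which explains the sign
  condition.\<close>

lemma center4I:
  assumes v: "v > 0" and G: "subst_form v 0 u 1 F = vector [A, B, C, - B, A]"
    and s: "if i = 2 then B^2 - 8*A^2 - 4*A*C < 0 else B^2 - 8*A^2 - 4*A*C > 0" and i: "i \<noteq> 1"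
  shows "center i F (Complex u v)"
proof -
  define w0 w where "w0 = (6*A + C) / 8" and "w = Complex ((2*A - C) / 8) (B / 4)"
  have G': "subst_form v 0 u 1 F = Psi 4 \<i> w0 w"
    unfolding G Psi_i by (simp add: base_form_def w0_def w_def vec5_eq_iff vector_5 field_simps)
  have "(cmod w)^2 - \<bar>w0\<bar>^2 = (B^2 - 8*A^2 - 4*A*C) / 16"
    by (simp add: w_def w0_def cmod_power2 power_divide) (simp add: power2_eq_square field_simps)
  then have sq: "if i = 2 then (cmod w)^2 < \<bar>w0\<bar>^2 else \<bar>w0\<bar>^2 < (cmod w)^2"
    using s by (auto split: if_splits)
  have "admissible i w0 w"
    using sq power2_less_imp_less[of "cmod w" "\<bar>w0\<bar>"] power2_less_imp_less[of "\<bar>w0\<bar>" "cmod w"]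
    by (auto simp only: admissible_def abs_ge_zero norm_ge_zero split: if_splits)
  then have c: "center i (subst_form v 0 u 1 F) \<i>"
    unfolding center_iff_Psi G' using i by (auto simp: weight_def)
  have D: "v * 1 - 0 * u \<noteq> 0" using v by simp
  from center_subst_pos[OF c, of "1/v" 1 0 "- u / v"]
  have "center i (subst_form (1/v) 0 (- u / v) 1 (subst_form v 0 u 1 F)) ((\<i> + of_real (u/v)) / of_real (1 / v))"
    using v by simp
  moreover have "subst_form (1/v) 0 (- u / v) 1 (subst_form v 0 u 1 F) = F"
    using subst_form_inverse(2)[OF D, of F] v by simp
  moreover have "(\<i> + of_real (u/v)) / of_real (1 / v) = Complex u v"
    using v by (simp add: complex_eq_iff Re_divide Im_divide field_simps power2_eq_square)
  ultimately show ?thesis by simp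
qed

text \<open>Such a form is x^2 + y^2 times a x^2 + b x y + c y^2, and the positive discriminant of
  the second factor becomes |w0| < |w|.\<close>

lemma center2I:
  assumes v: "v > 0" and G: "subst_form v 0 u 1 F = vector [a, b, a + c, b, c]" and s: "b^2 - 4*a*c > 0"
  shows "center 1 F (Complex u v)"
proof -
  define w0 w where "w0 = (a + c) / 2" and "w = Complex ((a - c) / 2) (b / 2)"
  have G': "subst_form v 0 u 1 F = Psi 2 \<i> w0 w"
    unfolding G Psi_i by (simp add: base_form_def w0_def w_def vec5_eq_iff vector_5 field_simps)
  have "(cmod w)^2 - \<bar>w0\<bar>^2 = (b^2 - 4*a*c) / 4"
    by (simp add: w_def w0_def cmod_power2 power_divide) (simp add: power2_eq_square field_simps)
  then have "\<bar>w0\<bar>^2 < (cmod w)^2" using s by simp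
  then have "admissible 1 w0 w"
    using power2_less_imp_less[of "\<bar>w0\<bar>" "cmod w"] by (simp add: admissible_def del: power2_abs)
  then have c: "center 1 (subst_form v 0 u 1 F) \<i>"
    unfolding center_iff_Psi G' by (auto simp: weight_def)
  have D: "v * 1 - 0 * u \<noteq> 0" using v by simp
  from center_subst_pos[OF c, of "1/v" 1 0 "- u / v"]
  have "center 1 (subst_form (1/v) 0 (- u / v) 1 (subst_form v 0 u 1 F)) ((\<i> + of_real (u/v)) / of_real (1 / v))"
    using v by simp
  moreover have "subst_form (1/v) 0 (- u / v) 1 (subst_form v 0 u 1 F) = F"
    using subst_form_inverse(2)[OF D, of F] v by simp
  moreover have "(\<i> + of_real (u/v)) / of_real (1 / v) = Complex u v"
    using v by (simp add: complex_eq_iff Re_divide Im_divide field_simps power2_eq_square)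
  ultimately show ?thesis by simp
qed

text \<open>The center is the intersection point of the geodesics that join opposite roots.\<close>

lemma center_four_real_roots:
  assumes F: "\<And>x y. form_eval F x y = a * (x - r1 * y) * (x - r2 * y) * (x - r3 * y) * (x - r4 * y)"
    and a: "a \<noteq> 0" and r: "r1 < r2" "r2 < r3" "r3 < r4"
  shows "\<exists>z. center 0 F z"
proof -
  define D where "D = r2 + r4 - r1 - r3"
  have D: "D > 0" using r by (simp add: D_def)
  \<comment> \<open>Obtained from (u - r1) (r3 - u) = (u - r2) (r4 - u), whose common value is v^2:
    both geodesics pass through u + i v.\<close>
  define u where "u = (r2 * r4 - r1 * r3) / D"
  define v where "v = sqrt ((r3 - u) * (u - r1))"
  define d1 d2 d3 d4 where "d1 = r1 - u" and "d2 = r2 - u" and "d3 = r3 - u" and "d4 = r4 - u"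
  have uD: "u * D = r2 * r4 - r1 * r3" using D by (simp add: u_def)
  have "(u - r1) * D = (r2 - r1) * (r4 - r1)" using uD unfolding D_def by algebra
  then have "u - r1 > 0" using r D by (metis diff_gt_0_iff_gt less_trans mult_pos_pos zero_less_mult_pos2)
  moreover have "(r3 - u) * D = (r3 - r2) * (r4 - r3)" using uD unfolding D_def by algebra
  then have "r3 - u > 0" using r D by (metis diff_gt_0_iff_gt less_trans mult_pos_pos zero_less_mult_pos2)
  ultimately have pos: "(r3 - u) * (u - r1) > 0" by simp
  then have v: "v > 0" "v^2 = - (d1 * d3)"
    by (simp_all add: v_def d1_def d3_def algebra_simps)
  have v': "v^2 = - (d2 * d4)" using v(2) uD unfolding d1_def d2_def d3_def d4_def D_def by algebra
  have "center 0 F (Complex u v)"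
  proof (rule center4I[OF v(1)])
    show "subst_form v 0 u 1 F = vector [a * v^4, - a * v^3 * (d1 + d2 + d3 + d4),
      a * v^2 * ((d1 + d3) * (d2 + d4) - 2 * v^2), - (- a * v^3 * (d1 + d2 + d3 + d4)), a * v^4]"
    proof (rule form_eval_inject)
      fix x y
      have "form_eval (subst_form v 0 u 1 F) x y
         = a * (v * x - d1 * y) * (v * x - d2 * y) * (v * x - d3 * y) * (v * x - d4 * y)"
        by (simp add: form_eval_subst F d1_def d2_def d3_def d4_def algebra_simps)
      also have "\<dots> = form_eval (vector [a * v^4, - a * v^3 * (d1 + d2 + d3 + d4),
      a * v^2 * ((d1 + d3) * (d2 + d4) - 2 * v^2), - (- a * v^3 * (d1 + d2 + d3 + d4)), a * v^4]) x y"
        unfolding form_eval_def vector_5 using v(2) v' by algebra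
      finally show "form_eval (subst_form v 0 u 1 F) x y = \<dots>" .
    qed
    have "(- a * v^3 * (d1 + d2 + d3 + d4))\<^sup>2 - 8 * (a * v^4)\<^sup>2 - 4 * (a * v^4) * (a * v^2 * ((d1 + d3) * (d2 + d4) - 2 * v^2))
       = (a * v^3 * (d1 + d3 - d2 - d4))^2" by algebra
    moreover have "d1 + d3 - d2 - d4 \<noteq> 0" using D by (simp add: D_def d1_def d2_def d3_def d4_def)
    ultimately show "if (0::nat) = 2 then (- a * v^3 * (d1 + d2 + d3 + d4))\<^sup>2 - 8 * (a * v^4)\<^sup>2 - 4 * (a * v^4) * (a * v^2 * ((d1 + d3) * (d2 + d4) - 2 * v^2)) < 0
      else 0 < (- a * v^3 * (d1 + d2 + d3 + d4))\<^sup>2 - 8 * (a * v^4)\<^sup>2 - 4 * (a * v^4) * (a * v^2 * ((d1 + d3) * (d2 + d4) - 2 * v^2))"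
      using a v(1) by simp
  qed simp
  then show ?thesis by blast
qed

lemma center_two_real_roots:
  assumes F: "\<And>x y. form_eval F x y = a * ((x - u * y)^2 + v^2 * y^2) * (x - r1 * y) * (x - r2 * y)"
    and a: "a \<noteq> 0" and r: "r1 \<noteq> r2" and v: "v > 0"
  shows "\<exists>z. center 1 F z"
proof -
  define d1 d2 where "d1 = r1 - u" and "d2 = r2 - u"
  have "center 1 F (Complex u v)"
  proof (rule center2I[OF v])
    show "subst_form v 0 u 1 F = vector [a * v^4, - a * v^3 * (d1 + d2), a * v^4 + a * v^2 * d1 * d2,
       - a * v^3 * (d1 + d2), a * v^2 * d1 * d2]"
    proof (rule form_eval_inject)
      fix x y
      have "form_eval (subst_form v 0 u 1 F) x y = a * ((v * x)^2 + v^2 * y^2) * (v * x - d1 * y) * (v * x - d2 * y)"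
        by (simp add: form_eval_subst F d1_def d2_def algebra_simps)
      also have "\<dots> = form_eval (vector [a * v^4, - a * v^3 * (d1 + d2), a * v^4 + a * v^2 * d1 * d2,
       - a * v^3 * (d1 + d2), a * v^2 * d1 * d2]) x y"
        unfolding form_eval_def vector_5 by algebra
      finally show "form_eval (subst_form v 0 u 1 F) x y = \<dots>" .
    qed
    have "(- a * v^3 * (d1 + d2))^2 - 4 * (a * v^4) * (a * v^2 * d1 * d2) = (a * v^3 * (d1 - d2))^2" by algebra
    moreover have "d1 - d2 \<noteq> 0" using r by (simp add: d1_def d2_def)
    ultimately show "0 < (- a * v^3 * (d1 + d2))^2 - 4 * (a * v^4) * (a * v^2 * d1 * d2)"
      using a v by simp
  qed
  then show ?thesis by blast
qed

text \<open>The center is the midpoint of the geodesic segment between the two roots in the upper half plane.\<close>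

lemma center_no_real_roots:
  assumes F: "\<And>x y. form_eval F x y = a * ((x - u1 * y)^2 + v1^2 * y^2) * ((x - u2 * y)^2 + v2^2 * y^2)"
    and a: "a \<noteq> 0" and v: "v1 > 0" "v2 > 0"
  shows "\<exists>z. center 2 F z"
proof -
  define s where "s u' v' x = sqrt ((x - u')^2 + v'^2)" for u' v' x :: real
  have sp: "s u' v' x > 0" "s u' v' x ^ 2 = (x - u')^2 + v'^2" "\<bar>x - u'\<bar> < s u' v' x" if "v' > 0" for u' v' x
  proof -
    have "(x - u')^2 + v'^2 > 0" using that by (simp add: add_nonneg_pos)
    then show 1: "s u' v' x > 0" "s u' v' x ^ 2 = (x - u')^2 + v'^2" by (simp_all add: s_def)
    have "\<bar>x - u'\<bar>^2 < s u' v' x ^ 2" using that by (simp add: 1)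
    then show "\<bar>x - u'\<bar> < s u' v' x" using 1(1) by (simp add: power2_less_imp_less)
  qed
  \<comment> \<open>Let s1, s2 be the distances of u from the two roots. The rotation by \<pi> about
    u + i w interchanges the two quadratic factors up to constants if w^2 = s1 s2 and (u - u1) s2 +
    (u - u2) s1 = 0. The second equation is \<open>h u = 0\<close>, which the intermediate value
    theorem solves between u1 and u2.\<close>
  define h where "h x = (x - u1) * s u2 v2 x + (x - u2) * s u1 v1 x" for x
  have ch: "continuous_on S h" for S
    unfolding h_def s_def by (intro continuous_intros)
  have "h (min u1 u2) \<le> 0" "0 \<le> h (max u1 u2)"
    using sp(1)[OF v(1)] sp(1)[OF v(2)]
    by (auto simp: h_def min_def max_def mult_nonneg_nonneg mult_nonpos_nonneg less_imp_le)
  moreover have "min u1 u2 \<le> max u1 u2" by simp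
  ultimately obtain u where hu: "h u = 0"
    using IVT'[of h "min u1 u2" 0 "max u1 u2", OF _ _ _ ch] by blast
  define p1 p2 s1 s2 where "p1 = u - u1" and "p2 = u - u2" and "s1 = s u1 v1 u" and "s2 = s u2 v2 u"
  have sq: "s1^2 = p1^2 + v1^2" "s2^2 = p2^2 + v2^2" and s0: "s1 > 0" "s2 > 0"
    and lt: "\<bar>p1\<bar> < s1" "\<bar>p2\<bar> < s2"
    using sp[OF v(1)] sp[OF v(2)] by (auto simp: s1_def s2_def p1_def p2_def)
  have h: "p1 * s2 + p2 * s1 = 0" using hu by (simp add: h_def p1_def p2_def s1_def s2_def)
  define w where "w = sqrt (s1 * s2)"
  have w: "w > 0" "w^2 = s1 * s2" using s0 by (simp_all add: w_def)
  have "center 2 F (Complex u w)"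
  proof (rule center4I[OF w(1)])
    let ?B = "2 * a * w^3 * (p1 + p2)"
    let ?C = "a * w^2 * (s1^2 + s2^2 + 4 * p1 * p2)"
    show "subst_form w 0 u 1 F = vector [a * w^4, ?B, ?C, - ?B, a * w^4]"
    proof (rule form_eval_inject)
      fix x y
      have "form_eval (subst_form w 0 u 1 F) x y =
          a * ((w * x + p1 * y)^2 + v1^2 * y^2) * ((w * x + p2 * y)^2 + v2^2 * y^2)"
        by (simp add: form_eval_subst F p1_def p2_def algebra_simps)
      also have "\<dots> = a * (w^2 * x^2 + 2 * p1 * w * x * y + s1^2 * y^2) * (w^2 * x^2 + 2 * p2 * w * x * y + s2^2 * y^2)"
        unfolding sq by algebra
      also have "\<dots> = form_eval (vector [a * w^4, ?B, ?C, - ?B, a * w^4]) x y"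
        unfolding form_eval_def vector_5 using h w(2) by algebra
      finally show "form_eval (subst_form w 0 u 1 F) x y = \<dots>" .
    qed
    have "?B^2 - 8*(a * w^4)^2 - 4*(a * w^4)*?C = 4 * (a * w^3)^2 * ((p1 - p2)^2 - 2 * w^2 - s1^2 - s2^2)"
      by algebra
    also have "(p1 - p2)^2 - 2 * w^2 - s1^2 - s2^2 = (p1 - p2)^2 - (s1 + s2)^2"
      unfolding w(2) by (simp add: power2_eq_square algebra_simps)
    finally have e: "?B^2 - 8*(a * w^4)^2 - 4*(a * w^4)*?C = 4 * (a * w^3)^2 * ((p1 - p2)^2 - (s1 + s2)^2)" .
    have "\<bar>p1 - p2\<bar> < s1 + s2" using lt by linarith
    then have "(p1 - p2)^2 < (s1 + s2)^2"
      by (metis abs_ge_zero power2_abs power_strict_mono pos2)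
    then have "?B^2 - 8*(a * w^4)^2 - 4*(a * w^4)*?C < 0"
      unfolding e using a w(1) by (intro mult_pos_neg) auto
    then show "if (2::nat) = 2 then ?B^2 - 8*(a * w^4)^2 - 4*(a * w^4)*?C < 0
      else 0 < ?B^2 - 8*(a * w^4)^2 - 4*(a * w^4)*?C" by simp
  qed simp
  then show ?thesis by blast
qed

section \<open>Factorization of real quartics\<close>

lemma quadratic_factor:
  fixes p :: "real poly"
  assumes z: "poly (map_poly of_real p) z = 0" "Im z \<noteq> 0"
  shows "[:(cmod z)^2, - 2 * Re z, 1:] dvd p"
proof -
  let ?m = "[:(cmod z)^2, - 2 * Re z, 1:]" let ?r = "p mod ?m"
  have m: "poly (map_poly of_real ?m) z = 0"
    unfolding cmod_power2 by (simp add: map_poly_pCons complex_eq_iff power2_eq_square algebra_simps)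
  have "map_poly of_real (?m * (p div ?m) + ?r) =
      map_poly of_real (?m * (p div ?m)) + (map_poly of_real ?r :: complex poly)"
    by (rule map_poly_hom_add) simp_all
  also have "map_poly of_real (?m * (p div ?m)) = map_poly of_real ?m * (map_poly of_real (p div ?m) :: complex poly)"
    by (rule map_poly_hom_mult) simp_all
  finally have r: "poly (map_poly of_real ?r) z = 0"
    using z m by (simp only: mult_div_mod_eq poly_add poly_mult mult_zero_left add_0)
  have "degree ?r < 2" using degree_mod_less[of ?m p] by auto
  then have e: "?r = [:coeff ?r 0, coeff ?r 1:]"
    by (intro poly_eqI) (auto simp: coeff_pCons split: nat.split intro!: coeff_eq_0)
  have "poly (map_poly of_real [:coeff ?r 0, coeff ?r 1:]) z = 0" using r e by metis
  then have "complex_of_real (coeff ?r 0) + z * complex_of_real (coeff ?r 1) = 0" by (simp add: map_poly_pCons)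
  then have "coeff ?r 1 = 0" "coeff ?r 0 = 0" using z(2) by (auto simp: complex_eq_iff)
  then have "?r = 0" using e by (metis pCons_0_0)
  then show ?thesis by (simp only: mod_eq_0_iff_dvd)
qed

lemma poly_map_of_real: "poly (map_poly of_real p) (of_real x) = of_real (poly p x)"
  by (induction p) (simp_all add: map_poly_pCons)

lemma real_root_or_quadratic_factor:
  fixes p :: "real poly"
  assumes "degree p > 0"
  shows "(\<exists>x. poly p x = 0) \<or> (\<exists>u v q. v > 0 \<and> p = [:u^2 + v^2, - 2 * u, 1:] * q)"
proof -
  have "degree (map_poly complex_of_real p) = degree p" by (simp add: degree_map_poly)
  then have "\<not> constant (poly (map_poly complex_of_real p))" using assms by (simp add: constant_degree)
  then obtain z where z: "poly (map_poly complex_of_real p) z = 0"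
    using fundamental_theorem_of_algebra by blast
  show ?thesis
  proof (cases "Im z = 0")
    case True
    then have "z = of_real (Re z)" by (simp add: complex_eq_iff)
    then have "complex_of_real (poly p (Re z)) = 0" using z
      by (metis of_real_0 poly_map_of_real)
    then show ?thesis by auto
  next
    case False
    from quadratic_factor[OF z this] obtain q where "p = [:(cmod z)^2, - 2 * Re z, 1:] * q" by (auto elim: dvdE)
    then have "p = [:(Re z)^2 + \<bar>Im z\<bar>^2, - 2 * Re z, 1:] * q" by (simp add: cmod_power2)
    then show ?thesis using False by (metis zero_less_abs_iff)
  qed
qed

lemma cubic_real_root:
  fixes p :: "real poly"
  assumes "degree p = 3"
  shows "\<exists>x. poly p x = 0"
proof (rule ccontr)
  assume n: "\<nexists>x. poly p x = 0"
  then obtain u v q where q: "p = [:u^2 + v^2, - 2 * u, 1:] * q"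
    using real_root_or_quadratic_factor[of p] assms by auto
  have "q \<noteq> 0" using q assms by auto
  then have "degree q = 1" using degree_mult_eq[of "[:u^2 + v^2, - 2 * u, 1:]" q] q assms by simp
  then obtain a b where "q = [:a, b:]" "b \<noteq> 0" by (metis degree1_coeffs)
  then have "poly q (- a / b) = 0" by simp
  then have "poly p (- a / b) = 0" unfolding q poly_mult by simp
  then show False using n by blast
qed

lemma sorted4:
  fixes a b c d :: real
  assumes "distinct [a, b, c, d]"
  shows "\<exists>r1 r2 r3 r4. r1 < r2 \<and> r2 < r3 \<and> r3 < r4 \<and> {r1, r2, r3, r4} = {a, b, c, d}
    \<and> (\<forall>x y. (x - r1 * y) * (x - r2 * y) * (x - r3 * y) * (x - r4 * y) = (x - a * y) * (x - b * y) * (x - c * y) * (x - d * y))"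
proof -
  let ?l = "sort [a, b, c, d]"
  obtain r1 r2 r3 r4 where l: "?l = [r1, r2, r3, r4]"
  proof -
    have "?l = [?l ! 0, ?l ! 1, ?l ! 2, ?l ! 3]"
      by (rule nth_equalityI) (auto simp: less_Suc_eq eval_nat_numeral)
    then show thesis by (rule that)
  qed
  have "sorted [r1, r2, r3, r4]" "distinct [r1, r2, r3, r4]" using assms l sorted_sort distinct_sort by metis+
  then have "r1 < r2" "r2 < r3" "r3 < r4" by auto
  moreover have st: "{r1, r2, r3, r4} = {a, b, c, d}"
    using arg_cong[OF l, of set] by (simp only: set_sort list.set)
  moreover have "(x - r1 * y) * (x - r2 * y) * (x - r3 * y) * (x - r4 * y) = (x - a * y) * (x - b * y) * (x - c * y) * (x - d * y)" for x y
  proof -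
    have p: "(\<Prod>r\<in>{r1, r2, r3, r4}. x - r * y) = (\<Prod>r\<in>{a, b, c, d}. x - r * y)"
      using st by simp
    show ?thesis using p assms \<open>distinct [r1, r2, r3, r4]\<close> by (simp add: mult.assoc)
  qed
  ultimately show ?thesis by blast
qed

definition real_dehom :: "quartic \<Rightarrow> real poly" where
  "real_dehom f = map_poly of_int (dehom f)"

lemma poly_real_dehom: "poly (real_dehom f) x = form_eval (real_form f) x 1"
  by (simp add: real_dehom_def dehom_def map_poly_pCons form_eval_def algebra_simps eval_nat_numeral)

lemma form_eval_dehomogenize:
  "y \<noteq> 0 \<Longrightarrow> form_eval F x y = y^4 * form_eval F (x / y) 1"
  by (simp add: form_eval_def field_simps eval_nat_numeral)

lemma real_dehom_simple_root:
  assumes f: "\<not> splits f" and P: "real_dehom f = [:- r, 1:] * c"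
  shows "poly c r \<noteq> 0"
proof
  assume "poly c r = 0"
  then have "poly (real_dehom f) r = 0" "poly (pderiv (real_dehom f)) r = 0"
    by (simp_all add: P pderiv_mult pderiv_pCons del: mult_pCons_left)
  then show False using no_double_root[OF f] by (simp add: real_dehom_def)
qed

text \<open>The real roots are distinct. Two pairs of non-real roots may coincide; this corresponds
  to \<open>w = 0\<close> at the center.\<close>

definition shape :: "nat \<Rightarrow> real ^ 5 \<Rightarrow> bool" where
  "shape i F \<longleftrightarrow> (if i = 0 then \<exists>r1 r2 r3 r4. r1 < r2 \<and> r2 < r3 \<and> r3 < r4 \<and>
       (\<forall>x y. form_eval F x y = F$1 * (x - r1 * y) * (x - r2 * y) * (x - r3 * y) * (x - r4 * y))
     else if i = 1 then \<exists>u v r1 r2. v > 0 \<and> r1 \<noteq> r2 \<and>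
       (\<forall>x y. form_eval F x y = F$1 * ((x - u * y)^2 + v^2 * y^2) * (x - r1 * y) * (x - r2 * y))
     else \<exists>u1 v1 u2 v2. v1 > 0 \<and> v2 > 0 \<and>
       (\<forall>x y. form_eval F x y = F$1 * ((x - u1 * y)^2 + v1^2 * y^2) * ((x - u2 * y)^2 + v2^2 * y^2)))"

text \<open>A real quartic polynomial has no real root or, since a cubic has one, at least two; the
  remaining quadratic then decides between the types 0 and 1. As f does not split, its leading
  coefficient is nonzero and its real roots are simple.\<close>

lemma shape_exists:
  assumes f: "\<not> splits f"
  shows "\<exists>i\<in>{0,1,2}. shape i (real_form f)"
proof -
  define F where "F = real_form f"
  define P where "P = real_dehom f"
  have f1: "f$1 \<noteq> 0" using f splits_if_leading_0 by blast
  have P4: "degree P = 4" and lc: "lead_coeff P = F$1"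
    using f1 by (simp_all add: P_def F_def real_dehom_def dehom_def map_poly_pCons)
  have P0: "P \<noteq> 0" using P4 by auto
  have ev: "form_eval F x y = y^4 * poly P (x / y)" if "y \<noteq> 0" for x y
    unfolding P_def poly_real_dehom F_def[symmetric] by (rule form_eval_dehomogenize[OF that])
  have ev0: "form_eval F x 0 = F$1 * x^4" for x by (simp add: form_eval_def)
  have deg: "degree B + degree A = degree D" if "D = A * B" "degree D \<noteq> 0" for A B D :: "real poly"
    using that degree_mult_eq[of A B] by (metis add.commute degree_0 mult_eq_0_iff)
  show ?thesis
  proof (cases "\<exists>x. poly P x = 0")
    case False
    then obtain u1 v1 q where q: "v1 > 0" "P = [:u1^2 + v1^2, - 2 * u1, 1:] * q"
      using real_root_or_quadratic_factor[of P] P4 by auto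
    let ?m1 = "[:u1^2 + v1^2, - 2 * u1, 1:]"
    have q2: "degree q = 2" using deg[OF q(2)] P4 by simp
    moreover have "\<nexists>x. poly q x = 0" using False unfolding q(2) poly_mult by auto
    ultimately obtain u2 v2 c where c: "v2 > 0" "q = [:u2^2 + v2^2, - 2 * u2, 1:] * c"
      using real_root_or_quadratic_factor[of q] by auto
    let ?m2 = "[:u2^2 + v2^2, - 2 * u2, 1:]"
    have "degree c = 0" using deg[OF c(2)] q2 by simp
    then obtain \<alpha> where \<alpha>: "c = [:\<alpha>:]" by (metis degree_eq_zeroE)
    have P: "P = ?m1 * (?m2 * [:\<alpha>:])" using q c \<alpha> by simp
    have "\<alpha> = F$1" using lc unfolding P lead_coeff_mult by simp
    then have "form_eval F x y = F$1 * ((x - u1 * y)^2 + v1^2 * y^2) * ((x - u2 * y)^2 + v2^2 * y^2)" for x y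
      by (cases "y = 0") (simp_all add: ev ev0 P field_simps eval_nat_numeral del: mult_pCons_left mult_pCons_right)
    then show ?thesis using q(1) c(1) unfolding F_def[symmetric] by (intro bexI[of _ 2]) (auto simp: shape_def)
  next
    case True
    then obtain r1 where r1: "poly P r1 = 0" by blast
    then obtain c where c: "P = [:- r1, 1:] * c" by (metis dvdE poly_eq_0_iff_dvd)
    have c3: "degree c = 3" using deg[OF c] P4 by simp
    then obtain r2 where "poly c r2 = 0" using cubic_real_root by blast
    then obtain q where q: "c = [:- r2, 1:] * q" by (metis dvdE poly_eq_0_iff_dvd)
    have q2: "degree q = 2" using deg[OF q] c3 by simp
    have ne: "poly c r1 \<noteq> 0" using real_dehom_simple_root[OF f] c by (simp add: P_def)
    then have r12: "r1 \<noteq> r2" and qr1: "poly q r1 \<noteq> 0" unfolding q poly_mult by auto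
    have "P = [:- r2, 1:] * ([:- r1, 1:] * q)" unfolding c q by (simp only: ac_simps)
    then have qr2: "poly q r2 \<noteq> 0"
      using real_dehom_simple_root[OF f, folded P_def] unfolding poly_mult by force
    from real_root_or_quadratic_factor[of q] q2
    consider r3 where "poly q r3 = 0" | u v d where "v > 0" "q = [:u^2 + v^2, - 2 * u, 1:] * d" by auto
    then show ?thesis
    proof cases
      case 1
      then obtain l where l: "q = [:- r3, 1:] * l" by (metis dvdE poly_eq_0_iff_dvd)
      have "degree l = 1" using deg[OF l] q2 by simp
      then obtain \<beta> \<alpha> where ab: "l = [:\<beta>, \<alpha>:]" "\<alpha> \<noteq> 0" by (metis degree1_coeffs)
      define r4 where "r4 = - \<beta> / \<alpha>"
      have l': "l = [:- r4, 1:] * [:\<alpha>:]" using ab by (simp add: r4_def)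
      have P: "P = [:- r1, 1:] * ([:- r2, 1:] * ([:- r3, 1:] * ([:- r4, 1:] * [:\<alpha>:])))"
        unfolding c q l l' ..
      have "\<alpha> = F$1" using lc unfolding P lead_coeff_mult by simp
      then have pt: "poly P t = F$1 * ((t - r1) * (t - r2) * (t - r3) * (t - r4))" for t
        unfolding P poly_mult by simp
      have fe: "form_eval F x y = F$1 * ((x - r1 * y) * (x - r2 * y) * (x - r3 * y) * (x - r4 * y))" for x y
      proof (cases "y = 0")
        case True
        then show ?thesis by (simp add: ev0 eval_nat_numeral)
      next
        case False
        define t where "t = x / y"
        have x: "x = t * y" using False by (simp add: t_def)
        have "form_eval F x y = y^4 * poly P t" using ev[OF False] by (simp add: t_def)
        then show ?thesis unfolding pt x by algebra
      qed
      have "P = [:- r3, 1:] * ([:- r1, 1:] * ([:- r2, 1:] * ([:- r4, 1:] * [:\<alpha>:])))"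
        unfolding P by (simp only: ac_simps)
      then have "poly ([:- r1, 1:] * ([:- r2, 1:] * ([:- r4, 1:] * [:\<alpha>:]))) r3 \<noteq> 0"
        using real_dehom_simple_root[OF f, folded P_def] by blast
      then have "r3 \<noteq> r4" unfolding poly_mult mult_eq_0_iff by simp
      moreover have "r1 \<noteq> r3" "r1 \<noteq> r4" "r2 \<noteq> r3" "r2 \<noteq> r4" using qr1 qr2 unfolding l l' by auto
      ultimately have "distinct [r1, r2, r3, r4]" using r12 by simp
      from sorted4[OF this] obtain a b c d where "a < b" "b < c" "c < d"
        "\<forall>x y. (x - a * y) * (x - b * y) * (x - c * y) * (x - d * y) = (x - r1 * y) * (x - r2 * y) * (x - r3 * y) * (x - r4 * y)"
        by blast
      moreover from this(4) have "form_eval F x y = F$1 * (x - a * y) * (x - b * y) * (x - c * y) * (x - d * y)" for x y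
        unfolding fe by (metis mult.assoc)
      ultimately have "shape 0 F" unfolding shape_def by auto
      then show ?thesis by (simp add: F_def)
    next
      case 2
      have "degree d = 0" using deg[OF 2(2)] q2 by simp
      then obtain \<alpha> where \<alpha>: "d = [:\<alpha>:]" by (metis degree_eq_zeroE)
      have P: "P = [:- r1, 1:] * ([:- r2, 1:] * ([:u^2 + v^2, - 2 * u, 1:] * [:\<alpha>:]))"
        unfolding c q 2 \<alpha> ..
      have "\<alpha> = F$1" using lc unfolding P lead_coeff_mult by simp
      then have "form_eval F x y = F$1 * ((x - u * y)^2 + v^2 * y^2) * (x - r1 * y) * (x - r2 * y)" for x y
        by (cases "y = 0") (simp_all add: ev ev0 P field_simps eval_nat_numeral del: mult_pCons_left mult_pCons_right)
      then have "shape 1 F" unfolding shape_def using 2(1) r12 by auto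
      then show ?thesis by (simp add: F_def)
    qed
  qed
qed

lemma shape_center:
  assumes "shape i F" "F$1 \<noteq> 0" "i \<in> {0,1,2}"
  shows "\<exists>z. center i F z"
  using assms center_four_real_roots[of F "F$1"] center_two_real_roots[of F "F$1"] center_no_real_roots[of F "F$1"]
  by (auto simp: shape_def)

lemma shape_card_roots:
  assumes "shape i F" "F$1 \<noteq> 0" "i \<in> {0,1,2}"
  shows "finite {x. form_eval F x 1 = 0} \<and> card {x. form_eval F x 1 = 0} = 4 - 2 * i"
proof -
  consider "i = 0" | "i = 1" | "i = 2" using assms(3) by auto
  then show ?thesis
  proof cases
    case 1
    then obtain r1 r2 r3 r4 where r: "r1 < r2" "r2 < r3" "r3 < r4"
      "\<And>x y. form_eval F x y = F$1 * (x - r1 * y) * (x - r2 * y) * (x - r3 * y) * (x - r4 * y)"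
      using assms by (auto simp: shape_def)
    then have "{x. form_eval F x 1 = 0} = {r1, r2, r3, r4}" using assms(2) by auto
    then show ?thesis using r 1 by simp
  next
    case 2
    then obtain u v r1 r2 where r: "v > 0" "r1 \<noteq> r2"
      "\<And>x y. form_eval F x y = F$1 * ((x - u * y)^2 + v^2 * y^2) * (x - r1 * y) * (x - r2 * y)"
      using assms by (auto simp: shape_def)
    moreover have "(x - u)^2 + v^2 \<noteq> 0" for x using r(1) by (simp add: sum_power2_eq_zero_iff)
    ultimately have "{x. form_eval F x 1 = 0} = {r1, r2}" using assms(2) by auto
    then show ?thesis using r 2 by simp
  next
    case 3
    then obtain u1 v1 u2 v2 where r: "v1 > 0" "v2 > 0"
      "\<And>x y. form_eval F x y = F$1 * ((x - u1 * y)^2 + v1^2 * y^2) * ((x - u2 * y)^2 + v2^2 * y^2)"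
      using assms by (auto simp: shape_def)
    have "(x - u1)^2 + v1^2 \<noteq> 0" "(x - u2)^2 + v2^2 \<noteq> 0" for x
      using r(1,2) by (simp_all add: sum_power2_eq_zero_iff)
    then have "{x. form_eval F x 1 = 0} = {}" using assms(2) r(3) by auto
    then show ?thesis using 3 by simp
  qed
qed

text \<open>As the leading coefficient is nonzero, the line through (1, 0) is not a root, so every
  root contains a unique point with second coordinate 1.\<close>

lemma real_roots_bij:
  assumes f: "f$1 \<noteq> 0"
  shows "bij_betw (\<lambda>r. span {vector [r, 1] :: real ^ 2}) {x. form_eval (real_form f) x 1 = 0} (real_roots f)"
proof -
  let ?F = "real_form f"
  let ?v = "\<lambda>r. vector [r, 1] :: real ^ 2"
  have nz: "?v r \<noteq> 0" for r by (simp add: vec_eq_iff forall_2 vector_2)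
  have hom: "form_eval ?F (c * x) (c * y) = c^4 * form_eval ?F x y" for c x y
    by (simp add: form_eval_def power_mult_distrib algebra_simps eval_nat_numeral)
  have roots: "L \<in> real_roots f \<longleftrightarrow> subspace L \<and> dim L = 1 \<and> (\<forall>v\<in>L. form_eval ?F (v$1) (v$2) = 0)" for L
    by (simp add: real_roots_def P1_real_def form_eval_real_form)
  show ?thesis
    unfolding bij_betw_def
  proof (intro conjI set_eqI iffI)
    show "inj_on (\<lambda>r. span {?v r}) {x. form_eval ?F x 1 = 0}"
    proof (rule inj_onI)
      fix r r' assume "span {?v r} = span {?v r'}"
      then have "?v r \<in> span {?v r'}" by (metis insertI1 span_base)
      then obtain k where "?v r = k *\<^sub>R ?v r'" by (auto simp: span_singleton)
      then show "r = r'" by (simp add: vec_eq_iff forall_2 vector_2)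
    qed
  next
    fix L assume "L \<in> (\<lambda>r. span {?v r}) ` {x. form_eval ?F x 1 = 0}"
    then obtain r where r: "form_eval ?F r 1 = 0" "L = span {?v r}" by blast
    have "form_eval ?F (v$1) (v$2) = 0" if vL: "v \<in> L" for v
    proof -
      obtain k where "v = k *\<^sub>R ?v r" using vL unfolding r(2) span_singleton by blast
      then show ?thesis using hom[of k r 1] r(1) by (simp add: vector_2)
    qed
    moreover have "dim (span {?v r}) = 1" unfolding dim_span using nz[of r] by simp
    ultimately show "L \<in> real_roots f" unfolding roots r(2) by (simp add: subspace_span)
  next
    fix L assume L: "L \<in> real_roots f"
    then have sub: "subspace L" and dim: "dim L = 1" and z: "\<And>v. v \<in> L \<Longrightarrow> form_eval ?F (v$1) (v$2) = 0"
      unfolding roots by auto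
    have "L \<noteq> {0}" using dim by auto
    then obtain v where v: "v \<in> L" "v \<noteq> 0" using subspace_0[OF sub] by blast
    have "v$2 \<noteq> 0"
    proof
      assume "v$2 = 0"
      then have "real_of_int (f$1) * (v$1)^4 = 0" using z[OF v(1)] by (simp add: form_eval_def)
      then have "v$1 = 0" using f by simp
      then show False using v(2) \<open>v$2 = 0\<close> by (simp add: vec_eq_iff forall_2)
    qed
    define r where "r = v$1 / v$2"
    have vr: "?v r = (1 / v$2) *\<^sub>R v"
      using \<open>v$2 \<noteq> 0\<close> by (simp add: vec_eq_iff forall_2 vector_2 r_def)
    then have rL: "?v r \<in> L" using v(1) sub by (simp add: subspace_mul)
    then have "form_eval ?F r 1 = 0" using z[of "?v r"] by (simp add: vector_2)
    moreover have "L = span {?v r}"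
    proof (rule sym, rule subspace_dim_equal)
      show "span {?v r} \<subseteq> L" using rL sub by (simp add: span_minimal)
      show "dim (span {?v r}) \<ge> dim L" unfolding dim_span using dim nz[of r] by simp
    qed (use sub in \<open>simp_all add: subspace_span\<close>)
    ultimately show "L \<in> (\<lambda>r. span {?v r}) ` {x. form_eval ?F x 1 = 0}" by blast
  qed
qed

lemma irreducible_center:
  assumes "irreducible_over_Q f"
  shows "\<exists>i\<in>{0,1,2}. f \<in> V_Z i \<and> (\<exists>z. center i (real_form f) z)"
proof -
  have ns: "\<not> splits f" using assms by (simp add: irreducible_over_Q_iff)
  then have f1: "f$1 \<noteq> 0" using splits_if_leading_0 by blast
  obtain i where i: "i \<in> {0,1,2}" "shape i (real_form f)" using shape_exists[OF ns] by blast
  have F1: "real_form f $ 1 \<noteq> 0" using f1 by simp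
  have "finite (real_roots f) \<and> card (real_roots f) = 4 - 2 * i"
    using shape_card_roots[OF i(2) F1 i(1)] bij_betw_same_card[OF real_roots_bij[OF f1]]
      bij_betw_finite[OF real_roots_bij[OF f1]] by simp
  then have "f \<in> V_Z i" using i(1) by (auto simp: V_Z_def)
  then show ?thesis using shape_center[OF i(2) F1 i(1)] i(1) by blast
qed

text \<open>From here on the number of real roots is replaced by the type of the center, which
  transforms explicitly under substitutions.\<close>

lemma V_Z_iff_center:
  assumes "irreducible_over_Q f" "i \<in> {0,1,2}"
  shows "f \<in> V_Z i \<longleftrightarrow> (\<exists>z. center i (real_form f) z)"
proof -
  obtain j where j: "j \<in> {0,1,2}" "f \<in> V_Z j" "\<exists>z. center j (real_form f) z"
    using irreducible_center[OF assms(1)] by blast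
  show ?thesis
  proof
    assume "f \<in> V_Z i"
    then have "i = j" using j(2) by (simp add: V_Z_def)
    then show "\<exists>z. center i (real_form f) z" using j by blast
  next
    assume "\<exists>z. center i (real_form f) z"
    then have "i = j" using center_type_unique[OF _ _ assms(2) j(1)] j(3) by blast
    then show "f \<in> V_Z i" using j by simp
  qed
qed

section \<open>Reduction theory\<close>

definition mat22 :: "int \<Rightarrow> int \<Rightarrow> int \<Rightarrow> int \<Rightarrow> int ^ 2 ^ 2" where
  "mat22 p q r s = vector [vector [p, q], vector [r, s]]"

lemma mat22_nth [simp]:
  "mat22 p q r s $ 1 $ 1 = p" "mat22 p q r s $ 1 $ 2 = q" "mat22 p q r s $ 2 $ 1 = r" "mat22 p q r s $ 2 $ 2 = s"
  by (simp_all add: mat22_def vector_2)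

lemma mat22_eq: "\<gamma> = mat22 (\<gamma>$1$1) (\<gamma>$1$2) (\<gamma>$2$1) (\<gamma>$2$2)"
  by (simp add: vec_eq_iff forall_2)

lemma mat22_mult:
  "mat22 p q r s ** mat22 p' q' r' s' = mat22 (p * p' + q * r') (p * q' + q * s') (r * p' + s * r') (r * q' + s * s')"
  by (simp add: vec_eq_iff forall_2 matrix_matrix_mult_def sum_2)

lemma mat_1_eq: "(mat 1 :: int ^ 2 ^ 2) = mat22 1 0 0 1"
  by (simp add: vec_eq_iff forall_2 mat_def)

lemma mat22_GL2Z_iff: "mat22 p q r s \<in> GL2Z \<longleftrightarrow> p * s - q * r = 1 \<or> p * s - q * r = - 1"
proof
  assume "mat22 p q r s \<in> GL2Z"
  then obtain B where "mat22 p q r s ** B = mat 1" by (auto simp: GL2Z_def invertible_def)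
  then have "det (mat22 p q r s) * det B = 1" by (metis det_mul det_I)
  then have "det (mat22 p q r s) dvd 1" by (metis dvd_triv_left)
  then have "det (mat22 p q r s) = 1 \<or> det (mat22 p q r s) = - 1" by auto
  then show "p * s - q * r = 1 \<or> p * s - q * r = - 1" by (simp add: det_2)
next
  define d where "d = p * s - q * r"
  assume "p * s - q * r = 1 \<or> p * s - q * r = - 1"
  then have d: "d * d = 1" by (auto simp: d_def)
  have "mat22 p q r s ** mat22 (d * s) (- d * q) (- d * r) (d * p) = mat 1"
    "mat22 (d * s) (- d * q) (- d * r) (d * p) ** mat22 p q r s = mat 1"
    using d unfolding mat22_mult mat_1_eq by (auto simp: d_def algebra_simps)
  then show "mat22 p q r s \<in> GL2Z" unfolding GL2Z_def invertible_def by blast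
qed

lemma GL2Z_cases:
  assumes "\<gamma> \<in> GL2Z"
  obtains p q r s where "\<gamma> = mat22 p q r s" "p * s - q * r = 1 \<or> p * s - q * r = - 1"
  using assms mat22_eq mat22_GL2Z_iff by metis

lemma quartic_act_mult: "quartic_act \<gamma> (quartic_act \<delta> f) = quartic_act (\<gamma> ** \<delta>) f"
proof -
  obtain p q r s where g: "\<gamma> = mat22 p q r s" using mat22_eq by blast
  obtain p' q' r' s' where d: "\<delta> = mat22 p' q' r' s'" using mat22_eq by blast
  show ?thesis unfolding g d mat22_mult
    by (subst real_form_inject[symmetric]) (simp add: real_form_act subst_form_subst)
qed

lemma quartic_act_1: "quartic_act (mat 1) f = f"
  by (subst real_form_inject[symmetric]) (simp add: real_form_act mat_1_eq subst_form_id)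

lemma GL2Z_inverse:
  assumes "\<gamma> \<in> GL2Z"
  obtains \<delta> where "\<delta> \<in> GL2Z" "\<And>f. quartic_act \<delta> (quartic_act \<gamma> f) = f" "\<And>f. quartic_act \<gamma> (quartic_act \<delta> f) = f"
proof -
  obtain \<delta> where "\<gamma> ** \<delta> = mat 1" "\<delta> ** \<gamma> = mat 1" using assms by (auto simp: GL2Z_def invertible_def)
  then show thesis using that[of \<delta>] by (auto simp: quartic_act_mult quartic_act_1 GL2Z_def invertible_def)
qed

lemma GL2Z_mult: "\<gamma> \<in> GL2Z \<Longrightarrow> \<delta> \<in> GL2Z \<Longrightarrow> \<gamma> ** \<delta> \<in> GL2Z"
  by (simp add: GL2Z_def invertible_mult)

lemma GL2Z_1: "mat 1 \<in> GL2Z"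
  by (simp add: mat_1_eq mat22_GL2Z_iff)

lemma GL2Z_orbit_self: "f \<in> GL2Z_orbit f"
  unfolding GL2Z_orbit_def using GL2Z_1 quartic_act_1 by (metis imageI)

lemma GL2Z_orbit_act:
  assumes "\<gamma> \<in> GL2Z"
  shows "GL2Z_orbit (quartic_act \<gamma> f) = GL2Z_orbit f"
proof -
  have sub: "GL2Z_orbit (quartic_act \<gamma> f) \<subseteq> GL2Z_orbit f" if "\<gamma> \<in> GL2Z" for \<gamma> f
    using that by (auto simp: GL2Z_orbit_def quartic_act_mult GL2Z_mult)
  obtain \<delta> where "\<delta> \<in> GL2Z" "quartic_act \<delta> (quartic_act \<gamma> f) = f" using GL2Z_inverse[OF assms] by metis
  then show ?thesis using sub[of \<delta> "quartic_act \<gamma> f"] sub[OF assms] by auto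
qed

lemma GL2Z_orbit_eq_iff: "GL2Z_orbit f = GL2Z_orbit g \<longleftrightarrow> (\<exists>\<gamma>\<in>GL2Z. g = quartic_act \<gamma> f)"
proof
  assume "GL2Z_orbit f = GL2Z_orbit g"
  then have "g \<in> GL2Z_orbit f" using GL2Z_orbit_self by simp
  then show "\<exists>\<gamma>\<in>GL2Z. g = quartic_act \<gamma> f" by (auto simp: GL2Z_orbit_def)
qed (auto simp: GL2Z_orbit_act)

lemma irreducible_act:
  assumes "\<gamma> \<in> GL2Z" "irreducible_over_Q f"
  shows "irreducible_over_Q (quartic_act \<gamma> f)"
  using GL2Z_inverse[OF assms(1)] assms(2) splits_act unfolding irreducible_over_Q_iff by metis

lemma height_act:
  assumes "\<gamma> \<in> GL2Z"
  shows "height (quartic_act \<gamma> f) = height f"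
proof -
  obtain p q r s where g: "\<gamma> = mat22 p q r s" and d: "p * s - q * r = 1 \<or> p * s - q * r = - 1"
    using GL2Z_cases[OF assms] by blast
  have "real_of_int p * s - q * r = 1 \<or> real_of_int p * s - q * r = - 1"
    using d by (metis of_int_1 of_int_diff of_int_minus of_int_mult)
  then have "(real_of_int p * s - q * r)^12 = 1"
    by (elim disjE) (simp_all only: power_one, simp)
  then show ?thesis
    by (simp add: form_height_real_form[symmetric] real_form_act form_height_subst g)
qed

section \<open>The action on the upper half plane and its fundamental domain\<close>

text \<open>Roots move by the inverse of z -> (p z + r) / (q z + s). For negative determinant the
  image lies in the lower half plane and is reflected back.\<close>

definition upper_act :: "int \<Rightarrow> int \<Rightarrow> int \<Rightarrow> int \<Rightarrow> complex \<Rightarrow> complex" where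
  "upper_act p q r s z = (let w = (z * of_int s - of_int r) / (of_int p - z * of_int q)
     in if p * s - q * r > 0 then w else cnj w)"

lemma center_act:
  assumes "center i (real_form f) z" "p * s - q * r \<noteq> 0"
  shows "center i (real_form (quartic_act (mat22 p q r s) f)) (upper_act p q r s z)"
proof -
  have e: "real_of_int (p * s - q * r) = real_of_int p * real_of_int s - real_of_int q * real_of_int r" by simp
  show ?thesis
  proof (cases "p * s - q * r > 0")
    case True
    then have "real_of_int p * real_of_int s - real_of_int q * real_of_int r > 0" using e by (metis of_int_0_less_iff)
    from center_subst_pos[OF assms(1) this] show ?thesis
      using True by (simp add: real_form_act upper_act_def Let_def)
  next
    case False
    then have "real_of_int p * real_of_int s - real_of_int q * real_of_int r < 0" using e assms(2)
      by (metis of_int_less_0_iff less_linear)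
    from center_subst_neg[OF assms(1) this] show ?thesis
      using False by (simp add: real_form_act upper_act_def Let_def)
  qed
qed

lemma V_Z_act:
  assumes "\<gamma> \<in> GL2Z" "irreducible_over_Q f" "i \<in> {0,1,2}" "f \<in> V_Z i"
  shows "quartic_act \<gamma> f \<in> V_Z i"
proof -
  obtain p q r s where g: "\<gamma> = mat22 p q r s" and d: "p * s - q * r = 1 \<or> p * s - q * r = - 1"
    using GL2Z_cases[OF assms(1)] by blast
  obtain z where "center i (real_form f) z" using assms V_Z_iff_center by blast
  then have "center i (real_form (quartic_act \<gamma> f)) (upper_act p q r s z)"
    unfolding g by (rule center_act) (use d in auto)
  then show ?thesis using V_Z_iff_center[OF irreducible_act[OF assms(1,2)] assms(3)] by blast
qed

lemma Im_upper_act_unimodular: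
  assumes "p * s - q * r = 1 \<or> p * s - q * r = - 1"
  shows "Im (upper_act p q r s z) = Im z / (cmod (of_int p - z * of_int q))\<^sup>2"
proof -
  have e: "Im ((z * of_int s - of_int r) / (of_int p - z * of_int q)) =
     (real_of_int p * s - q * r) * Im z / (cmod (of_int p - z * of_int q))\<^sup>2"
    using Im_moebius[of z s r p q] by simp
  from assms show ?thesis
  proof
    assume d: "p * s - q * r = 1"
    then have "real_of_int p * s - q * r = 1" by (metis of_int_1 of_int_diff of_int_mult)
    then show ?thesis using e d by (simp add: upper_act_def Let_def)
  next
    assume d: "p * s - q * r = - 1"
    then have "real_of_int p * s - q * r = - 1" by (metis of_int_1 of_int_diff of_int_minus of_int_mult)
    then show ?thesis using e unfolding upper_act_def Let_def d
      by (simp del: complex_cnj_divide complex_cnj_diff complex_cnj_mult)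
  qed
qed

definition fund :: "complex set" where
  "fund = {z. Im z > 0 \<and> \<bar>Re z\<bar> \<le> 1 / 2 \<and> 1 \<le> cmod z}"

text \<open>The imaginary axis is removed because the reflection z -> - cnj z fixes it; off it, f
  and \<open>flip f\<close> have different centers.\<close>

definition fund_interior :: "complex set" where
  "fund_interior = {z. Im z > 0 \<and> \<bar>Re z\<bar> < 1 / 2 \<and> 1 < cmod z \<and> Re z \<noteq> 0}"

text \<open>Im z is divided by |p - z q|^2, so a nonzero integral pair with the smallest |p - z q|
  is taken. It is coprime and can be completed to a matrix of determinant 1; the second row is
  adjusted by a translation, and minimality against it gives modulus at least 1.\<close>

lemma reduction_exists:
  assumes z: "Im z > 0"
  shows "\<exists>p q r s. p * s - q * r = 1 \<and> upper_act p q r s z \<in> fund"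
proof -
  define N where "N = (\<lambda>(p :: int, q :: int). cmod (of_int p - z * of_int q))"
  define K where "K = {x. x \<noteq> (0, 0) \<and> N x \<le> 1}"
  define B where "B = \<lceil>1 / Im z\<rceil>" 
  have "K \<subseteq> {- \<lceil>1 + cmod z * B\<rceil>..\<lceil>1 + cmod z * B\<rceil>} \<times> {- B..B}"
  proof
    fix x assume x: "x \<in> K"
    obtain p q where [simp]: "x = (p, q)" by (metis surj_pair)
    have N1: "cmod (of_int p - z * of_int q) \<le> 1" using x by (simp add: K_def N_def)
    have "\<bar>Im (of_int p - z * of_int q)\<bar> \<le> 1" using N1 abs_Im_le_cmod order_trans by blast
    then have "\<bar>real_of_int q\<bar> * Im z \<le> 1" using z by (simp add: abs_mult mult.commute)
    then have "\<bar>real_of_int q\<bar> \<le> 1 / Im z" using z by (simp add: field_simps)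
    then have q: "\<bar>q\<bar> \<le> B" unfolding B_def by linarith
    have "\<bar>real_of_int p\<bar> = cmod (of_int p)" by simp
    also have "\<dots> \<le> cmod (of_int p - z * of_int q) + cmod (z * of_int q)"
      by (metis diff_add_cancel norm_triangle_ineq)
    also have "\<dots> \<le> 1 + cmod z * B"
      using N1 q by (intro add_mono) (auto simp: norm_mult intro!: mult_left_mono)
    finally have "\<bar>p\<bar> \<le> \<lceil>1 + cmod z * B\<rceil>" by linarith
    then show "x \<in> {- \<lceil>1 + cmod z * B\<rceil>..\<lceil>1 + cmod z * B\<rceil>} \<times> {- B..B}"
      using q by auto
  qed
  then have finK: "finite K" by (rule finite_subset) simp
  have "(1, 0) \<in> K" by (simp add: K_def N_def)
  then obtain x where x: "x \<in> K" "\<And>y. y \<in> K \<Longrightarrow> N x \<le> N y"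
    using finK by (metis arg_min_if_finite(1) arg_min_least empty_iff)
  obtain p q where xpq: "x = (p, q)" by (metis surj_pair)
  have min: "N (p, q) \<le> N y" if "y \<noteq> (0, 0)" for y
  proof (cases "y \<in> K")
    case True then show ?thesis using x xpq by auto
  next
    case False then show ?thesis using x(1) that xpq by (auto simp: K_def)
  qed
  have pq0: "(p, q) \<noteq> (0, 0)" using x xpq by (auto simp: K_def)
  define c where "c = of_int p - z * of_int q"
  have c0: "c \<noteq> 0"
  proof
    assume "c = 0"
    then have "Im c = 0" "Re c = 0" by simp_all
    then show False using pq0 z by (auto simp: c_def)
  qed
  have "gcd p q = 1"
  proof -
    define g where "g = gcd p q"
    have g: "g > 0" using pq0 by (auto simp: g_def)
    obtain p' q' where p': "p = g * p'" and q': "q = g * q'" by (metis dvdE g_def gcd_dvd1 gcd_dvd2)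
    have "(p', q') \<noteq> (0, 0)" using pq0 p' q' by auto
    then have "N (p, q) \<le> N (p', q')" by (rule min)
    moreover have "N (p, q) = g * N (p', q')"
    proof -
      have "of_int p - z * of_int q = of_int g * (of_int p' - z * of_int q')"
        unfolding p' q' by (simp add: algebra_simps)
      then show ?thesis using g by (simp add: N_def norm_mult)
    qed
    moreover have "N (p, q) > 0" using c0 by (simp add: N_def c_def)
    ultimately have "N (p', q') > 0" "real_of_int g * N (p', q') \<le> 1 * N (p', q')"
      using g by (auto simp: zero_less_mult_iff)
    then have "real_of_int g \<le> 1" by (metis mult_le_cancel_right_pos)
    then have "g = 1" using g by linarith
    then show ?thesis by (simp add: g_def)
  qed
  then obtain a b where ab: "a * p + b * q = 1" using bezout_int[of p q] by auto
  define z1 where "z1 = (z * of_int a - of_int (- b)) / c"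
  define n where "n = round (Re z1)"
  define r s where "r = - b + n * p" and "s = a + n * q"
  have det: "p * s - q * r = 1" using ab by (simp add: r_def s_def algebra_simps)
  have m: "upper_act p q r s z = z1 - of_int n"
    unfolding upper_act_def Let_def det z1_def c_def[symmetric] using c0
    by (simp add: r_def s_def field_simps) (simp add: c_def algebra_simps)
  have "Im (upper_act p q r s z) > 0"
    using Im_upper_act_unimodular[of p s q r z] det z c0 by (simp add: c_def)
  moreover have "\<bar>Re (upper_act p q r s z)\<bar> \<le> 1 / 2"
    unfolding m n_def using of_int_round_abs_le[of "Re z1"] by (simp add: abs_minus_commute)
  moreover have "1 \<le> cmod (upper_act p q r s z)"
  proof -
    have "(r, s) \<noteq> (0, 0)" using det by auto
    then have "N (p, q) \<le> N (r, s)" by (rule min)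
    then have "cmod c \<le> cmod (z * of_int s - of_int r)" by (simp add: N_def c_def norm_minus_commute)
    then show ?thesis using det c0 by (simp add: upper_act_def Let_def norm_divide c_def)
  qed
  ultimately show ?thesis using det unfolding fund_def by blast
qed

lemma quadratic_form_ge_1:
  fixes p q :: int
  assumes "(p, q) \<noteq> (0, 0)"
  shows "p^2 - \<bar>p * q\<bar> + q^2 \<ge> 1"
proof -
  have "2 * (p^2 - \<bar>p * q\<bar> + q^2) = (\<bar>p\<bar> - \<bar>q\<bar>)^2 + \<bar>p\<bar>^2 + \<bar>q\<bar>^2"
    by (simp add: power2_diff abs_mult algebra_simps)
  moreover have "\<bar>p\<bar>^2 + \<bar>q\<bar>^2 > 0" using assms by (auto simp: sum_power2_gt_zero_iff)
  then have "(\<bar>p\<bar> - \<bar>q\<bar>)^2 + \<bar>p\<bar>^2 + \<bar>q\<bar>^2 > 0"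
    unfolding add.assoc by (rule add_nonneg_pos[OF zero_le_power2])
  ultimately have "0 < 2 * (p^2 - \<bar>p * q\<bar> + q^2)" by (simp only:)
  then show ?thesis by simp
qed

text \<open>|p - z q|^2 = p^2 - 2 p q Re z + q^2 |z|^2 exceeds p^2 - |p q| + q^2 >= 1, and Im z is
  divided by it.\<close>

lemma Im_decreases:
  assumes z: "z \<in> fund_interior" and d: "p * s - q * r = 1 \<or> p * s - q * r = - 1" and q: "q \<noteq> 0"
  shows "Im (upper_act p q r s z) < Im z"
proof -
  have Z: "Im z > 0" "\<bar>Re z\<bar> < 1/2" "1 < cmod z" using z by (auto simp: fund_interior_def)
  have sq: "(cmod (of_int p - z * of_int q))\<^sup>2 = p^2 - 2 * (p * q) * Re z + q^2 * (cmod z)^2"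
    unfolding cmod_power2 by (simp add: power2_eq_square algebra_simps)
  have "\<bar>2 * (p * q) * Re z\<bar> \<le> \<bar>real_of_int (p * q)\<bar>"
    using mult_left_mono[of "\<bar>Re z\<bar>" "1/2" "2 * \<bar>real_of_int (p * q)\<bar>"] Z by (simp add: abs_mult)
  moreover have "real_of_int (q^2) * (cmod z)^2 > real_of_int (q^2) * 1"
    using q Z(3) by (intro mult_strict_left_mono) (auto simp: power_gt1_lemma one_less_power)
  moreover have "real_of_int (p^2 - \<bar>p * q\<bar> + q^2) \<ge> 1"
    using quadratic_form_ge_1[of p q] q by (metis Pair_inject of_int_1_le_iff)
  ultimately have "(cmod (of_int p - z * of_int q))\<^sup>2 > 1" unfolding sq by simp
  then show ?thesis unfolding Im_upper_act_unimodular[OF d] using Z(1)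
    by (simp add: divide_less_eq)
qed

definition flip :: "quartic \<Rightarrow> quartic" where
  "flip f = quartic_act (mat22 1 0 0 (- 1)) f"

lemma flip_nth: "flip f = vector [f$1, - f$2, f$3, - f$4, f$5]"
  unfolding flip_def
  by (subst real_form_inject[symmetric]) (simp add: real_form_act subst_form_def vec5_eq_iff vector_5)

lemma center_flip: "center i (real_form f) z \<Longrightarrow> center i (real_form (flip f)) (- cnj z)"
  using center_act[of i f z 1 "-1" 0 0] by (simp add: flip_def upper_act_def)

text \<open>If \<open>q \<noteq> 0\<close>, both the matrix and its inverse would strictly decrease
  the imaginary part. So the matrix is triangular with diagonal entries 1 or -1, and the width of
  the strip gives \<open>r = 0\<close>. Since the degree is even, a common sign of the diagonal
  entries does not matter, and only f and \<open>flip f\<close> remain.\<close>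

lemma fund_interior_orbit:
  assumes f: "center i (real_form f) z" "z \<in> fund_interior"
    and g: "center i (real_form g) z'" "z' \<in> fund_interior"
    and o: "\<gamma> \<in> GL2Z" "g = quartic_act \<gamma> f"
  shows "g = f \<or> g = flip f"
proof -
  obtain p q r s where \<gamma>: "\<gamma> = mat22 p q r s" and d: "p * s - q * r = 1 \<or> p * s - q * r = - 1"
    using GL2Z_cases[OF o(1)] by blast
  have z': "z' = upper_act p q r s z"
    using center_unique[OF g(1)] center_act[OF f(1), of p s q r] d o(2) \<gamma> by auto
  define e where "e = p * s - q * r"
  have e: "e * e = 1" using d by (auto simp: e_def)
  have "f = quartic_act (mat22 (e * s) (- e * q) (- e * r) (e * p)) g"
    unfolding o(2) \<gamma> quartic_act_mult mat22_mult
    using quartic_act_1[of f] e unfolding mat_1_eq e_def by (simp add: algebra_simps)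
  moreover have d': "(e * s) * (e * p) - (- e * q) * (- e * r) = 1 \<or> (e * s) * (e * p) - (- e * q) * (- e * r) = - 1"
  proof -
    have "(e * s) * (e * p) - (- e * q) * (- e * r) = e * e * (p * s - q * r)" by algebra
    then show ?thesis using d e by simp
  qed
  moreover have "x \<noteq> 0" if "x = 1 \<or> x = - 1" for x :: int using that by auto
  ultimately have fe: "f = quartic_act (mat22 (e * s) (- e * q) (- e * r) (e * p)) g"
    and nz: "(e * s) * (e * p) - (- e * q) * (- e * r) \<noteq> 0" by blast+
  have z: "z = upper_act (e * s) (- e * q) (- e * r) (e * p) z'"
    by (rule center_unique[OF f(1)]) (subst fe, rule center_act[OF g(1) nz])
  have "q = 0"
  proof (rule ccontr)
    assume q: "q \<noteq> 0"
    then have "- e * q \<noteq> 0" using e by auto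
    have "Im (upper_act (e * s) (- e * q) (- e * r) (e * p) z') < Im z'"
      by (rule Im_decreases[OF g(2) d' \<open>- e * q \<noteq> 0\<close>])
    moreover have "Im (upper_act p q r s z) < Im z" by (rule Im_decreases[OF f(2) d q])
    ultimately show False unfolding z[symmetric] z'[symmetric] by linarith
  qed
  then have ps: "p * s = 1 \<or> p * s = - 1" using d by simp
  then have pm: "(p = 1 \<or> p = - 1) \<and> (s = 1 \<or> s = - 1)" 
    using zmult_eq_1_iff[of p s] zmult_eq_1_iff[of p "- s"] by auto
  have "r = 0"
  proof -
    have "\<bar>Re z'\<bar> = \<bar>s * Re z - r\<bar>"
      using pm \<open>q = 0\<close> unfolding z' upper_act_def Let_def by auto
    moreover have "\<bar>Re z'\<bar> < 1/2" "\<bar>Re z\<bar> < 1/2" using f g by (auto simp: fund_interior_def)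
    moreover have "\<bar>s * Re z\<bar> = \<bar>Re z\<bar>" using pm by auto
    ultimately have "\<bar>real_of_int r\<bar> < 1" by linarith
    then show ?thesis by linarith
  qed
  have "real_form g = subst_form p 0 0 s (real_form f)" unfolding o(2) \<gamma> using \<open>q = 0\<close> \<open>r = 0\<close> by (simp add: real_form_act)
  then have "real_form g = real_form f \<or> real_form g = real_form (flip f)"
    using pm by (auto simp: subst_form_def vec5_eq_iff vector_5 flip_nth)
  then show ?thesis by (simp add: real_form_inject)
qed

text \<open>An orbit that meets \<open>R'\<close> does so in exactly the two forms f and
  \<open>flip f\<close>. Every orbit in \<open>A\<close> meets \<open>R\<close>, and at most
  \<open>card (R - R')\<close> of them miss \<open>R'\<close>.\<close>

lemma orbit_count:
  fixes S :: "quartic set" and X :: real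
  assumes S: "GL2Z_invariant S" and i: "i \<in> {0,1,2}"
  defines "A \<equiv> {f \<in> S \<inter> V_Z i. irreducible_over_Q f \<and> height f < X}"
  defines "R \<equiv> {f \<in> A. \<exists>z\<in>fund. center i (real_form f) z}"
    and "R' \<equiv> {f \<in> A. \<exists>z\<in>fund_interior. center i (real_form f) z}"
  assumes fin: "finite R"
  shows "card R' \<le> 2 * N_classes (S \<inter> V_Z i) X" "2 * N_classes (S \<inter> V_Z i) X \<le> card R' + 2 * card (R - R')"
proof -
  have A_act: "quartic_act \<gamma> f \<in> A" if "\<gamma> \<in> GL2Z" "f \<in> A" for \<gamma> f
    using that S V_Z_act[OF that(1) _ i] irreducible_act[OF that(1)] height_act[OF that(1)]
    by (auto simp: A_def GL2Z_invariant_def)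
  have R'R: "R' \<subseteq> R" by (auto simp: R_def R'_def fund_def fund_interior_def less_imp_le)
  then have finR': "finite R'" using fin finite_subset by blast
  have "GL2Z_orbit ` A \<subseteq> GL2Z_orbit ` R"
  proof
    fix U assume "U \<in> GL2Z_orbit ` A"
    then obtain f where f: "f \<in> A" "U = GL2Z_orbit f" by blast
    then obtain z where z: "center i (real_form f) z" using V_Z_iff_center[OF _ i] by (auto simp: A_def)
    then have "Im z > 0" by (simp add: center_def)
    then obtain p q r s where pq: "p * s - q * r = 1" "upper_act p q r s z \<in> fund" using reduction_exists by blast
    let ?\<gamma> = "mat22 p q r s"
    have G: "?\<gamma> \<in> GL2Z" using pq by (simp add: mat22_GL2Z_iff)
    have "center i (real_form (quartic_act ?\<gamma> f)) (upper_act p q r s z)" by (rule center_act[OF z]) (use pq in simp)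
    then have "quartic_act ?\<gamma> f \<in> R" using A_act[OF G f(1)] pq by (auto simp: R_def)
    then show "U \<in> GL2Z_orbit ` R" using GL2Z_orbit_act[OF G, of f] f(2) by blast
  qed
  moreover have "R \<subseteq> A" by (auto simp: R_def)
  ultimately have AR: "GL2Z_orbit ` A = GL2Z_orbit ` R" by blast
  have N: "N_classes (S \<inter> V_Z i) X = card (GL2Z_orbit ` R)"
    unfolding N_classes_def A_def[symmetric] AR ..
  have fiber: "card {g \<in> R'. GL2Z_orbit g = GL2Z_orbit f} = 2" if f: "f \<in> R'" for f
  proof -
    obtain z where z: "z \<in> fund_interior" "center i (real_form f) z" using f by (auto simp: R'_def)
    have G: "mat22 1 0 0 (- 1) \<in> GL2Z" by (simp add: mat22_GL2Z_iff)
    have z': "- cnj z \<in> fund_interior" using z(1) by (simp add: fund_interior_def)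
    have fl: "flip f \<in> R'" using A_act[OF G, of f] f z' center_flip[OF z(2)]
      by (auto simp: R'_def flip_def[symmetric])
    have "flip f \<noteq> f"
    proof
      assume e: "flip f = f"
      have "z = - cnj z" by (rule center_unique[OF z(2)]) (use center_flip[OF z(2)] in \<open>simp only: e\<close>)
      then have "Re z = Re (- cnj z)" by (rule arg_cong)
      then have "Re z = 0" by simp
      then show False using z(1) by (simp add: fund_interior_def)
    qed
    moreover have "{g \<in> R'. GL2Z_orbit g = GL2Z_orbit f} = {f, flip f}"
    proof (intro equalityI subsetI)
      fix g assume "g \<in> {g \<in> R'. GL2Z_orbit g = GL2Z_orbit f}"
      then have g: "g \<in> R'" "\<exists>\<gamma>\<in>GL2Z. g = quartic_act \<gamma> f" using GL2Z_orbit_eq_iff[of f g] by auto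
      then obtain z' \<gamma> where "z' \<in> fund_interior" "center i (real_form g) z'" "\<gamma> \<in> GL2Z" "g = quartic_act \<gamma> f"
        by (auto simp: R'_def)
      then show "g \<in> {f, flip f}" using fund_interior_orbit[OF z(2,1)] by blast
    next
      fix g assume "g \<in> {f, flip f}"
      then show "g \<in> {g \<in> R'. GL2Z_orbit g = GL2Z_orbit f}"
        using f fl GL2Z_orbit_act[OF G, of f] by (auto simp: flip_def)
    qed
    ultimately show ?thesis by simp
  qed
  have "card R' = (\<Sum>f\<in>R'. 1)" by simp
  also have "\<dots> = (\<Sum>U\<in>GL2Z_orbit ` R'. \<Sum>g\<in>{g \<in> R'. GL2Z_orbit g = U}. 1)"
    by (rule sum.image_gen[OF finR'])
  also have "\<dots> = (\<Sum>U\<in>GL2Z_orbit ` R'. 2)"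
    by (intro sum.cong refl) (use fiber in auto)
  finally have c: "card R' = 2 * card (GL2Z_orbit ` R')" by simp
  have "card (GL2Z_orbit ` R') \<le> card (GL2Z_orbit ` R)"
    using R'R fin by (intro card_mono) auto
  then show "card R' \<le> 2 * N_classes (S \<inter> V_Z i) X" using c N by simp
  have "GL2Z_orbit ` R \<subseteq> GL2Z_orbit ` R' \<union> GL2Z_orbit ` (R - R')" by blast
  then have "card (GL2Z_orbit ` R) \<le> card (GL2Z_orbit ` R' \<union> GL2Z_orbit ` (R - R'))"
    using fin finR' by (intro card_mono) auto
  also have "\<dots> \<le> card (GL2Z_orbit ` R') + card (GL2Z_orbit ` (R - R'))" by (rule card_Un_le)
  also have "card (GL2Z_orbit ` (R - R')) \<le> card (R - R')" by (rule card_image_le) (use fin in simp)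
  finally show "2 * N_classes (S \<inter> V_Z i) X \<le> card R' + 2 * card (R - R')" using c N by simp
qed

section \<open>Counting with Rankin's trick\<close>

text \<open>The value at 0 is 1, so that vanishing coefficients do not destroy bounds for
  products.\<close>

definition tau :: "int \<Rightarrow> real" where
  "tau n = max 1 \<bar>real_of_int n\<bar>"

lemma tau_ge_1: "tau n \<ge> 1" by (simp add: tau_def)

lemma tau_nonzero: "n \<noteq> 0 \<Longrightarrow> tau n = \<bar>real_of_int n\<bar>"
proof -
  assume "n \<noteq> 0"
  then have "\<bar>n\<bar> \<ge> 1" by simp
  then have "\<bar>real_of_int n\<bar> \<ge> 1" by (metis of_int_1_le_iff of_int_abs)
  then show ?thesis by (simp add: tau_def)
qed

lemma tau_mult: "m \<noteq> 0 \<Longrightarrow> n \<noteq> 0 \<Longrightarrow> tau (m * n) = tau m * tau n"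
  by (simp add: tau_nonzero abs_mult)

text \<open>Convergence requires an exponent greater than 1; 9/8 is the one that turns a product of
  size X^(2/3) into X^(3/4).\<close>

lemma tau_sum_bounded: "\<exists>Z\<ge>1. \<forall>B. finite B \<longrightarrow> (\<Sum>n\<in>B. tau n powr (- (9/8))) \<le> Z"
proof -
  define a where "a k = tau (int k) powr (- (9/8))" for k
  have "summable (\<lambda>n. real n powr (- (9/8)))" by (subst summable_real_powr_iff) simp
  moreover have "a n = real n powr (- (9/8))" if "n \<ge> 1" for n
    using that by (simp add: a_def tau_def)
  ultimately have sm: "summable a"
    by (subst summable_cong[of _ "\<lambda>n. real n powr (- (9/8))"]) (auto simp: eventually_sequentially)
  have a0: "a k \<ge> 0" for k by (simp add: a_def)
  have half: "(\<Sum>n\<in>B. tau n powr (- (9/8))) \<le> suminf a" if "finite B" "inj_on (\<lambda>n. nat \<bar>n\<bar>) B" for B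
  proof -
    have "(\<Sum>n\<in>B. tau n powr (- (9/8))) = (\<Sum>n\<in>B. a (nat \<bar>n\<bar>))"
      by (intro sum.cong refl) (simp add: a_def tau_def)
    also have "\<dots> = sum a ((\<lambda>n. nat \<bar>n\<bar>) ` B)" using that(2) by (simp add: sum.reindex)
    also have "\<dots> \<le> suminf a" by (rule sum_le_suminf[OF sm]) (use that a0 in auto)
    finally show ?thesis .
  qed
  have "(\<Sum>n\<in>B. tau n powr (- (9/8))) \<le> 2 * suminf a" if B: "finite B" for B
  proof -
    have "(\<Sum>n\<in>B. tau n powr (- (9/8))) =
        (\<Sum>n\<in>B \<inter> {0..}. tau n powr (- (9/8))) + (\<Sum>n\<in>B \<inter> {..<0}. tau n powr (- (9/8)))"
      by (subst sum.union_disjoint[symmetric]) (use B in \<open>auto intro!: sum.cong\<close>)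
    also have "\<dots> \<le> suminf a + suminf a"
      by (intro add_mono half) (use B in \<open>auto simp: inj_on_def\<close>)
    finally show ?thesis by simp
  qed
  then have "\<forall>B. finite B \<longrightarrow> (\<Sum>n\<in>B. tau n powr (- (9/8))) \<le> max 1 (2 * suminf a)"
    by (meson max.coboundedI2)
  then show ?thesis by (intro exI[of _ "max 1 (2 * suminf a)"]) simp
qed

lemma sum_lists_prod:
  fixes w :: "'a \<Rightarrow> real"
  assumes "finite B"
  shows "(\<Sum>xs\<in>{xs. set xs \<subseteq> B \<and> length xs = k}. prod_list (map w xs)) = (\<Sum>x\<in>B. w x) ^ k"
proof (induction k)
  case 0
  have "{xs. set xs \<subseteq> B \<and> length xs = 0} = {[]}" by auto
  then show ?case by simp
next
  case (Suc k)
  let ?L = "{xs. set xs \<subseteq> B \<and> length xs = k}"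
  have "{xs. set xs \<subseteq> B \<and> length xs = Suc k} = (\<lambda>(x, xs). x # xs) ` (B \<times> ?L)"
    by (force simp: length_Suc_conv)
  moreover have "inj_on (\<lambda>(x, xs). x # xs) (B \<times> ?L)" by (auto simp: inj_on_def)
  ultimately have "(\<Sum>xs\<in>{xs. set xs \<subseteq> B \<and> length xs = Suc k}. prod_list (map w xs))
      = (\<Sum>(x, xs)\<in>B \<times> ?L. w x * prod_list (map w xs))"
    by (simp add: sum.reindex case_prod_unfold)
  also have "\<dots> = (\<Sum>x\<in>B. w x) * (\<Sum>xs\<in>?L. prod_list (map w xs))"
    by (simp add: sum.cartesian_product[symmetric] sum_product)
  finally show ?case using Suc by simp
qed

definition tau_zeta :: real where
  "tau_zeta = (SOME Z. Z \<ge> 1 \<and> (\<forall>B. finite B \<longrightarrow> (\<Sum>n\<in>B. tau n powr (- (9/8))) \<le> Z))"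

lemma tau_zeta: "tau_zeta \<ge> 1" "finite B \<Longrightarrow> (\<Sum>n\<in>B. tau n powr (- (9/8))) \<le> tau_zeta"
proof -
  have "tau_zeta \<ge> 1 \<and> (\<forall>B. finite B \<longrightarrow> (\<Sum>n\<in>B. tau n powr (- (9/8))) \<le> tau_zeta)"
    unfolding tau_zeta_def by (rule someI_ex) (use tau_sum_bounded in blast)
  then show "tau_zeta \<ge> 1" "finite B \<Longrightarrow> (\<Sum>n\<in>B. tau n powr (- (9/8))) \<le> tau_zeta" by blast+
qed

text \<open>Rankin's trick: tuples with \<open>\<Prod> \<tau> n \<le> N\<close> are counted with the weight \<open>(N / \<Prod> \<tau> n)\<close> to the power \<open>9/8\<close>.\<close>

lemma rankin:
  assumes A: "finite A" "\<And>xs. xs \<in> A \<Longrightarrow> length xs = k \<and> prod_list (map tau xs) \<le> N"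
  shows "real (card A) \<le> tau_zeta ^ k * N powr (9/8)"
proof -
  let ?w = "\<lambda>n. tau n powr (- (9/8))"
  define B where "B = (\<Union>xs\<in>A. set xs)"
  have finB: "finite B" using A by (simp add: B_def)
  have pw: "prod_list (map ?w xs) = prod_list (map tau xs) powr (- (9/8))" for xs
    by (induction xs) (simp_all add: powr_mult prod_list_nonneg tau_def)
  have p1: "prod_list (map tau xs) \<ge> 1" for xs
  proof (induction xs)
    case (Cons x xs)
    then show ?case using mult_mono[of 1 "tau x" 1 "prod_list (map tau xs)"] tau_ge_1[of x] by simp
  qed simp
  have "real (card A) = (\<Sum>xs\<in>A. 1)" by simp
  also have "\<dots> \<le> (\<Sum>xs\<in>A. N powr (9/8) * prod_list (map ?w xs))"
  proof (rule sum_mono)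
    fix xs assume "xs \<in> A"
    then have le: "prod_list (map tau xs) \<le> N" using A by blast
    have "prod_list (map tau xs) powr (9/8) \<le> N powr (9/8)"
      using le p1[of xs] by (intro powr_mono2) auto
    moreover have "prod_list (map tau xs) powr (9/8) * prod_list (map tau xs) powr (- (9/8)) = 1"
      using p1[of xs] by (simp flip: powr_add)
    ultimately show "1 \<le> N powr (9/8) * prod_list (map ?w xs)"
      unfolding pw by (metis mult_right_mono powr_ge_zero)
  qed
  finally have le: "real (card A) \<le> N powr (9/8) * (\<Sum>xs\<in>A. prod_list (map ?w xs))" by (simp add: sum_distrib_left)
  have "(\<Sum>xs\<in>A. prod_list (map ?w xs)) \<le> (\<Sum>xs\<in>{xs. set xs \<subseteq> B \<and> length xs = k}. prod_list (map ?w xs))"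
  proof (rule sum_mono2)
    show "finite {xs. set xs \<subseteq> B \<and> length xs = k}" by (rule finite_lists_length_eq[OF finB])
    show "A \<subseteq> {xs. set xs \<subseteq> B \<and> length xs = k}" using A by (auto simp: B_def)
    show "0 \<le> prod_list (map ?w b)" for b by (rule prod_list_nonneg) auto
  qed
  also have "\<dots> = (\<Sum>x\<in>B. ?w x) ^ k" by (rule sum_lists_prod[OF finB])
  also have "\<dots> \<le> tau_zeta ^ k" by (intro power_mono tau_zeta(2) finB sum_nonneg) simp
  finally have "(\<Sum>xs\<in>A. prod_list (map ?w xs)) \<le> tau_zeta ^ k" .
  then show ?thesis using order_trans[OF le mult_left_mono[of _ _ "N powr (9/8)"]] by (simp add: mult.commute)
qed

text \<open>The tuple attached to a form is given by a relation, because it may come from a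
  factorization, of which there can be several; one is chosen, and at most \<open>c\<close> forms
  share a tuple.\<close>

lemma rankin_relation:
  assumes F: "finite F" "\<forall>f\<in>F. \<exists>xs. R f xs \<and> length xs = k \<and> prod_list (map tau xs) \<le> N"
      "\<And>xs. card {f \<in> F. R f xs} \<le> c"
  shows "real (card F) \<le> c * (tau_zeta ^ k * N powr (9/8))"
proof -
  obtain \<phi> where \<phi>: "\<forall>f\<in>F. R f (\<phi> f) \<and> length (\<phi> f) = k \<and> prod_list (map tau (\<phi> f)) \<le> N"
    using bchoice[OF F(2)] by blast
  have "card F = (\<Sum>f\<in>F. 1)" by simp
  also have "\<dots> = (\<Sum>xs\<in>\<phi> ` F. \<Sum>f\<in>{f \<in> F. \<phi> f = xs}. 1)" by (rule sum.image_gen[OF F(1)])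
  also have "\<dots> \<le> (\<Sum>xs\<in>\<phi> ` F. c)"
  proof (rule sum_mono)
    fix xs assume "xs \<in> \<phi> ` F"
    have "card {f \<in> F. \<phi> f = xs} \<le> card {f \<in> F. R f xs}"
      by (rule card_mono) (use F(1) \<phi> in auto)
    then show "(\<Sum>f\<in>{f \<in> F. \<phi> f = xs}. 1) \<le> c" using F(3)[of xs] by simp
  qed
  also have "\<dots> = c * card (\<phi> ` F)" by simp
  finally have "real (card F) \<le> real c * real (card (\<phi> ` F))" by (metis of_nat_le_iff of_nat_mult)
  also have "\<dots> \<le> c * (tau_zeta ^ k * N powr (9/8))"
    by (intro mult_left_mono rankin) (use F(1) \<phi> in auto)
  finally show ?thesis .
qed

section \<open>Coefficients of reduced forms\<close>

text \<open>The bounds carry the factors (Im z)^(-2), ..., (Im z)^2. As Im z >= 1/2, a product of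
  four of them with total exponent at most 0 is O(K^4) = O(X^(2/3)). The leading coefficient, being
  nonzero, bounds Im z.\<close>

lemma center_tau_bounds:
  assumes c: "center i (real_form f) z" and H: "height f < X" and X: "X \<ge> 1"
    and u: "\<bar>Re z\<bar> \<le> 2 * Im z" and v: "Im z \<ge> 1 / 2" and f1: "f$1 \<noteq> 0"
  defines "K \<equiv> 400 * X powr (1/6)"
  shows "tau (f$1) * (Im z)^2 \<le> K" "tau (f$2) * Im z \<le> K" "tau (f$3) \<le> K" "tau (f$4) \<le> K * Im z"
    "tau (f$5) \<le> K * (Im z)^2" "(Im z)^2 \<le> K" "K \<ge> 400"
proof -
  define l where "l = X powr (1/6)"
  have l1: "l \<ge> 1" using X by (simp add: l_def ge_one_powr_ge_zero)
  have l6: "l^6 = X" using X by (simp add: l_def powr_power)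
  have Kl: "K = 400 * l" by (simp add: K_def l_def)
  show K: "K \<ge> 400" using l1 by (simp add: Kl)
  have H': "form_height (real_form f) \<le> l^6" using H by (simp add: form_height_real_form l6)
  note b = center_box[OF c H' _ u, folded Kl]
  have b: "(Im z)^2 * \<bar>real_of_int (f$1)\<bar> \<le> K" "Im z * \<bar>real_of_int (f$2)\<bar> \<le> K" "\<bar>real_of_int (f$3)\<bar> \<le> K"
    "\<bar>real_of_int (f$4)\<bar> \<le> K * Im z" "\<bar>real_of_int (f$5)\<bar> \<le> K * (Im z)^2"
    using b l1 by simp_all
  show t1: "tau (f$1) * (Im z)^2 \<le> K" using b(1) f1 by (simp add: tau_nonzero mult.commute)
  then show v2: "(Im z)^2 \<le> K" using tau_ge_1[of "f$1"] mult_right_mono[of 1 "tau (f$1)" "(Im z)^2"] by simp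
  have "Im z \<le> K"
  proof (cases "Im z \<le> 1")
    case False
    then have "Im z \<le> (Im z)^2" by (simp add: power2_eq_square)
    then show ?thesis using v2 by simp
  qed (use K in simp)
  then show "tau (f$2) * Im z \<le> K" using b(2) v by (simp add: tau_def max_mult_distrib_right mult.commute)
  show "tau (f$3) \<le> K" using b(3) K by (simp add: tau_def)
  have "1 \<le> K * Im z" using mult_mono[of 2 K "1/2" "Im z"] K v by simp
  then show "tau (f$4) \<le> K * Im z" using b(4) by (simp add: tau_def)
  have "(1/2)^2 \<le> (Im z)^2" using v by (intro power_mono) auto
  then have "1 \<le> K * (Im z)^2" using mult_mono[of 4 K "1/4" "(Im z)^2"] K by (simp add: power_divide)
  then show "tau (f$5) \<le> K * (Im z)^2" using b(5) by (simp add: tau_def)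
qed

lemma tau_abs: "\<bar>real_of_int n\<bar> \<le> tau n" by (simp add: tau_def)

text \<open>An infinite set has cardinality 0, so finiteness has to precede every count; all
  coefficients are at most \<open>K * K\<close>.\<close>

lemma finite_center_region:
  assumes X: "X \<ge> 1"
  shows "finite {f. f$1 \<noteq> 0 \<and> height f < X \<and> (\<exists>z. center i (real_form f) z \<and> \<bar>Re z\<bar> \<le> 2 * Im z \<and> Im z \<ge> 1/2)}"
    (is "finite ?F")
proof -
  define K where "K = 400 * X powr (1/6)"
  have "?F \<subseteq> {f. \<forall>j. f$j \<in> {- \<lceil>K * K\<rceil>..\<lceil>K * K\<rceil>}}"
  proof
    fix f assume "f \<in> ?F"
    then obtain z where f: "f$1 \<noteq> 0" "height f < X" and z: "center i (real_form f) z" "\<bar>Re z\<bar> \<le> 2 * Im z" "Im z \<ge> 1/2"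
      by blast
    note t = center_tau_bounds[OF z(1) f(2) X z(2,3) f(1), folded K_def]
    have K4: "4 * K \<le> K * K" using t(7) mult_right_mono[of 4 K K] by simp
    have Kp: "K > 0" using t(7) by simp
    have v4: "1 \<le> 4 * (Im z)^2" using power_mono[of "1/2" "Im z" 2] z(3) by (simp add: power_divide)
    have "tau (f$1) \<le> 4 * (tau (f$1) * (Im z)^2)"
      using mult_left_mono[OF v4, of "tau (f$1)"] tau_ge_1[of "f$1"] by (simp add: algebra_simps)
    then have 1: "tau (f$1) \<le> K * K" using t(1) K4 Kp by linarith
    have "tau (f$2) \<le> 2 * (tau (f$2) * Im z)"
      using mult_left_mono[of 1 "2 * Im z" "tau (f$2)"] tau_ge_1[of "f$2"] z(3) by (simp add: algebra_simps)
    then have 2: "tau (f$2) \<le> K * K" using t(2) K4 Kp by linarith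
    have 3: "tau (f$3) \<le> K * K" using t(3) K4 Kp by linarith
    have 5: "tau (f$5) \<le> K * K" using t(5) mult_left_mono[OF t(6), of K] Kp by linarith
    have "Im z \<le> 2 * (Im z)^2" using z(3) mult_right_mono[of 1 "2 * Im z" "Im z"] by (simp add: power2_eq_square)
    moreover have "(Im z)^2 \<le> K" by (rule t(6))
    moreover have "Im z \<le> K"
    proof (cases "Im z \<le> 1")
      case False
      then have "Im z \<le> (Im z)^2" by (simp add: power2_eq_square)
      then show ?thesis using t(6) by simp
    qed (use t(7) in simp)
    ultimately have 4: "tau (f$4) \<le> K * K" using t(4) mult_left_mono[of "Im z" K K] Kp by linarith
    have "\<bar>real_of_int (f$j)\<bar> \<le> K * K" for j
      using 1 2 3 4 5 tau_abs[of "f$j"] exhaust_5[of j] by auto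
    then have "- \<lceil>K * K\<rceil> \<le> f$j \<and> f$j \<le> \<lceil>K * K\<rceil>" for j
      by (smt (verit) le_of_int_ceiling of_int_le_iff of_int_minus)
    then show "f \<in> {f. \<forall>j. f$j \<in> {- \<lceil>K * K\<rceil>..\<lceil>K * K\<rceil>}}" by auto
  qed
  then show ?thesis by (rule finite_subset) (rule finite_bounded_vec, simp)
qed

lemma K_powr: "(X :: real) \<ge> 1 \<Longrightarrow> (c * (400 * X powr (1/6))^4) powr (9/8) = (c * 400^4) powr (9/8) * X powr (3/4)" if "c \<ge> 0"
proof -
  assume X: "X \<ge> 1"
  have "(c * (400 * X powr (1/6))^4) = (c * 400^4) * X powr (2/3)"
    using X by (simp add: power_mult_distrib powr_power)
  then show ?thesis using X that by (simp only: powr_mult powr_powr) simp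
qed

section \<open>Counting boundary points and reducible forms\<close>

text \<open>For given a, b, c and e the equation for the center to lie on the axis is quadratic in d
  with leading coefficient a \<noteq> 0, so d has at most two values. The \<open>tau\<close> values
  of a, b, c, e have product at most 2 K^4.\<close>

lemma axis_count:
  assumes i: "i \<in> {0,1,2}"
  shows "\<exists>C. \<forall>X\<ge>1. real (card {f. f$1 \<noteq> 0 \<and> height f < X \<and>
     (\<exists>z. center i (real_form f) z \<and> Re z = 0 \<and> Im z \<ge> 1/2)}) \<le> C * X powr (3/4)"
proof -
  let ?F = "\<lambda>X. {f. f$1 \<noteq> 0 \<and> height f < X \<and> (\<exists>z. center i (real_form f) z \<and> Re z = 0 \<and> Im z \<ge> 1/2)}"
  have "real (card (?F X)) \<le> 2 * (tau_zeta^4 * (2 * 400^4) powr (9/8)) * X powr (3/4)" if X: "X \<ge> 1" for X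
  proof -
    define K where "K = 400 * X powr (1/6)"
    define R where "R = (\<lambda>f :: quartic. \<lambda>xs. xs = [f$1, f$2, f$3, f$5])"
    have "real (card (?F X)) \<le> 2 * (tau_zeta^4 * (2 * K^4) powr (9/8))"
    proof (rule rankin_relation[of _ R 4 _ 2, simplified of_nat_numeral])
      show "finite (?F X)"
        by (rule finite_subset[OF _ finite_center_region[OF X, of i]]) auto
      show "\<forall>f\<in>?F X. \<exists>xs. R f xs \<and> length xs = 4 \<and> prod_list (map tau xs) \<le> 2 * K^4"
      proof
        fix f assume "f \<in> ?F X"
        then obtain z where f: "f$1 \<noteq> 0" "height f < X" and z: "center i (real_form f) z" "Re z = 0" "Im z \<ge> 1/2"
          by blast
        have u: "\<bar>Re z\<bar> \<le> 2 * Im z" using z by simp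
        note t = center_tau_bounds[OF z(1) f(2) X u z(3) f(1), folded K_def]
        have v: "Im z > 0" using z(3) by simp
        have t1: "tau (f$1) \<le> K / (Im z)^2" and t2: "tau (f$2) \<le> K / Im z"
          using t(1,2) v by (simp_all add: field_simps)
        have "tau (f$1) * (tau (f$2) * (tau (f$3) * tau (f$5))) \<le> K / (Im z)^2 * (K / Im z * (K * (K * (Im z)^2)))"
          using t v tau_ge_1 by (intro mult_mono t1 t2 t(3,5)) (auto intro!: mult_nonneg_nonneg order_trans[OF zero_le_one tau_ge_1])
        also have "\<dots> = K^4 / Im z" using v by (simp add: field_simps eval_nat_numeral)
        also have "\<dots> \<le> 2 * K^4" using z(3) v by (simp add: field_simps) (use mult_left_mono[of 1 "2 * Im z" "K^4"] in \<open>simp add: mult_ac\<close>)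
        finally show "\<exists>xs. R f xs \<and> length xs = 4 \<and> prod_list (map tau xs) \<le> 2 * K^4"
          by (intro exI[of _ "[f$1, f$2, f$3, f$5]"]) (simp add: R_def mult.assoc)
      qed
      fix xs
        let ?G = "{f \<in> ?F X. R f xs}"
        show "card ?G \<le> 2"
        proof (cases "?G = {}")
          case True show ?thesis unfolding True by simp
        next
          case False
          then obtain f0 where f0: "f0 \<in> ?G" by blast
          define q where "q = (if weight i = 4
            then [: - ((real_of_int (f0$2))^2 * real_of_int (f0$5)), 0, real_of_int (f0$1):]
            else [:real_of_int (f0$5) * (real_of_int (f0$2))^2, - real_of_int (f0$2) * real_of_int (f0$3), real_of_int (f0$1):])"
          have q: "q \<noteq> 0" "degree q \<le> 2" using f0 by (auto simp: q_def)
          have inj: "inj_on (\<lambda>f. real_of_int (f$4)) ?G"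
            by (rule inj_onI) (auto simp: R_def vec5_eq_iff)
          have "(\<lambda>f. real_of_int (f$4)) ` ?G \<subseteq> {x. poly q x = 0}"
          proof (rule image_subsetI)
            fix f assume f: "f \<in> ?G"
            then obtain z where z: "center i (real_form f) z" "Re z = 0" by blast
            have eq: "f$1 = f0$1" "f$2 = f0$2" "f$3 = f0$3" "f$5 = f0$5" using f f0 by (auto simp: R_def)
            have "axis_poly (weight i) (subst_form 1 0 0 1 (real_form f)) = 0"
              by (rule axis_poly_vertical[OF z])
            then show "real_of_int (f$4) \<in> {x. poly q x = 0}"
              using eq by (simp add: subst_form_id axis_poly_def q_def power2_eq_square algebra_simps split: if_splits)
          qed
          then have "card ?G \<le> card {x. poly q x = 0}"
            by (rule card_inj_on_le[OF inj]) (rule poly_roots_finite[OF q(1)])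
          then show ?thesis using card_poly_roots_bound[OF q(1)] q(2) by linarith
        qed
    qed
    also have "\<dots> = 2 * (tau_zeta^4 * (2 * 400^4) powr (9/8)) * X powr (3/4)"
      unfolding K_def using K_powr[of 2 X] X by simp
    finally show ?thesis .
  qed
  then show ?thesis by blast
qed

lemma rankin_injective:
  assumes F: "finite F" "\<And>f. f \<in> F \<Longrightarrow> \<exists>xs. R f xs \<and> length xs = k \<and> prod_list (map tau xs) \<le> N"
    and inj: "\<And>f g xs. R f xs \<Longrightarrow> R g xs \<Longrightarrow> f = g"
  shows "real (card F) \<le> tau_zeta ^ k * N powr (9/8)"
proof -
  have "card {f \<in> F. R f xs} \<le> 1" for xs
    using F(1) inj by (simp add: card_le_Suc0_iff_eq) blast
  then show ?thesis using rankin_relation[of F R k N 1] F by simp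
qed

lemma mult4_mono:
  fixes a b c d :: real
  assumes "0 \<le> a" "a \<le> a'" "0 \<le> b" "b \<le> b'" "0 \<le> c" "c \<le> c'" "0 \<le> d" "d \<le> d'"
  shows "a * b * c * d \<le> a' * b' * c' * d'"
  using assms by (intro mult_mono) (auto intro!: mult_nonneg_nonneg intro: order_trans)

text \<open>If e = 0, the other four coefficients determine f. Otherwise the outer coefficients of
  the two factors have products a and e. Replacing a and e by these four integers leaves the product
  of the \<open>tau\<close> values unchanged, and together with two of b, c, d they determine f. In
  this way Rankin's trick also absorbs the number of divisors.\<close>

lemma splits_count:
  "\<exists>C. \<forall>X\<ge>1. real (card {f. f$1 \<noteq> 0 \<and> height f < X \<and> splits f \<and>
     (\<exists>z. center i (real_form f) z \<and> \<bar>Re z\<bar> \<le> 1/2 \<and> Im z \<ge> 1/2)}) \<le> C * X powr (3/4)"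
proof -
  define F where "F X = {f. f$1 \<noteq> 0 \<and> height f < X \<and> splits f \<and>
     (\<exists>z. center i (real_form f) z \<and> \<bar>Re z\<bar> \<le> 1/2 \<and> Im z \<ge> 1/2)}" for X
  define C0 where "C0 = tau_zeta^6 * (4 * 400^4) powr (9/8)"
  have "real (card (F X)) \<le> 4 * C0 * X powr (3/4)" if X: "X \<ge> 1" for X
  proof -
    define K where "K = 400 * X powr (1/6)"
    have finF: "finite (F X)"
      unfolding F_def by (rule finite_subset[OF _ finite_center_region[OF X, of i]]) auto
    have bnd: "tau (f$1) * tau (f$5) * tau (f$2) * tau (f$4) \<le> 4 * K^4 \<and>
      tau (f$1) * tau (f$5) * tau (f$2) * tau (f$3) \<le> 4 * K^4 \<and>
      tau (f$1) * tau (f$2) * tau (f$3) * tau (f$4) \<le> 4 * K^4 \<and> f$1 \<noteq> 0" if fF: "f \<in> F X" for f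
    proof -
      obtain z where f: "f$1 \<noteq> 0" "height f < X" and z: "center i (real_form f) z" "\<bar>Re z\<bar> \<le> 1/2" "Im z \<ge> 1/2"
        using fF unfolding F_def by blast
      have u: "\<bar>Re z\<bar> \<le> 2 * Im z" using z by simp
      note t = center_tau_bounds[OF z(1) f(2) X u z(3) f(1), folded K_def]
      have v: "Im z > 0" using z(3) by simp
      have t1: "tau (f$1) \<le> K / (Im z)^2" and t2: "tau (f$2) \<le> K / Im z"
        using t(1,2) v by (simp_all add: field_simps)
      have n: "0 \<le> tau m" for m using tau_ge_1[of m] by linarith
      have K0: "K^4 > 0" using t(7) by simp
      have v2: "1 \<le> 2 * Im z" "1 \<le> 4 * (Im z)^2"
        using z(3) power_mono[of "1/2" "Im z" 2] by (simp_all add: power_divide)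
      have "tau (f$1) * tau (f$5) * tau (f$2) * tau (f$4) \<le> K / (Im z)^2 * (K * (Im z)^2) * (K / Im z) * (K * Im z)"
        by (intro mult4_mono n t1 t2 t)
      also have "\<dots> = K^4" using v by (simp add: field_simps eval_nat_numeral)
      finally have 1: "tau (f$1) * tau (f$5) * tau (f$2) * tau (f$4) \<le> 4 * K^4" using K0 by linarith
      have "tau (f$1) * tau (f$5) * tau (f$2) * tau (f$3) \<le> K / (Im z)^2 * (K * (Im z)^2) * (K / Im z) * K"
        by (intro mult4_mono n t1 t2 t)
      also have "\<dots> = K^4 / Im z" using v by (simp add: field_simps eval_nat_numeral)
      also have "\<dots> \<le> 4 * K^4" using mult_left_mono[OF v2(1), of "K^4"] K0 v by (simp add: divide_le_eq mult_ac)
      finally have 2: "tau (f$1) * tau (f$5) * tau (f$2) * tau (f$3) \<le> 4 * K^4" .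
      have "tau (f$1) * tau (f$2) * tau (f$3) * tau (f$4) \<le> K / (Im z)^2 * (K / Im z) * K * (K * Im z)"
        by (intro mult4_mono n t1 t2 t)
      also have "\<dots> = K^4 / (Im z)^2" using v by (simp add: field_simps eval_nat_numeral)
      also have "\<dots> \<le> 4 * K^4" using mult_left_mono[OF v2(2), of "K^4"] K0 v by (simp add: divide_le_eq mult_ac)
      finally show ?thesis using 1 2 f by blast
    qed
    have cK: "tau_zeta ^ k * (4 * K^4) powr (9/8) \<le> C0 * X powr (3/4)" if "k \<le> 6" for k
    proof -
      have "tau_zeta ^ k \<le> tau_zeta ^ 6" using that tau_zeta(1) by (intro power_increasing)
      then have "tau_zeta ^ k * (4 * K^4) powr (9/8) \<le> tau_zeta ^ 6 * (4 * K^4) powr (9/8)"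
        by (rule mult_right_mono) simp
      also have "\<dots> = C0 * X powr (3/4)" unfolding K_def C0_def using K_powr[of 4 X] X by simp
      finally show ?thesis .
    qed
    define F0 where "F0 = {f \<in> F X. f$5 = 0}"
    \<comment> \<open>b and d give c1 and c2, because p and q are nonzero.\<close>
    define R1 where "R1 = (\<lambda>(f :: quartic) xs. \<exists>p q c0 c1 c2 c3. f = vector [p * c0, p * c1 + q * c0, p * c2 + q * c1, p * c3 + q * c2, q * c3]
      \<and> f$1 \<noteq> (0::int) \<and> f$5 \<noteq> 0 \<and> xs = [p, c0, q, c3, f$2, f$4])"
    define F1 where "F1 = {f \<in> F X. \<exists>xs. R1 f xs}"
    \<comment> \<open>b and d form a linear system for q and t with determinant p u - r s.\<close>
    define R2 where "R2 = (\<lambda>(f :: quartic) xs. \<exists>p q r s t u. f = vector [p * s, p * t + q * s, p * u + q * t + r * s, q * u + r * t, r * u]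
      \<and> p * u - r * s \<noteq> (0::int) \<and> f$1 \<noteq> 0 \<and> f$5 \<noteq> 0 \<and> xs = [p, s, r, u, f$2, f$4])"
    define F2 where "F2 = {f \<in> F X. \<exists>xs. R2 f xs}"
    \<comment> \<open>If the determinant vanishes, then p d = r b, so b already gives d, and c takes
      the last place in the tuple.\<close>
    define R3 where "R3 = (\<lambda>(f :: quartic) xs. \<exists>p q r s t u. f = vector [p * s, p * t + q * s, p * u + q * t + r * s, q * u + r * t, r * u]
      \<and> p * u - r * s = (0::int) \<and> f$1 \<noteq> 0 \<and> f$5 \<noteq> 0 \<and> xs = [p, s, r, u, f$2, f$3])"
    define F3 where "F3 = {f \<in> F X. \<exists>xs. R3 f xs}"
    have fin: "finite F0" "finite F1" "finite F2" "finite F3" using finF by (auto simp: F0_def F1_def F2_def F3_def)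
    have "real (card F0) \<le> tau_zeta ^ 4 * (4 * K^4) powr (9/8)"
    proof (rule rankin_injective[OF fin(1), where R = "\<lambda>f xs. f$5 = 0 \<and> xs = [f$1, f$2, f$3, f$4]"])
      fix f assume "f \<in> F0"
      then show "\<exists>xs. (f$5 = 0 \<and> xs = [f$1, f$2, f$3, f$4]) \<and> length xs = 4 \<and> prod_list (map tau xs) \<le> 4 * K^4"
        using bnd[of f] by (auto simp: F0_def mult.assoc)
    qed (auto simp: vec5_eq_iff)
    also have "\<dots> \<le> C0 * X powr (3/4)" by (rule cK) simp
    finally have 0: "real (card F0) \<le> C0 * X powr (3/4)" .
    have "real (card F1) \<le> tau_zeta ^ 6 * (4 * K^4) powr (9/8)"
    proof (rule rankin_injective[OF fin(2), where R = R1])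
      fix f assume f: "f \<in> F1"
      then obtain xs where "R1 f xs" by (auto simp: F1_def)
      then obtain p q c0 c1 c2 c3 where e: "f = vector [p * c0, p * c1 + q * c0, p * c2 + q * c1, p * c3 + q * c2, q * c3]"
        "f$1 \<noteq> 0" "f$5 \<noteq> 0" "xs = [p, c0, q, c3, f$2, f$4]" unfolding R1_def by blast
      have "tau (f$1) = tau p * tau c0" "tau (f$5) = tau q * tau c3" using e(2,3) by (simp_all add: e(1) vector_5 tau_mult)
      then have "prod_list (map tau xs) \<le> 4 * K^4" using bnd[of f] f e(4) by (simp add: F1_def mult.assoc)
      then show "\<exists>xs. R1 f xs \<and> length xs = 6 \<and> prod_list (map tau xs) \<le> 4 * K^4"
        using \<open>R1 f xs\<close> e(4) by (intro exI[of _ xs]) simp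
    next
      fix f g xs assume "R1 f xs" "R1 g xs"
      then show "f = g" unfolding R1_def by (clarsimp simp: vector_5)
    qed
    also have "\<dots> \<le> C0 * X powr (3/4)" by (rule cK) simp
    finally have 1: "real (card F1) \<le> C0 * X powr (3/4)" .
    have "real (card F2) \<le> tau_zeta ^ 6 * (4 * K^4) powr (9/8)"
    proof (rule rankin_injective[OF fin(3), where R = R2])
      fix f assume f: "f \<in> F2"
      then obtain xs where "R2 f xs" by (auto simp: F2_def)
      then obtain p q r s t u where e: "f = vector [p * s, p * t + q * s, p * u + q * t + r * s, q * u + r * t, r * u]"
        "f$1 \<noteq> 0" "f$5 \<noteq> 0" "xs = [p, s, r, u, f$2, f$4]" unfolding R2_def by blast
      have "tau (f$1) = tau p * tau s" "tau (f$5) = tau r * tau u" using e(2,3) by (simp_all add: e(1) vector_5 tau_mult)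
      then have "prod_list (map tau xs) \<le> 4 * K^4" using bnd[of f] f e(4) by (simp add: F2_def mult.assoc)
      then show "\<exists>xs. R2 f xs \<and> length xs = 6 \<and> prod_list (map tau xs) \<le> 4 * K^4"
        using \<open>R2 f xs\<close> e(4) by (intro exI[of _ xs]) simp
    next
      fix f g xs assume fg: "R2 f xs" "R2 g xs"
      from fg(1) obtain p q r s t u where e: "f = vector [p * s, p * t + q * s, p * u + q * t + r * s, q * u + r * t, r * u]"
        "p * u - r * s \<noteq> 0" "xs = [p, s, r, u, f$2, f$4]" unfolding R2_def by blast
      from fg(2) obtain q' t' where e': "g = vector [p * s, p * t' + q' * s, p * u + q' * t' + r * s, q' * u + r * t', r * u]"
        "xs = [p, s, r, u, g$2, g$4]" unfolding R2_def e(3) by auto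
      have eq: "p * t + q * s = p * t' + q' * s" "q * u + r * t = q' * u + r * t'"
        using e(3) e'(2) by (simp_all add: e(1) e'(1) vector_5)
      have "(p * u - r * s) * (t - t') = 0" "(p * u - r * s) * (q - q') = 0" using eq by algebra+
      then have "t = t'" "q = q'" using e(2) by auto
      then show "f = g" using e(1) e'(1) by simp
    qed
    also have "\<dots> \<le> C0 * X powr (3/4)" by (rule cK) simp
    finally have 2: "real (card F2) \<le> C0 * X powr (3/4)" .
    have "real (card F3) \<le> tau_zeta ^ 6 * (4 * K^4) powr (9/8)"
    proof (rule rankin_injective[OF fin(4), where R = R3])
      fix f assume f: "f \<in> F3"
      then obtain xs where "R3 f xs" by (auto simp: F3_def)
      then obtain p q r s t u where e: "f = vector [p * s, p * t + q * s, p * u + q * t + r * s, q * u + r * t, r * u]"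
        "f$1 \<noteq> 0" "f$5 \<noteq> 0" "xs = [p, s, r, u, f$2, f$3]" unfolding R3_def by blast
      have "tau (f$1) = tau p * tau s" "tau (f$5) = tau r * tau u" using e(2,3) by (simp_all add: e(1) vector_5 tau_mult)
      then have "prod_list (map tau xs) \<le> 4 * K^4" using bnd[of f] f e(4) by (simp add: F3_def mult.assoc)
      then show "\<exists>xs. R3 f xs \<and> length xs = 6 \<and> prod_list (map tau xs) \<le> 4 * K^4"
        using \<open>R3 f xs\<close> e(4) by (intro exI[of _ xs]) simp
    next
      have d: "\<exists>p s r u. p \<noteq> 0 \<and> p * f$4 = r * f$2 \<and> f$1 = p * s \<and> f$5 = r * u \<and> xs = [p, s, r, u, f$2, f$3]"
        if "R3 f xs" for f xs
      proof -
        from that obtain p q r s t u where e: "f = vector [p * s, p * t + q * s, p * u + q * t + r * s, q * u + r * t, r * u]"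
          "p * u - r * s = 0" "f$1 \<noteq> 0" "xs = [p, s, r, u, f$2, f$3]" unfolding R3_def by blast
        have "p * f$4 = r * f$2" using e(2) unfolding e(1) vector_5 by algebra
        moreover have "p \<noteq> 0" "f$1 = p * s" "f$5 = r * u" using e(3) by (auto simp: e(1) vector_5)
        ultimately show ?thesis using e(4) by blast
      qed
      fix f g xs assume "R3 f xs" "R3 g xs"
      from d[OF this(1)] d[OF this(2)] show "f = g"
        by (auto simp: vec5_eq_iff) (metis mult_cancel_left)
    qed
    also have "\<dots> \<le> C0 * X powr (3/4)" by (rule cK) simp
    finally have 3: "real (card F3) \<le> C0 * X powr (3/4)" .
    have "F X \<subseteq> F0 \<union> F1 \<union> F2 \<union> F3"
    proof
      fix f assume f: "f \<in> F X"
      show "f \<in> F0 \<union> F1 \<union> F2 \<union> F3"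
      proof (cases "f$5 = 0")
        case False
        have sp: "splits f" and f1: "f$1 \<noteq> 0" using f by (auto simp: F_def)
        from sp have "(\<exists>xs. R1 f xs) \<or> (\<exists>xs. R2 f xs) \<or> (\<exists>xs. R3 f xs)"
          unfolding splits_def
        proof (elim disjE exE)
          fix p q c0 c1 c2 c3
          assume "f = vector [p * c0, p * c1 + q * c0, p * c2 + q * c1, p * c3 + q * c2, q * c3]"
          then have "R1 f [p, c0, q, c3, f$2, f$4]" unfolding R1_def using f1 False by blast
          then show ?thesis by blast
        next
          fix p q r s t u
          assume e: "f = vector [p * s, p * t + q * s, p * u + q * t + r * s, q * u + r * t, r * u]"
          show ?thesis
          proof (cases "p * u - r * s = 0")
            case True
            then have "R3 f [p, s, r, u, f$2, f$3]" unfolding R3_def using e f1 False by blast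
            then show ?thesis by blast
          next
            case nz: False
            then have "R2 f [p, s, r, u, f$2, f$4]" unfolding R2_def using e f1 False by blast
            then show ?thesis by blast
          qed
        qed
        then show ?thesis using f unfolding F1_def F2_def F3_def by blast
      qed (use f in \<open>simp add: F0_def\<close>)
    qed
    then have "card (F X) \<le> card (F0 \<union> F1 \<union> F2 \<union> F3)" using fin by (intro card_mono) auto
    also have "\<dots> \<le> card F0 + card F1 + card F2 + card F3"
      by (meson card_Un_le order_trans add_le_mono order_refl)
    finally have "real (card (F X)) \<le> card F0 + card F1 + card F2 + card F3" by linarith
    then show ?thesis using 0 1 2 3 by linarith
  qed
  then show ?thesis unfolding F_def by blast
qed

text \<open>The curves Re z = 0, 1/2, -1/2 and |z| = 1 are moved to the imaginary axis by integral
  matrices of determinant D = 1, 4, 4 and 2. Such a matrix acts injectively on forms and multiplies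
  the height by D^12, so \<open>axis_count\<close> applies. The new leading coefficient is a value
  of f, nonzero because f does not split.\<close>

lemma boundary_count:
  assumes i: "i \<in> {0,1,2}"
  shows "\<exists>C. \<forall>X\<ge>1. finite {f. \<not> splits f \<and> height f < X \<and> (\<exists>z\<in>fund. center i (real_form f) z)} \<and>
    real (card {f. \<not> splits f \<and> height f < X \<and> (\<exists>z\<in>fund - fund_interior. center i (real_form f) z)}) \<le> C * X powr (3/4)"
proof -
  define B where "B X = {f. f$1 \<noteq> 0 \<and> height f < X \<and>
     (\<exists>z. center i (real_form f) z \<and> Re z = 0 \<and> Im z \<ge> 1/2)}" for X
  obtain C0 where C0: "\<And>X. X \<ge> 1 \<Longrightarrow> real (card (B X)) \<le> C0 * X powr (3/4)"
    using axis_count[OF i] unfolding B_def by blast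
  have finB: "finite (B X)" if "X \<ge> 1" for X
    unfolding B_def by (rule finite_subset[OF _ finite_center_region[OF that, of i]]) auto
  let ?E = "\<lambda>X. {f. \<not> splits f \<and> height f < X \<and> (\<exists>z\<in>fund - fund_interior. center i (real_form f) z)}"
  have Im_fund: "Im z \<ge> 1/2" if "z \<in> fund" for z
  proof -
    have "1 \<le> (cmod z)^2" "\<bar>Re z\<bar>^2 \<le> (1/2)^2"
      using that power_mono[of "\<bar>Re z\<bar>" "1/2" 2] one_le_power[of "cmod z" 2] by (simp_all add: fund_def)
    then have "(1/2)^2 \<le> (Im z)^2" by (simp add: cmod_power2 power_divide)
    then show ?thesis using that by (simp add: fund_def power_mono_iff)
  qed
  have inj: "inj (quartic_act (mat22 p q r s))" if "p * s - q * r \<noteq> 0" for p q r s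
  proof (rule injI)
    fix f g assume "quartic_act (mat22 p q r s) f = quartic_act (mat22 p q r s) g"
    then have e: "subst_form p q r s (real_form f) = subst_form p q r s (real_form g)"
      by (metis real_form_act mat22_nth)
    have "real_of_int p * real_of_int s - real_of_int q * real_of_int r \<noteq> 0" using that by (metis of_int_0_eq_iff of_int_diff of_int_mult)
    from subst_form_inverse(2)[OF this] e have "real_form f = real_form g" by metis
    then show "f = g" by (simp add: real_form_inject)
  qed
  have ht: "height (quartic_act (mat22 p q r s) f) = real_of_int (p * s - q * r)^12 * height f" for p q r s f
    by (simp add: form_height_real_form[symmetric] real_form_act form_height_subst)
  have first: "quartic_act (mat22 p q r s) f $ 1 = quartic_eval f p q" for p q r s f
  proof -
    have "real_of_int (quartic_act (mat22 p q r s) f $ 1) = real_of_int (quartic_eval f p q)"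
      by (simp add: real_form_nth[symmetric] real_form_act subst_form_def vector_5 quartic_eval_def del: real_form_nth)
    then show ?thesis by simp
  qed
  have transfer: "real (card {f. \<not> splits f \<and> height f < X \<and> (\<exists>z\<in>fund. P z \<and> center i (real_form f) z)})
      \<le> C0 * (of_int (p * s - q * r) ^ 12 * X) powr (3/4)"
    if X: "X \<ge> 1" and D: "p * s - q * r \<ge> 1"
      and P: "\<And>z. z \<in> fund \<Longrightarrow> P z \<Longrightarrow> Re (upper_act p q r s z) = 0 \<and> Im (upper_act p q r s z) \<ge> 1/2"
      and nz: "\<And>f. \<not> splits f \<Longrightarrow> quartic_eval f p q \<noteq> 0" for X p q r s P
  proof -
    let ?A = "{f. \<not> splits f \<and> height f < X \<and> (\<exists>z\<in>fund. P z \<and> center i (real_form f) z)}"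
    let ?Y = "of_int (p * s - q * r) ^ 12 * X"
    have D1: "real_of_int (p * s - q * r) ^ 12 \<ge> 1" using D by (metis of_int_1_le_iff one_le_power)
    have Y: "?Y \<ge> 1" using D1 X mult_mono[of 1 _ 1 X] by fastforce
    have sub: "quartic_act (mat22 p q r s) ` ?A \<subseteq> B ?Y"
    proof (rule image_subsetI)
      fix f assume "f \<in> ?A"
      then obtain z where f: "\<not> splits f" "height f < X" and z: "z \<in> fund" "P z" "center i (real_form f) z" by blast
      have "p * s - q * r \<noteq> 0" using D by simp
      from center_act[OF z(3) this] P[OF z(1,2)] first nz[OF f(1)] f(2) D1
      show "quartic_act (mat22 p q r s) f \<in> B ?Y"
        unfolding B_def ht mem_Collect_eq by (intro conjI exI[of _ "upper_act p q r s z"] mult_strict_left_mono) auto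
    qed
    have "p * s - q * r \<noteq> 0" using D by simp
    then have "inj_on (quartic_act (mat22 p q r s)) ?A"
      by (rule inj_on_subset[OF inj]) simp
    then have "card ?A \<le> card (B ?Y)" by (rule card_inj_on_le[OF _ sub finB[OF Y]])
    then show ?thesis using C0[OF Y] by linarith
  qed
  have nz10: "quartic_eval f c 0 \<noteq> (0 :: int)" if "\<not> splits f" "c \<noteq> 0" for f c
    using that splits_if_leading_0[of f] by (auto simp: quartic_eval_def)
  have nz11: "quartic_eval f 1 1 \<noteq> (0 :: int)" if "\<not> splits f" for f
  proof -
    have G: "mat22 1 1 0 1 \<in> GL2Z" by (simp add: mat22_GL2Z_iff)
    have "\<not> splits (quartic_act (mat22 1 1 0 1) f)"
      using irreducible_act[OF G] that by (simp add: irreducible_over_Q_iff)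
    then show ?thesis using splits_if_leading_0 first[of 1 1 0 1 f] by metis
  qed
  define C where "C = C0 * (1 powr (3/4) + 2 * (4^12) powr (3/4) + (2^12) powr (3/4))"
  have "real (card (?E X)) \<le> C * X powr (3/4)" if X: "X \<ge> 1" for X
  proof -
    define A where "A P = {f. \<not> splits f \<and> height f < X \<and> (\<exists>z\<in>fund. P z \<and> center i (real_form f) z)}" for P
    have finA: "finite (A P)" for P
      unfolding A_def
      by (rule finite_subset[OF _ finite_center_region[OF X, of i]])
        (use Im_fund splits_if_leading_0 in \<open>force simp: fund_def\<close>)
    have "z \<in> fund - fund_interior \<Longrightarrow> z \<in> fund \<and> (Re z = 0 \<or> Re z = 1/2 \<or> Re z = -1/2 \<or> cmod z = 1)" for z
      by (auto simp: fund_def fund_interior_def)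
    then have "?E X \<subseteq> A (\<lambda>z. Re z = 0) \<union> A (\<lambda>z. Re z = 1/2) \<union> A (\<lambda>z. Re z = -1/2) \<union> A (\<lambda>z. cmod z = 1)"
      unfolding A_def by blast
    then have "card (?E X) \<le> card (A (\<lambda>z. Re z = 0) \<union> A (\<lambda>z. Re z = 1/2) \<union> A (\<lambda>z. Re z = -1/2) \<union> A (\<lambda>z. cmod z = 1))"
      using finA by (intro card_mono) auto
    also have "\<dots> \<le> card (A (\<lambda>z. Re z = 0)) + card (A (\<lambda>z. Re z = 1/2)) + card (A (\<lambda>z. Re z = -1/2)) + card (A (\<lambda>z. cmod z = 1))"
      by (meson card_Un_le order_trans add_le_mono order_refl)
    finally have le: "real (card (?E X)) \<le> real (card (A (\<lambda>z. Re z = 0))) + real (card (A (\<lambda>z. Re z = 1/2)))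
       + real (card (A (\<lambda>z. Re z = -1/2))) + real (card (A (\<lambda>z. cmod z = 1)))" by linarith
    have 1: "real (card (A (\<lambda>z. Re z = 0))) \<le> C0 * (of_int (1 * 1 - 0 * 0) ^ 12 * X) powr (3/4)"
      unfolding A_def
      by (rule transfer[OF X]) (use Im_fund nz10 in \<open>auto simp: upper_act_def\<close>)
    \<comment> \<open>The translation by 1/2 is given by the integral matrix with rows (2, 0) and
      (1, 2).\<close>
    have 2: "real (card (A (\<lambda>z. Re z = 1/2))) \<le> C0 * (of_int (2 * 2 - 0 * 1) ^ 12 * X) powr (3/4)"
      unfolding A_def
      by (rule transfer[OF X]) (use Im_fund nz10 in \<open>auto simp: upper_act_def Re_divide Im_divide\<close>)
    have 3: "real (card (A (\<lambda>z. Re z = -1/2))) \<le> C0 * (of_int (2 * 2 - 0 * (-1)) ^ 12 * X) powr (3/4)"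
      unfolding A_def
      by (rule transfer[OF X]) (use Im_fund nz10 in \<open>auto simp: upper_act_def Re_divide Im_divide\<close>)
    \<comment> \<open>The map z -> (z + 1) / (1 - z) sends the unit circle to the imaginary
      axis.\<close>
    have 4: "real (card (A (\<lambda>z. cmod z = 1))) \<le> C0 * (of_int (1 * 1 - 1 * (-1)) ^ 12 * X) powr (3/4)"
      unfolding A_def
    proof (rule transfer[OF X])
      fix z assume z: "z \<in> fund" "cmod z = 1"
      let ?w = "(z * of_int 1 - of_int (- 1)) / (of_int 1 - z * of_int 1)"
      have sq: "(Re z)^2 + (Im z)^2 = 1" using z(2) by (metis cmod_power2 one_power2)
      have u: "\<bar>Re z\<bar> \<le> 1/2" "Im z \<ge> 1/2" using z Im_fund by (auto simp: fund_def)
      have den: "(1 - Re z)^2 + (Im z)^2 = 2 - 2 * Re z" using sq by (simp add: power2_diff)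
      have "Re ?w = 0" using sq by (simp add: Re_divide power2_eq_square algebra_simps)
      moreover have "Im ?w = 2 * Im z / (2 - 2 * Re z)"
        unfolding den[symmetric] by (simp add: Im_divide diff_divide_distrib[symmetric] add_divide_distrib[symmetric] algebra_simps)
      moreover have "2 * Im z / (2 - 2 * Re z) \<ge> 1/2"
      proof -
        have "(Im z)^2 \<ge> (1 - Re z)^2 / 4"
        proof -
          have "4 * (Im z)^2 - (1 - Re z)^2 = (1 - Re z) * (3 + 5 * Re z)" using sq by algebra
          moreover have "(1 - Re z) * (3 + 5 * Re z) \<ge> 0" using u by (intro mult_nonneg_nonneg) auto
          ultimately show ?thesis by simp
        qed
        then have "((1 - Re z) / 2)^2 \<le> (Im z)^2" by (simp add: power_divide)
        then have "(1 - Re z) / 2 \<le> Im z" using u by (simp add: power_mono_iff)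
        moreover have "2 - 2 * Re z > 0" using u by linarith
        ultimately show ?thesis by (subst le_divide_eq) simp
      qed
      ultimately show "Re (upper_act 1 1 (- 1) 1 z) = 0 \<and> Im (upper_act 1 1 (- 1) 1 z) \<ge> 1/2"
        by (simp add: upper_act_def Let_def)
    qed (use nz11 in auto)
    show ?thesis using le 1 2 3 4 X unfolding C_def by (simp add: powr_mult algebra_simps)
  qed
  moreover have "finite {f. \<not> splits f \<and> height f < X \<and> (\<exists>z\<in>fund. center i (real_form f) z)}" if X: "X \<ge> 1" for X
    by (rule finite_subset[OF _ finite_center_region[OF X, of i]])
      (use Im_fund splits_if_leading_0 in \<open>force simp: fund_def\<close>)
  ultimately show ?thesis by blast
qed

section \<open>From classes to forms with center in the cusp\<close>

text \<open>The usual fundamental domain dilated by L, with the left side included and the right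
  side excluded, so that translates by multiples of L are disjoint.\<close>

definition cusp :: "real \<Rightarrow> complex set" where
  "cusp L = {z. Im z > 0 \<and> - (L / 2) \<le> Re z \<and> Re z < L / 2 \<and> L \<le> cmod z}"

definition region :: "nat \<Rightarrow> real \<Rightarrow> complex set \<Rightarrow> quartic set" where
  "region i X D = {f. f$1 \<noteq> 0 \<and> height f < X \<and> (\<exists>z\<in>D. center i (real_form f) z)}"

text \<open>Irreducibility is not a condition that can be followed along a segment of forms; it is
  traded here for a \<noteq> 0, at the cost of the reducible forms. The constant is chosen before
  \<open>S\<close>, since it has to serve for the given set and for the set of all forms.\<close>

lemma N_classes_region:
  assumes i: "i \<in> {0,1,2}"
  shows "\<exists>C. \<forall>S. GL2Z_invariant S \<longrightarrow> (\<forall>X\<ge>1.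
    \<bar>2 * real (N_classes (S \<inter> V_Z i) X) - real (card (S \<inter> region i X (cusp 1)))\<bar> \<le> C * X powr (3/4))"
proof -
  let ?E = "\<lambda>X. {f. \<not> splits f \<and> height f < X \<and> (\<exists>z\<in>fund - fund_interior. center i (real_form f) z)}"
  let ?M = "\<lambda>X. {f. \<not> splits f \<and> height f < X \<and> (\<exists>z\<in>fund. center i (real_form f) z)}"
  let ?P = "\<lambda>X. {f. f$1 \<noteq> 0 \<and> height f < X \<and> splits f \<and>
     (\<exists>z. center i (real_form f) z \<and> \<bar>Re z\<bar> \<le> 1/2 \<and> Im z \<ge> 1/2)}"
  obtain C1 where C1: "\<And>X. X \<ge> 1 \<Longrightarrow> finite (?M X)" "\<And>X. X \<ge> 1 \<Longrightarrow> real (card (?E X)) \<le> C1 * X powr (3/4)"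
    using boundary_count[OF i] by meson
  obtain C2 where C2: "\<And>X. X \<ge> 1 \<Longrightarrow> real (card (?P X)) \<le> C2 * X powr (3/4)"
    using splits_count by meson
  have "\<bar>2 * real (N_classes (S \<inter> V_Z i) X) - real (card (S \<inter> region i X (cusp 1)))\<bar> \<le> (3 * C1 + C2) * X powr (3/4)"
    if S: "GL2Z_invariant S" and X: "X \<ge> 1" for S X
  proof -
    define A where "A = {f \<in> S \<inter> V_Z i. irreducible_over_Q f \<and> height f < X}"
    define R where "R = {f \<in> A. \<exists>z\<in>fund. center i (real_form f) z}"
    define R' where "R' = {f \<in> A. \<exists>z\<in>fund_interior. center i (real_form f) z}"
    define T where "T = S \<inter> region i X (cusp 1)"
    have finR: "finite R" by (rule finite_subset[OF _ C1(1)[OF X]]) (auto simp: R_def A_def irreducible_over_Q_iff)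
    have finE: "finite (?E X)" by (rule finite_subset[OF _ C1(1)[OF X]]) auto
    have finP: "finite (?P X)" by (rule finite_subset[OF _ finite_center_region[OF X, of i]]) auto
    have oc: "card R' \<le> 2 * N_classes (S \<inter> V_Z i) X" "2 * N_classes (S \<inter> V_Z i) X \<le> card R' + 2 * card (R - R')"
      using orbit_count[OF S i, of X] finR unfolding R_def R'_def A_def by auto
    have "R - R' \<subseteq> ?E X" by (auto simp: R_def R'_def A_def irreducible_over_Q_iff)
    then have c1: "card (R - R') \<le> card (?E X)" using finE by (rule card_mono[rotated])
    have "R' \<subseteq> T"
    proof
      fix f assume f: "f \<in> R'"
      then have "f$1 \<noteq> 0" using splits_if_leading_0 by (auto simp: R'_def A_def irreducible_over_Q_iff)
      moreover have "fund_interior \<subseteq> cusp 1" by (auto simp: fund_interior_def cusp_def)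
      ultimately show "f \<in> T" using f by (auto simp: T_def R'_def A_def region_def)
    qed
    have fund_cusp: "cusp 1 \<subseteq> fund" unfolding cusp_def fund_def by (auto simp: abs_le_iff)
    have "T - R' \<subseteq> ?E X \<union> ?P X"
    proof
      fix f assume f: "f \<in> T - R'"
      then obtain z where z: "z \<in> cusp 1" "center i (real_form f) z" and f': "f \<in> S" "f$1 \<noteq> 0" "height f < X"
        by (auto simp: T_def region_def)
      show "f \<in> ?E X \<union> ?P X"
      proof (cases "splits f")
        case True
        have u: "\<bar>Re z\<bar> \<le> 1/2" using z(1) unfolding cusp_def by (auto simp: abs_le_iff)
        have "1 \<le> (cmod z)^2" "\<bar>Re z\<bar>^2 \<le> (1/2)^2"
          using u z(1) power_mono[of "\<bar>Re z\<bar>" "1/2" 2] one_le_power[of "cmod z" 2] by (simp_all add: cusp_def)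
        then have "(1/2)^2 \<le> (Im z)^2" by (simp add: cmod_power2 power_divide)
        then have "1/2 \<le> Im z" using z(1) by (simp add: cusp_def power_mono_iff)
        then show ?thesis using True z f' u by blast
      next
        case False
        then have irr: "irreducible_over_Q f" by (simp add: irreducible_over_Q_iff)
        then have "f \<in> A" using f' z(2) V_Z_iff_center[OF irr i] by (auto simp: A_def)
        then have "z \<notin> fund_interior" using f z(2) by (auto simp: R'_def)
        then show ?thesis using False f' z fund_cusp by blast
      qed
    qed
    then have "card (T - R') \<le> card (?E X \<union> ?P X)" using finE finP by (intro card_mono) auto
    also have "\<dots> \<le> card (?E X) + card (?P X)" by (rule card_Un_le)
    finally have c2: "card (T - R') \<le> card (?E X) + card (?P X)" .
    have finR': "finite R'" by (rule finite_subset[OF _ finR]) (auto simp: R_def R'_def fund_def fund_interior_def less_imp_le)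
    have "finite (T - R')" using \<open>T - R' \<subseteq> ?E X \<union> ?P X\<close> finE finP by (meson finite_Un finite_subset)
    then have "finite T" using finR' by simp
    then have "card T = card R' + card (T - R')"
      using \<open>R' \<subseteq> T\<close> by (metis card_Diff_subset card_mono finR' le_add_diff_inverse)
    then have "\<bar>2 * real (N_classes (S \<inter> V_Z i) X) - real (card T)\<bar> \<le> 3 * real (card (?E X)) + real (card (?P X))"
      using oc c1 c2 by linarith
    also have "\<dots> \<le> 3 * (C1 * X powr (3/4)) + C2 * X powr (3/4)"
      using C1(2)[OF X] C2[OF X] by linarith
    finally show ?thesis by (simp add: T_def algebra_simps)
  qed
  then show ?thesis by blast
qed

section \<open>Equidistribution in residue classes\<close>

lemma wedge_center_bounds:
  assumes f: "f \<in> region i X (wedge L)" and L: "L \<ge> 1" and X: "X \<ge> 1"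
  defines "K \<equiv> 400 * X powr (1/6)"
  shows "\<bar>real_of_int (f$1)\<bar> \<le> 4 * K / L^2" "\<bar>real_of_int (f$2)\<bar> \<le> 2 * K / L" "\<bar>real_of_int (f$3)\<bar> \<le> K"
    "\<bar>real_of_int (f$4)\<bar> \<le> 2 * K * L" "\<bar>real_of_int (f$5)\<bar> \<le> 4 * K * L^2" "L^2 \<le> 4 * K"
proof -
  obtain z where f1: "f$1 \<noteq> 0" and H: "height f < X" and z: "z \<in> wedge L" "center i (real_form f) z"
    using f by (auto simp: region_def)
  have w: "\<bar>Re z\<bar> \<le> L" "L \<le> cmod z" "L \<le> cmod (z - of_real L)" "L \<le> cmod (z + of_real L)" "Im z \<ge> 0" "cmod z < 2 * L"
    using z(1) by (auto simp: wedge_def)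
  have vL: "L / 2 \<le> Im z" by (rule wedge_Im_ge) (use L w in auto)
  have v: "Im z > 0" "Im z \<ge> 1/2" "\<bar>Re z\<bar> \<le> 2 * Im z" using vL L w(1) by linarith+
  have v2: "Im z \<le> 2 * L" using w(6) abs_Im_le_cmod[of z] by linarith
  note t = center_tau_bounds[OF z(2) H X v(3,2) f1, folded K_def]
  have K0: "K > 0" using t(7) by simp
  have sq: "L^2 / 4 \<le> (Im z)^2" using power_mono[OF vL, of 2] L by (simp add: power_divide)
  have sq2: "(Im z)^2 \<le> 4 * L^2" using power_mono[OF v2, of 2] v by (simp add: power_mult_distrib)
  show "L^2 \<le> 4 * K" using sq t(6) by linarith
  have "tau (f$1) * (L^2 / 4) \<le> K" using t(1) mult_left_mono[OF sq, of "tau (f$1)"] tau_ge_1[of "f$1"] by linarith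
  then have "tau (f$1) \<le> 4 * K / L^2" using L by (simp add: field_simps)
  then show "\<bar>real_of_int (f$1)\<bar> \<le> 4 * K / L^2" using tau_abs order_trans by blast
  have "tau (f$2) * (L / 2) \<le> K" using t(2) mult_left_mono[OF vL, of "tau (f$2)"] tau_ge_1[of "f$2"] by linarith
  then have "tau (f$2) \<le> 2 * K / L" using L by (simp add: field_simps)
  then show "\<bar>real_of_int (f$2)\<bar> \<le> 2 * K / L" using tau_abs order_trans by blast
  show "\<bar>real_of_int (f$3)\<bar> \<le> K" using tau_abs t(3) order_trans by blast
  have "tau (f$4) \<le> K * (2 * L)" using t(4) mult_left_mono[OF v2 less_imp_le[OF K0]] by linarith
  then have "tau (f$4) \<le> 2 * K * L" by (simp only: mult_ac)
  then show "\<bar>real_of_int (f$4)\<bar> \<le> 2 * K * L" using tau_abs order_trans by blast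
  have "tau (f$5) \<le> K * (4 * L^2)" using t(5) mult_left_mono[OF sq2 less_imp_le[OF K0]] by linarith
  then have "tau (f$5) \<le> 4 * K * L^2" by (simp only: mult_ac)
  then show "\<bar>real_of_int (f$5)\<bar> \<le> 4 * K * L^2" using tau_abs order_trans by blast
qed

text \<open>Five directions, at most 7 M integers on a side of half length M, the factor 64 in a
  product of four half lengths, and K^4 = 400^4 X^(2/3).\<close>

definition face_const :: real where "face_const = 5 * 7^4 * 64 * 400^4"

lemma prod_UNIV_5: "(\<Prod>j\<in>UNIV - {i :: 5}. g j) = (if i = 1 then 1 else g 1) * (if i = 2 then 1 else g 2) *
   (if i = 3 then 1 else g 3) * (if i = 4 then 1 else g 4) * (if i = 5 then 1 else g 5)"
  for g :: "5 \<Rightarrow> 'b::comm_monoid_mult"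
proof -
  have U: "(UNIV :: 5 set) = {1, 2, 3, 4, 5}" using exhaust_5 by blast
  have "(\<Prod>j\<in>UNIV - {i}. g j) = (\<Prod>j\<in>UNIV. if j = i then 1 else g j)"
    by (rule prod.mono_neutral_cong_left) auto
  also have "\<dots> = (if i = 1 then 1 else g 1) * (if i = 2 then 1 else g 2) *
   (if i = 3 then 1 else g 3) * (if i = 4 then 1 else g 4) * (if i = 5 then 1 else g 5)"
    unfolding U by (simp add: mult.assoc eq_commute[of _ i])
  finally show ?thesis .
qed

lemma sum_UNIV_5: "(\<Sum>i\<in>UNIV. g (i :: 5)) = g 1 + g 2 + g 3 + g 4 + g 5" for g :: "5 \<Rightarrow> 'b::comm_monoid_add"
proof -
  have U: "(UNIV :: 5 set) = {1, 2, 3, 4, 5}" using exhaust_5 by blast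
  show ?thesis unfolding U by (simp add: add.assoc)
qed

text \<open>A unit step that enters or leaves the region starts in a box given by the
  \<open>M j\<close> and crosses a zero of one of 11 boundary polynomials of degree at most 6. Hence
  198 = 11 * 18, where 18 = 3 * 6 comes from \<open>card_crossings_le\<close>. The empty region is
  set apart because L^2 <= 4 K, which makes every \<open>M j\<close> at least 1, is read off from a
  form in the region.\<close>

lemma region_changes:
  assumes L: "L \<ge> 1" and X: "X \<ge> 1"
  shows "real (card {f. (f \<in> region i X (wedge L)) \<noteq> (f + axis k 1 \<in> region i X (wedge L))})
      \<le> 198 * face_const * X powr (2/3) * L^2"
proof (cases "region i X (wedge L) = {}")
  case True
  then show ?thesis using X by (simp add: face_const_def)
next
  case False
  define K where "K = 400 * X powr (1/6)"
  define Rg where "Rg = region i X (wedge L)"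
  have Kge: "K \<ge> 400" using X by (simp add: K_def ge_one_powr_ge_zero)
  obtain f0 where "f0 \<in> region i X (wedge L)" using False by blast
  then have LK: "L^2 \<le> 4 * K" using wedge_center_bounds(6)[OF _ L X] by (simp add: K_def)
  define M where "M = (\<lambda>j :: 5. if j = 1 then 4 * K / L^2 else if j = 2 then 2 * K / L else if j = 3 then K
     else if j = 4 then 2 * K * L else 4 * K * L^2)"
  have L0: "L > 0" using L by simp
  have LL: "L \<le> L^2" using L by (simp add: power2_eq_square)
  have M1: "M j \<ge> 1" for j
  proof -
    have "1 \<le> 4 * K / L^2" using LK L0 by (simp add: le_divide_eq)
    moreover have "K \<le> K * K" using mult_right_mono[of 1 K K] Kge by simp
    then have "L^2 \<le> (2 * K)^2" using LK by (simp add: power_mult_distrib power2_eq_square[of K])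
    then have "L \<le> 2 * K" by (rule power2_le_imp_le) (use Kge in simp)
    then have "1 \<le> 2 * K / L" using L0 by (simp add: le_divide_eq)
    moreover have "1 \<le> 2 * K * L" using mult_mono[of 1 "2 * K" 1 L] Kge L by simp
    moreover have "1 \<le> 4 * K * L^2" using mult_mono[of 1 "4 * K" 1 "L^2"] Kge L by (simp add: one_le_power)
    ultimately show ?thesis using Kge by (simp add: M_def)
  qed
  \<comment> \<open>One more on each side, since possibly only the end of the step lies in the
    region.\<close>
  define A where "A = (\<lambda>j. {- \<lceil>M j\<rceil> - 1..\<lceil>M j\<rceil> + 1})"
  have finA: "finite (A j)" for j by (simp add: A_def)
  have cardA: "real (card (A j)) \<le> 7 * M j" for j
    using M1[of j] of_int_ceiling_le_add_one[of "M j"] by (simp add: A_def) linarith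
  have bnd: "\<bar>real_of_int (f$j)\<bar> \<le> M j" if "f \<in> Rg" for f j
    using wedge_center_bounds[OF that[unfolded Rg_def] L X, folded K_def] exhaust_5[of j] by (auto simp: M_def)
  have inA: "n \<in> A j" if "\<bar>real_of_int (n + d)\<bar> \<le> M j" "\<bar>d\<bar> \<le> 1" for n d j
    using that unfolding A_def by (simp add: abs_le_iff) linarith
  have faces: "real (faces A) \<le> face_const * X powr (2/3) * L^2"
  proof -
    have e: "real (\<Prod>j\<in>UNIV - {i}. card (A j)) \<le> 7^4 * (64 * (K^4 * L^2))" for i
    proof -
      have "real (\<Prod>j\<in>UNIV - {i}. card (A j)) = (\<Prod>j\<in>UNIV - {i}. real (card (A j)))" by simp
      also have "\<dots> \<le> (\<Prod>j\<in>UNIV - {i}. 7 * M j)"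
        by (intro prod_mono conjI cardA) simp
      also have "\<dots> = 7^4 * (\<Prod>j\<in>UNIV - {i}. M j)"
        by (simp add: prod.distrib)
      also have "(\<Prod>j\<in>UNIV - {i}. M j) \<le> 64 * (K^4 * L^2)"
      proof -
        have K4: "K^4 > 0" using Kge by simp
        have L2: "1 \<le> L^2" using L by (simp add: one_le_power)
        have *: "K^4 \<le> K^4 * L^2" "K^4 * L \<le> K^4 * L^2" "K^4 / L \<le> K^4 * L^2" "K^4 / L^2 \<le> K^4 * L^2"
        proof -
          show 1: "K^4 \<le> K^4 * L^2" using mult_left_mono[OF L2, of "K^4"] K4 by simp
          show "K^4 * L \<le> K^4 * L^2" using LL K4 by simp
          have "K^4 / L \<le> K^4" "K^4 / L^2 \<le> K^4"
            using K4 L0 mult_left_mono[OF L, of "K^4"] 1 by (simp_all add: divide_le_eq)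
          then show "K^4 / L \<le> K^4 * L^2" "K^4 / L^2 \<le> K^4 * L^2" using 1 by linarith+
        qed
        consider "i = 1" | "i = 2" | "i = 3" | "i = 4" | "i = 5" using exhaust_5 by blast
        then show ?thesis
        proof cases
          \<comment> \<open>The face of largest order in L: it omits the leading coefficient, whose
            side is the shortest.\<close>
          case 1
          have "(\<Prod>j\<in>UNIV - {i}. M j) = 16 * (K^4 * L^2)"
            using 1 L0 by (simp add: prod_UNIV_5 M_def field_simps eval_nat_numeral)
          then show ?thesis using * K4 by linarith
        next
          case 2
          have "(\<Prod>j\<in>UNIV - {i}. M j) = 32 * (K^4 * L)"
            using 2 L0 by (simp add: prod_UNIV_5 M_def field_simps eval_nat_numeral)
          then show ?thesis using * K4 by linarith
        next
          case 3
          have "(\<Prod>j\<in>UNIV - {i}. M j) = 64 * K^4"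
            using 3 L0 by (simp add: prod_UNIV_5 M_def field_simps eval_nat_numeral)
          then show ?thesis using * K4 by linarith
        next
          case 4
          have "(\<Prod>j\<in>UNIV - {i}. M j) = 32 * (K^4 / L)"
            using 4 L0 by (simp add: prod_UNIV_5 M_def field_simps eval_nat_numeral)
          then show ?thesis using * K4 by linarith
        next
          case 5
          have "(\<Prod>j\<in>UNIV - {i}. M j) = 16 * (K^4 / L^2)"
            using 5 L0 by (simp add: prod_UNIV_5 M_def field_simps eval_nat_numeral)
          then show ?thesis using * K4 by linarith
        qed
      qed
      finally show ?thesis by simp
    qed
    have "real (faces A) \<le> 5 * (7^4 * (64 * (K^4 * L^2)))"
      unfolding faces_def sum_UNIV_5 of_nat_add using e[of 1] e[of 2] e[of 3] e[of 4] e[of 5] by linarith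
    moreover have "K^4 = 400^4 * X powr (2/3)" using X by (simp add: K_def power_mult_distrib powr_power)
    ultimately show ?thesis by (simp add: face_const_def mult_ac)
  qed
  let ?D = "{f. (f \<in> Rg) \<noteq> (f + axis k 1 \<in> Rg)}"
  let ?C = "\<lambda>Q. {f. (\<forall>j. f$j \<in> A j) \<and> (\<exists>s\<in>{0..1}. Q (real_form f + s *\<^sub>R axis k 1) = 0)}"
  let ?P = "boundary_polys (weight i) L X"
  have Rg_iff: "f \<in> Rg \<longleftrightarrow> real_form f $ 1 \<noteq> 0 \<and> form_height (real_form f) < X \<and> (\<exists>z\<in>wedge L. center i (real_form f) z)" for f
    by (simp add: Rg_def region_def form_height_real_form)
  have step: "real_form (f + axis k 1) = real_form f + axis k 1" for f
    by (simp add: vec_eq_iff axis_def)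
  have seg: "h \<in> closed_segment (real_form f) (real_form f + axis k 1) \<Longrightarrow> \<exists>s\<in>{0..1}. h = real_form f + s *\<^sub>R axis k 1" for h f
    by (auto simp: closed_segment_def algebra_simps)
  have "?D \<subseteq> (\<Union>Q\<in>set ?P. ?C Q)"
  proof
    fix f assume "f \<in> ?D"
    then have ch: "f \<in> Rg \<and> f + axis k 1 \<notin> Rg \<or> f + axis k 1 \<in> Rg \<and> f \<notin> Rg" by blast
    have box: "\<forall>j. f$j \<in> A j"
    proof
      fix j
      show "f$j \<in> A j" using ch
      proof (elim disjE conjE)
        assume "f \<in> Rg" then show ?thesis using bnd[of f j] by (intro inA[of _ 0]) auto
      next
        assume "f + axis k 1 \<in> Rg"
        then show ?thesis using bnd[of "f + axis k 1" j] by (intro inA[of _ "axis k 1 $ j"]) (auto simp: axis_def)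
      qed
    qed
    have "\<exists>h\<in>closed_segment (real_form f) (real_form f + axis k 1). \<exists>Q\<in>set ?P. Q h = 0"
      using ch
    proof (elim disjE conjE)
      assume a: "f \<in> Rg" "f + axis k 1 \<notin> Rg"
      show ?thesis
        by (rule region_change[of L X]) (use a L0 X in \<open>simp_all add: Rg_iff step\<close>)
    next
      assume a: "f + axis k 1 \<in> Rg" "f \<notin> Rg"
      have "\<exists>h\<in>closed_segment (real_form f + axis k 1) (real_form f). \<exists>Q\<in>set ?P. Q h = 0"
        by (rule region_change[of L X]) (use a L0 X in \<open>simp_all add: Rg_iff step\<close>)
      then show ?thesis by (simp add: closed_segment_commute)
    qed
    then obtain h Q where h: "h \<in> closed_segment (real_form f) (real_form f + axis k 1)" "Q \<in> set ?P" "Q h = 0" by blast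
    from seg[OF h(1)] obtain s where "s \<in> {0..1}" "h = real_form f + s *\<^sub>R axis k 1" by blast
    then show "f \<in> (\<Union>Q\<in>set ?P. ?C Q)" using h box by blast
  qed
  moreover have finC: "finite (?C Q)" for Q
    by (rule finite_subset[OF _ finite_bounded_vec[of "\<Union>j. A j"]]) (use finA in auto)
  ultimately have "card ?D \<le> card (\<Union>Q\<in>set ?P. ?C Q)" by (intro card_mono) auto
  also have "\<dots> \<le> (\<Sum>Q\<in>set ?P. card (?C Q))" by (rule card_UN_le) simp
  also have "\<dots> \<le> (\<Sum>Q\<in>set ?P. 3 * 6 * faces A)"
  proof (rule sum_mono)
    fix Q assume Q: "Q \<in> set ?P"
    obtain p where "Q p \<noteq> 0" using boundary_polys_nonzero[OF Q] L0 X by auto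
    then show "card (?C Q) \<le> 3 * 6 * faces A"
      by (rule card_crossings_le[OF boundary_polys_line_poly[OF Q] _ finA])
  qed
  also have "\<dots> = card (set ?P) * (18 * faces A)" by simp
  also have "\<dots> \<le> 11 * (18 * faces A)"
    by (intro mult_right_mono order_trans[OF card_length]) (simp_all add: boundary_polys_def)
  finally have "real (card ?D) \<le> 198 * real (faces A)" by linarith
  also have "\<dots> \<le> 198 * (face_const * X powr (2/3) * L^2)" using faces by simp
  finally show ?thesis by (simp add: Rg_def mult.assoc)
qed

section \<open>Translations and residue classes\<close>

text \<open>The number of changes is subadditive in the translation, and v is a sum of at most 5 m
  unit vectors.\<close>

lemma changes_translate:
  fixes R :: "quartic set"
  assumes fin: "finite R" and D: "\<And>k. card {f. (f \<in> R) \<noteq> (f + axis k 1 \<in> R)} \<le> D"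
    and v: "\<And>j. v$j \<in> {0..int m}"
  shows "card {f. (f \<in> R) \<noteq> (f + v \<in> R)} \<le> 5 * m * D"
proof -
  define ch where "ch w = card {f. (f \<in> R) \<noteq> (f + w \<in> R)}" for w :: quartic
  have fin': "finite {f. (f \<in> R) \<noteq> (f + w \<in> R)}" for w
  proof (rule finite_subset)
    show "{f. (f \<in> R) \<noteq> (f + w \<in> R)} \<subseteq> R \<union> (\<lambda>g. g - w) ` R"
      by (auto intro!: image_eqI[of _ _ "_ + w"])
    show "finite (R \<union> (\<lambda>g. g - w) ` R)" using fin by simp
  qed
  have add: "ch (w + w') \<le> ch w + ch w'" for w w'
  proof -
    have "{f. (f \<in> R) \<noteq> (f + (w + w') \<in> R)} \<subseteq>
      {f. (f \<in> R) \<noteq> (f + w \<in> R)} \<union> (\<lambda>g. g - w) ` {g. (g \<in> R) \<noteq> (g + w' \<in> R)}"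
      by (auto simp: add.assoc intro!: image_eqI[of _ _ "_ + w"])
    then have "ch (w + w') \<le> card ({f. (f \<in> R) \<noteq> (f + w \<in> R)} \<union> (\<lambda>g. g - w) ` {g. (g \<in> R) \<noteq> (g + w' \<in> R)})"
      unfolding ch_def by (intro card_mono) (use fin' in auto)
    also have "\<dots> \<le> ch w + card ((\<lambda>g. g - w) ` {g. (g \<in> R) \<noteq> (g + w' \<in> R)})"
      unfolding ch_def by (rule card_Un_le)
    also have "card ((\<lambda>g. g - w) ` {g. (g \<in> R) \<noteq> (g + w' \<in> R)}) \<le> ch w'"
      unfolding ch_def by (rule card_image_le[OF fin'])
    finally show ?thesis by simp
  qed
  have ch0: "ch 0 = 0" by (simp add: ch_def)
  have multi: "ch (axis k (int n)) \<le> n * D" for k n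
  proof (induction n)
    case 0
    have "axis k (int 0) = (0 :: quartic)" by (simp add: vec_eq_iff axis_def)
    then have "ch (axis k (int 0)) = 0" using ch0 by (simp only:)
    then show ?case by simp
  next
    case (Suc n)
    have "axis k (int (Suc n)) = axis k (int n) + (axis k 1 :: quartic)" by (simp add: vec_eq_iff axis_def)
    then have "ch (axis k (int (Suc n))) \<le> ch (axis k (int n)) + ch (axis k 1)" using add by metis
    also have "\<dots> \<le> n * D + D" using Suc D[of k] by (intro add_mono) (simp_all add: ch_def)
    finally show ?case by simp
  qed
  have one: "ch (axis j (v$j)) \<le> m * D" for j
  proof -
    have "ch (axis j (int (nat (v$j)))) \<le> nat (v$j) * D" by (rule multi)
    also have "\<dots> \<le> m * D" using v[of j] by (intro mult_right_mono) auto
    finally show ?thesis using v[of j] by simp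
  qed
  define a where "a j = axis j (v$j)" for j :: 5
  have "v = a 1 + (a 2 + (a 3 + (a 4 + a 5)))"
    by (simp add: vec5_eq_iff axis_def a_def)
  then have "ch v = ch (a 1 + (a 2 + (a 3 + (a 4 + a 5))))" by (rule arg_cong)
  also have "\<dots> \<le> ch (a 1) + ch (a 2) + ch (a 3) + ch (a 4) + ch (a 5)"
    using add[of "a 1" "a 2 + (a 3 + (a 4 + a 5))"] add[of "a 2" "a 3 + (a 4 + a 5)"]
      add[of "a 3" "a 4 + a 5"] add[of "a 4" "a 5"] by linarith
  also have "\<dots> \<le> 5 * m * D" using one[of 1] one[of 2] one[of 3] one[of 4] one[of 5] by (simp add: a_def)
  finally show ?thesis by (simp add: ch_def)
qed

definition residues_mod :: "nat \<Rightarrow> quartic set" where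
  "residues_mod m = {v. \<forall>j. v$j \<in> {0..<int m}}"

lemma finite_residues_mod: "finite (residues_mod m)"
  unfolding residues_mod_def by (rule finite_bounded_vec) simp

definition reduce_mod :: "nat \<Rightarrow> quartic \<Rightarrow> quartic" where
  "reduce_mod m f = (\<chi> j. f$j mod int m)"

lemma reduce_mod_in: "m > 0 \<Longrightarrow> reduce_mod m f \<in> residues_mod m"
  by (simp add: reduce_mod_def residues_mod_def)

lemma residue_count_shift:
  assumes S: "congruence_condition m S" and m: "m > 0"
  shows "card {v \<in> residues_mod m. f + v \<in> S} = card (S \<inter> residues_mod m)"
proof -
  have per: "g \<in> S \<longleftrightarrow> reduce_mod m g \<in> S" for g
    using S unfolding congruence_condition_def by (simp add: reduce_mod_def)
  have "bij_betw (\<lambda>v. reduce_mod m (f + v)) {v \<in> residues_mod m. f + v \<in> S} (S \<inter> residues_mod m)"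
  proof (rule bij_betw_byWitness[where f' = "\<lambda>w. reduce_mod m (w - f)"])
    show "\<forall>v\<in>{v \<in> residues_mod m. f + v \<in> S}. reduce_mod m (reduce_mod m (f + v) - f) = v"
      by (auto simp: reduce_mod_def residues_mod_def vec_eq_iff mod_simps)
    show "\<forall>w\<in>S \<inter> residues_mod m. reduce_mod m (f + reduce_mod m (w - f)) = w"
      by (auto simp: reduce_mod_def residues_mod_def vec_eq_iff mod_simps)
    show "(\<lambda>v. reduce_mod m (f + v)) ` {v \<in> residues_mod m. f + v \<in> S} \<subseteq> S \<inter> residues_mod m"
      using per reduce_mod_in[OF m] by blast
    have "f + reduce_mod m (w - f) \<in> S" if "w \<in> S" "w \<in> residues_mod m" for w
    proof -
      have "reduce_mod m (f + reduce_mod m (w - f)) = w"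
        using that(2) by (auto simp: reduce_mod_def residues_mod_def vec_eq_iff mod_simps)
      then show ?thesis using per that(1) by metis
    qed
    then show "(\<lambda>w. reduce_mod m (w - f)) ` (S \<inter> residues_mod m) \<subseteq> {v \<in> residues_mod m. f + v \<in> S}"
      using reduce_mod_in[OF m] by blast
  qed
  then show ?thesis by (rule bij_betw_same_card)
qed

definition density_mod :: "nat \<Rightarrow> quartic set \<Rightarrow> real" where
  "density_mod m S = card (S \<inter> residues_mod m) / card (residues_mod m)"

text \<open>Summed over all residues v, the number of f in R with f + v in S is exactly
  \<open>card R\<close> times the number of residues in S, because f + v runs through all classes.
  Each summand differs from \<open>card (S \<inter> R)\<close> only by forms whose membership in R
  changes under translation by v.\<close>

lemma equidistribution:
  fixes R :: "quartic set"
  assumes S: "congruence_condition m S" and m: "m > 0"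
    and fin: "finite R" and D: "\<And>k. card {f. (f \<in> R) \<noteq> (f + axis k 1 \<in> R)} \<le> D"
  shows "\<bar>real (card (S \<inter> R)) - density_mod m S * real (card R)\<bar> \<le> 5 * m * D"
proof -
  let ?V = "residues_mod m"
  have "0 \<in> ?V" using m by (simp add: residues_mod_def)
  then have V0: "card ?V > 0" using finite_residues_mod[of m] by (auto simp: card_gt_0_iff)
  have one: "\<bar>real (card {f \<in> R. f + v \<in> S}) - real (card (S \<inter> R))\<bar> \<le> 5 * m * D" if v: "v \<in> ?V" for v
  proof -
    have ch: "card {f. (f \<in> R) \<noteq> (f + v \<in> R)} \<le> 5 * m * D"
      by (rule changes_translate[OF fin D]) (use v in \<open>auto simp: residues_mod_def less_imp_le\<close>)
    define A where "A = {g. g - v \<in> R \<and> g \<in> S}"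
    have "bij_betw (\<lambda>f. f + v) {f \<in> R. f + v \<in> S} A"
      by (rule bij_betw_byWitness[where f' = "\<lambda>g. g - v"]) (auto simp: A_def)
    then have cA: "card {f \<in> R. f + v \<in> S} = card A" by (rule bij_betw_same_card)
    have "A \<subseteq> (\<lambda>f. f + v) ` R" by (auto simp: A_def intro!: image_eqI[of _ _ "_ - v"])
    then have finA: "finite A" using fin by (meson finite_imageI finite_subset)
    define B where "B = S \<inter> R"
    have finB: "finite B" using fin by (simp add: B_def)
    define E where "E = (\<lambda>f. f + v) ` {f. (f \<in> R) \<noteq> (f + v \<in> R)}"
    have finD: "finite {f. (f \<in> R) \<noteq> (f + v \<in> R)}"
      by (rule finite_subset[of _ "R \<union> (\<lambda>g. g - v) ` R"]) (use fin in \<open>auto intro!: image_eqI[of _ _ "_ + v"]\<close>)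
    have finE: "finite E" using finD by (simp add: E_def)
    have cE: "card E \<le> 5 * m * D" unfolding E_def using card_image_le[OF finD] ch order_trans by blast
    have E_iff: "g \<in> E \<longleftrightarrow> (g - v \<in> R) \<noteq> (g \<in> R)" for g
    proof
      assume "(g - v \<in> R) \<noteq> (g \<in> R)"
      then show "g \<in> E" unfolding E_def by (intro image_eqI[of _ _ "g - v"]) simp_all
    qed (auto simp: E_def)
    have "A \<subseteq> B \<union> E" "B \<subseteq> A \<union> E"
      unfolding A_def B_def by (auto simp: E_iff)
    then have "card A \<le> card (B \<union> E)" "card B \<le> card (A \<union> E)" using finA finB finE by (auto intro: card_mono)
    then have "card A \<le> card B + card E" "card B \<le> card A + card E" using card_Un_le order_trans by blast+
    then show ?thesis using cE unfolding cA B_def[symmetric] by linarith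
  qed
  have "(\<Sum>v\<in>?V. card {f \<in> R. f + v \<in> S}) = (\<Sum>v\<in>?V. \<Sum>f\<in>R. if f + v \<in> S then 1 else 0)"
    using fin by (intro sum.cong refl) (simp add: sum.If_cases Int_def)
  also have "\<dots> = (\<Sum>f\<in>R. \<Sum>v\<in>?V. if f + v \<in> S then 1 else 0)" by (rule sum.swap)
  also have "\<dots> = (\<Sum>f\<in>R. card {v \<in> ?V. f + v \<in> S})"
    using finite_residues_mod by (intro sum.cong refl) (simp add: sum.If_cases Int_def)
  also have "\<dots> = card R * card (S \<inter> ?V)" by (simp add: residue_count_shift[OF S m])
  finally have "real (\<Sum>v\<in>?V. card {f \<in> R. f + v \<in> S}) = real (card R * card (S \<inter> ?V))"
    by (rule arg_cong)
  then have tot: "(\<Sum>v\<in>?V. real (card {f \<in> R. f + v \<in> S})) = real (card R) * real (card (S \<inter> ?V))"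
    by (simp only: of_nat_sum of_nat_mult)
  have "\<bar>(\<Sum>v\<in>?V. real (card {f \<in> R. f + v \<in> S}) - real (card (S \<inter> R)))\<bar> \<le> (\<Sum>v\<in>?V. real (5 * m * D))"
    by (rule order_trans[OF sum_abs]) (intro sum_mono, use one in simp)
  then have "\<bar>real (card R) * real (card (S \<inter> ?V)) - real (card ?V) * real (card (S \<inter> R))\<bar> \<le> real (card ?V) * real (5 * m * D)"
    by (simp add: sum_subtractf tot)
  moreover have "real (card R) * real (card (S \<inter> ?V)) - real (card ?V) * real (card (S \<inter> R)) =
    real (card ?V) * (density_mod m S * real (card R) - real (card (S \<inter> R)))"
    using V0 by (simp add: density_mod_def field_simps)
  ultimately have "real (card ?V) * \<bar>density_mod m S * real (card R) - real (card (S \<inter> R))\<bar> \<le> real (card ?V) * real (5 * m * D)"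
    by (simp add: abs_mult)
  then have "\<bar>density_mod m S * real (card R) - real (card (S \<inter> R))\<bar> \<le> real (5 * m * D)"
    using V0 by (simp only: mult_le_cancel_left_pos of_nat_0_less_iff)
  then show ?thesis by (simp add: abs_minus_commute)
qed

section \<open>Tiling the cusp\<close>

lemma region_mono: "D \<subseteq> E \<Longrightarrow> region i X D \<subseteq> region i X E"
  by (auto simp: region_def)

lemma region_Un: "region i X (D \<union> E) = region i X D \<union> region i X E"
  by (auto simp: region_def)

lemma region_disjoint:
  assumes "D \<inter> E = {}"
  shows "region i X D \<inter> region i X E = {}"
  using assms center_unique unfolding region_def by blast

lemma cusp_Im: "L \<ge> 1 \<Longrightarrow> z \<in> cusp L \<Longrightarrow> L / 2 \<le> Im z \<and> \<bar>Re z\<bar> \<le> L / 2"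
proof -
  assume L: "L \<ge> 1" and z: "z \<in> cusp L"
  have u: "\<bar>Re z\<bar> \<le> L / 2" using z by (auto simp: cusp_def abs_le_iff)
  have "L^2 \<le> (cmod z)^2" using z L by (intro power_mono) (auto simp: cusp_def)
  moreover have "\<bar>Re z\<bar>^2 \<le> (L / 2)^2" using u by (intro power_mono) auto
  ultimately have "(L / 2)^2 \<le> (Im z)^2"
    by (simp add: cmod_power2 power_divide) (use zero_le_power2[of L] in linarith)
  then have "L / 2 \<le> Im z" by (rule power2_le_imp_le) (use z in \<open>simp add: cusp_def\<close>)
  then show ?thesis using u by blast
qed

lemma finite_region_cusp:
  assumes "L \<ge> 1" "X \<ge> 1"
  shows "finite (region i X (cusp L))"
  by (rule finite_subset[OF _ finite_center_region[OF assms(2), of i]])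
    (use cusp_Im[OF assms(1)] assms(1) in \<open>force simp: region_def\<close>)

lemma wedge_Im: "L \<ge> 1 \<Longrightarrow> z \<in> wedge L \<Longrightarrow> L / 2 \<le> Im z \<and> \<bar>Re z\<bar> \<le> L"
  using wedge_Im_ge[of L z] by (auto simp: wedge_def)

lemma finite_region_wedge:
  assumes "L \<ge> 1" "X \<ge> 1"
  shows "finite (region i X (wedge L))"
  by (rule finite_subset[OF _ finite_center_region[OF assms(2), of i]])
    (use wedge_Im[OF assms(1)] assms(1) in \<open>force simp: region_def\<close>)

lemma region_cusp_empty:
  assumes L: "L \<ge> 1" and X: "X \<ge> 1" and big: "L^2 > 4 * (400 * X powr (1/6))"
  shows "region i X (cusp L) = {}"
proof (rule ccontr)
  assume "region i X (cusp L) \<noteq> {}"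
  then obtain f z where f: "f$1 \<noteq> 0" "height f < X" and z: "z \<in> cusp L" "center i (real_form f) z"
    by (auto simp: region_def)
  have b: "L / 2 \<le> Im z" "\<bar>Re z\<bar> \<le> L / 2" using cusp_Im[OF L z(1)] by auto
  have "(Im z)^2 \<le> 400 * X powr (1/6)"
    by (rule center_tau_bounds(6)[OF z(2) f(2) X _ _ f(1)]) (use b L in linarith)+
  moreover have "(L/2)^2 \<le> (Im z)^2" using b L by (intro power_mono) auto
  ultimately show False using big by (simp add: power_divide)
qed

definition translate :: "int \<Rightarrow> quartic \<Rightarrow> quartic" where
  "translate n f = quartic_act (mat22 1 0 n 1) f"

lemma translate_GL2Z: "mat22 1 0 n 1 \<in> GL2Z" by (simp add: mat22_GL2Z_iff)

lemma translate_translate: "translate n (translate m f) = translate (n + m) f"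
  by (simp add: translate_def quartic_act_mult mat22_mult)

lemma translate_0: "translate 0 f = f"
  unfolding translate_def using quartic_act_1[of f] by (simp add: mat_1_eq)

lemma translate_leading: "translate n f $ 1 = f $ 1"
proof -
  have "real_of_int (translate n f $ 1) = real_form (translate n f) $ 1" by simp
  also have "\<dots> = real_of_int (f $ 1)" unfolding translate_def real_form_act by (simp add: subst_form_def vector_5)
  finally show ?thesis by simp
qed

lemma center_translate: "center i (real_form f) z \<Longrightarrow> center i (real_form (translate n f)) (z - of_int n)"
  using center_act[of i f z 1 1 0 n] by (simp add: translate_def upper_act_def)

lemma translate_region:
  assumes S: "GL2Z_invariant S" and D: "\<And>z. z \<in> D \<Longrightarrow> z - of_int n \<in> E"
  shows "translate n ` (S \<inter> region i X D) \<subseteq> S \<inter> region i X E"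
proof (rule image_subsetI)
  fix f assume f: "f \<in> S \<inter> region i X D"
  then obtain z where z: "z \<in> D" "center i (real_form f) z" by (auto simp: region_def)
  show "translate n f \<in> S \<inter> region i X E"
    using f S translate_GL2Z[of n] D[OF z(1)] center_translate[OF z(2), of n] translate_leading[of n f]
      height_act[OF translate_GL2Z, of n f]
    by (auto simp: region_def GL2Z_invariant_def translate_def)
qed

text \<open>Pieces of the cusp may be rearranged because integral translations preserve
  \<open>S\<close>, the height and the leading coefficient.\<close>

lemma card_translate_region:
  assumes S: "GL2Z_invariant S" and D: "\<And>z. z \<in> D \<Longrightarrow> z - of_int n \<in> E" and E: "\<And>z. z \<in> E \<Longrightarrow> z + of_int n \<in> D"
  shows "card (S \<inter> region i X D) = card (S \<inter> region i X E)"
proof (rule bij_betw_same_card)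
  show "bij_betw (translate n) (S \<inter> region i X D) (S \<inter> region i X E)"
  proof (rule bij_betw_byWitness[where f' = "translate (- n)"])
    show "translate n ` (S \<inter> region i X D) \<subseteq> S \<inter> region i X E" by (rule translate_region[OF S D])
    show "translate (- n) ` (S \<inter> region i X E) \<subseteq> S \<inter> region i X D"
      by (rule translate_region[OF S]) (use E in simp)
  qed (auto simp: translate_translate translate_0)
qed

text \<open>Two translates of the strip of width \<open>L\<close> tile the strip of width \<open>2 L\<close>, both cut off by the
  circles of radius \<open>L\<close> around the multiples of \<open>L\<close>.\<close>

lemma cusp_doubling:
  fixes n :: int
  assumes S: "GL2Z_invariant S" and L: "L = of_int n" "L \<ge> 1" and X: "X \<ge> 1"
  shows "2 * card (S \<inter> region i X (cusp L)) = card (S \<inter> region i X (wedge L)) + card (S \<inter> region i X (cusp (2 * L)))"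
proof -
  have sq: "L \<le> cmod w \<longleftrightarrow> L^2 \<le> (Re w)^2 + (Im w)^2" for w
    using L(2) by (simp add: cmod_power2[symmetric] power_mono_iff)
  \<comment> \<open>\<open>CL\<close> is decomposed twice: into \<open>cusp L\<close> and two outer
    pieces, which are translates of the halves \<open>cr\<close> and \<open>cl\<close>, and into
    \<open>wedge L\<close> and \<open>cusp (2 * L)\<close>.\<close>
  define CL where "CL = {z. Im z > 0 \<and> - L \<le> Re z \<and> Re z < L \<and> L \<le> cmod z \<and> L \<le> cmod (z - of_real L) \<and> L \<le> cmod (z + of_real L)}"
  define cl where "cl = {z \<in> cusp L. Re z < 0}"
  define cr where "cr = {z \<in> cusp L. Re z \<ge> 0}"
  define ml where "ml = {z \<in> CL. Re z < - (L / 2)}"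
  define mr where "mr = {z \<in> CL. Re z \<ge> L / 2}"
  have near: "L \<le> cmod (z - of_real L) \<and> L \<le> cmod (z + of_real L)" if "L \<le> cmod z" "\<bar>Re z\<bar> \<le> L / 2" for z
  proof -
    have "L * (L - 2 * Re z) \<ge> 0" "L * (L + 2 * Re z) \<ge> 0" using that(2) L(2) by (auto intro!: mult_nonneg_nonneg)
    moreover have "(Re z - L)^2 = (Re z)^2 + L * (L - 2 * Re z)" "(Re z + L)^2 = (Re z)^2 + L * (L + 2 * Re z)" by algebra+
    ultimately show ?thesis using that(1) unfolding sq by simp
  qed
  have cuspD: "\<bar>Re z\<bar> \<le> L / 2 \<and> L \<le> cmod z \<and> Im z > 0" if "z \<in> cusp L" for z using that by (auto simp: cusp_def abs_le_iff)
  have CL1: "CL = cusp L \<union> (ml \<union> mr)"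
  proof
    show "CL \<subseteq> cusp L \<union> (ml \<union> mr)" by (auto simp: CL_def cusp_def ml_def mr_def)
    have "cusp L \<subseteq> CL"
    proof
      fix z assume z: "z \<in> cusp L"
      show "z \<in> CL" using cuspD[OF z] near[of z] L(2) z by (auto simp: CL_def cusp_def)
    qed
    then show "cusp L \<union> (ml \<union> mr) \<subseteq> CL" by (auto simp: ml_def mr_def)
  qed
  have d1: "cusp L \<inter> (ml \<union> mr) = {}" "ml \<inter> mr = {}" using L(2) by (auto simp: cusp_def ml_def mr_def)
  have CL2: "CL = wedge L \<union> cusp (2 * L)"
  proof
    show "CL \<subseteq> wedge L \<union> cusp (2 * L)" by (auto simp: CL_def wedge_def cusp_def)
    have "cusp (2 * L) \<subseteq> CL"
    proof
      fix z assume z: "z \<in> cusp (2 * L)"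
      have "cmod (of_real L :: complex) = L" using L(2) by simp
      then have "2 * L \<le> cmod (z - of_real L) + L" "2 * L \<le> cmod (z + of_real L) + L"
        using z norm_triangle_ineq[of "z - of_real L" "of_real L"] norm_triangle_ineq4[of "z + of_real L" "of_real L"]
        by (auto simp: cusp_def)
      then show "z \<in> CL" using z L(2) by (auto simp: CL_def cusp_def)
    qed
    then show "wedge L \<union> cusp (2 * L) \<subseteq> CL" by (auto simp: CL_def wedge_def)
  qed
  have d2: "wedge L \<inter> cusp (2 * L) = {}" by (auto simp: wedge_def cusp_def)
  have cC: "cusp L = cl \<union> cr" "cl \<inter> cr = {}" by (auto simp: cl_def cr_def)
  have fin: "finite (S \<inter> region i X (cusp L))" "finite (S \<inter> region i X (wedge L))" "finite (S \<inter> region i X (cusp (2 * L)))"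
    using finite_region_cusp[of L X i] finite_region_wedge[of L X i] finite_region_cusp[of "2 * L" X i] L X by auto
  then have finCL: "finite (S \<inter> region i X CL)" unfolding CL2 region_Un by (simp add: Int_Un_distrib)
  have split: "card (S \<inter> region i X (D \<union> E)) = card (S \<inter> region i X D) + card (S \<inter> region i X E)"
    if "D \<inter> E = {}" "D \<union> E \<subseteq> CL" for D E
  proof -
    have "finite (S \<inter> region i X (D \<union> E))" using finCL region_mono[OF that(2)] by (meson finite_subset Int_mono order_refl)
    then show ?thesis using region_disjoint[OF that(1), of i X]
      unfolding region_Un Int_Un_distrib by (intro card_Un_disjoint) auto
  qed
  have r: "card (S \<inter> region i X mr) = card (S \<inter> region i X cl)"
  proof (rule card_translate_region[OF S, of _ n])
    show "z - of_int n \<in> cl" if "z \<in> mr" for z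
      using that L by (auto simp: mr_def CL_def cl_def cusp_def)
    show "z + of_int n \<in> mr" if z: "z \<in> cl" for z
    proof -
      have c: "\<bar>Re z\<bar> \<le> L / 2" "L \<le> cmod z" "Im z > 0" "Re z < 0" "- (L/2) \<le> Re z"
        using z by (auto simp: cl_def cusp_def abs_le_iff)
      have "(Re z)^2 \<le> (Re z + 2 * L)^2"
      proof -
        have "4 * L * (Re z + L) \<ge> 0" using c L(2) by (intro mult_nonneg_nonneg) auto
        moreover have "(Re z + 2 * L)^2 = (Re z)^2 + 4 * L * (Re z + L)" by algebra
        ultimately show ?thesis by simp
      qed
      then have "L \<le> cmod (z + of_real L + of_real L)" using c(2) unfolding sq by (simp add: add.assoc)
      then show ?thesis using c near[OF c(2,1)] L by (auto simp: mr_def CL_def)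
    qed
  qed
  have l: "card (S \<inter> region i X ml) = card (S \<inter> region i X cr)"
  proof (rule card_translate_region[OF S, of _ "- n"])
    show "z - of_int (- n) \<in> cr" if "z \<in> ml" for z
      using that L by (auto simp: ml_def CL_def cr_def cusp_def)
    show "z + of_int (- n) \<in> ml" if z: "z \<in> cr" for z
    proof -
      have c: "\<bar>Re z\<bar> \<le> L / 2" "L \<le> cmod z" "Im z > 0" "Re z \<ge> 0" "Re z < L / 2"
        using z by (auto simp: cr_def cusp_def)
      have "(Re z)^2 \<le> (Re z - 2 * L)^2"
      proof -
        have "4 * L * (L - Re z) \<ge> 0" using c L(2) by (intro mult_nonneg_nonneg) auto
        moreover have "(Re z - 2 * L)^2 = (Re z)^2 + 4 * L * (L - Re z)" by algebra
        ultimately show ?thesis by simp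
      qed
      then have "L \<le> cmod (z - of_real L - of_real L)" using c(2) unfolding sq by (simp add: algebra_simps)
      then show ?thesis using c near[OF c(2,1)] L by (auto simp: ml_def CL_def)
    qed
  qed
  have "card (S \<inter> region i X CL) = card (S \<inter> region i X (cusp L)) + (card (S \<inter> region i X ml) + card (S \<inter> region i X mr))"
    using split[of "cusp L" "ml \<union> mr"] split[of ml mr] d1 CL1 by auto
  moreover have "card (S \<inter> region i X (cusp L)) = card (S \<inter> region i X cl) + card (S \<inter> region i X cr)"
    using split[of cl cr] cC CL1 by auto
  moreover have "card (S \<inter> region i X CL) = card (S \<inter> region i X (wedge L)) + card (S \<inter> region i X (cusp (2 * L)))"
    using split[OF d2] CL2 by simp
  ultimately show ?thesis using l r by linarith
qed

text \<open>Iterated doubling. The weights are what the averaging gains: an error of order L^2 at L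
  = 2^j contributes only order L.\<close>

lemma cusp_layers:
  assumes S: "GL2Z_invariant S" and X: "X \<ge> 1"
  shows "real (card (S \<inter> region i X (cusp 1))) =
    (\<Sum>j<J. real (card (S \<inter> region i X (wedge (2^j)))) / 2^Suc j) + real (card (S \<inter> region i X (cusp (2^J)))) / 2^J"
proof (induction J)
  case 0
  show ?case by simp
next
  case (Suc J)
  have e: "(2::real)^J = of_int (2^J)" by simp
  have "2 * card (S \<inter> region i X (cusp (2^J))) =
      card (S \<inter> region i X (wedge (2^J))) + card (S \<inter> region i X (cusp (2 * 2^J)))"
    by (rule cusp_doubling[OF S e _ X]) (simp add: one_le_power)
  then have "2 * real (card (S \<inter> region i X (cusp (2^J)))) =
      real (card (S \<inter> region i X (wedge (2^J)))) + real (card (S \<inter> region i X (cusp (2^Suc J))))"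
    by (simp flip: of_nat_add)
  then have "real (card (S \<inter> region i X (cusp (2^J)))) / 2^J =
      real (card (S \<inter> region i X (wedge (2^J)))) / 2^Suc J + real (card (S \<inter> region i X (cusp (2^Suc J)))) / 2^Suc J"
    by (simp add: field_simps)
  then show ?case using Suc by simp
qed

text \<open>Layer j has error O(X^(2/3) 4^j) and weight 2^(-j-1), and the layers end at the first J
  with 4^J > 4 K, where the remaining region is empty. The geometric sum is O(2^J) = O(X^(1/12)),
  and 2/3 + 1/12 = 3/4.\<close>

lemma region_equidistribution:
  assumes S: "GL2Z_invariant S" and c: "congruence_condition m S" and m: "m > 0"
  shows "\<exists>C. \<forall>X\<ge>1. \<bar>real (card (S \<inter> region i X (cusp 1))) - density_mod m S * real (card (region i X (cusp 1)))\<bar>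
    \<le> C * X powr (3/4)"
proof -
  define C0 where "C0 = 5 * m * (198 * face_const + 1)"
  have C0: "C0 \<ge> 0" by (simp add: C0_def face_const_def)
  have "\<bar>real (card (S \<inter> region i X (cusp 1))) - density_mod m S * real (card (region i X (cusp 1)))\<bar>
    \<le> 80 * C0 * X powr (3/4)" if X: "X \<ge> 1" for X
  proof -
    define K where "K = 400 * X powr (1/6)"
    have K: "K \<ge> 400" using X by (simp add: K_def ge_one_powr_ge_zero)
    define bad where "bad j \<longleftrightarrow> (2^j)^2 > 4 * K" for j :: nat
    have "\<exists>j. bad j"
    proof -
      obtain j where "4 * K < (2::real)^j" using real_arch_pow[of 2 "4 * K"] by auto
      moreover have "(2::real)^j \<le> (2^j)^2" by (simp add: power2_eq_square one_le_power)
      ultimately show ?thesis unfolding bad_def by (meson less_le_trans)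
    qed
    define J where "J = (LEAST j. bad j)"
    have bJ: "bad J" unfolding J_def using \<open>\<exists>j. bad j\<close> by (rule LeastI_ex)
    have nb: "(2^j)^2 \<le> 4 * K" if "j < J" for j using not_less_Least[OF that[unfolded J_def]] by (simp add: bad_def)
    \<comment> \<open>Since 4 K = 1600 X^(1/6), the last power that is not bad is at most 40
      X^(1/12), and J is one step further.\<close>
    have J2: "(2::real)^J \<le> 80 * X powr (1/12)"
    proof (cases J)
      case 0
      then show ?thesis using X ge_one_powr_ge_zero[of X "1/12"] by simp
    next
      case (Suc j)
      have "((2::real)^j)^2 \<le> (40 * X powr (1/12))^2"
        using nb[of j] Suc X by (simp add: K_def power_mult_distrib powr_power)
      then have "(2::real)^j \<le> 40 * X powr (1/12)" by (rule power2_le_imp_le) simp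
      then show ?thesis using Suc by simp
    qed
    have empty: "region i X (cusp (2^J)) = {}"
      by (rule region_cusp_empty) (use bJ X in \<open>simp_all add: bad_def K_def one_le_power\<close>)
    have inv: "GL2Z_invariant (UNIV :: quartic set)" by (simp add: GL2Z_invariant_def)
    define \<delta> where "\<delta> = density_mod m S"
    let ?E = "\<lambda>j. real (card (S \<inter> region i X (wedge (2^j))))"
    let ?U = "\<lambda>j. real (card (region i X (wedge (2^j))))"
    have layer: "\<bar>?E j - \<delta> * ?U j\<bar> \<le> C0 * X powr (2/3) * 4^j" for j
    proof -
      have L: "(1::real) \<le> 2^j" by (simp add: one_le_power)
      define r where "r = 198 * face_const * X powr (2/3) * (2^j)^2"
      have r0: "r \<ge> 0" by (simp add: r_def face_const_def)
      have D: "card {f. (f \<in> region i X (wedge (2^j))) \<noteq> (f + axis k 1 \<in> region i X (wedge (2^j)))} \<le> nat \<lfloor>r\<rfloor>" for k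
        using region_changes[OF L X, of i k] unfolding r_def[symmetric] by (simp add: le_nat_floor)
      have "\<bar>?E j - \<delta> * ?U j\<bar> \<le> real (5 * m * nat \<lfloor>r\<rfloor>)"
        unfolding \<delta>_def by (rule equidistribution[OF c m finite_region_wedge[OF L X] D])
      also have "\<dots> \<le> 5 * m * r" using r0 by (simp add: mult_left_mono)
      also have "\<dots> \<le> C0 * X powr (2/3) * 4^j"
      proof -
        have "((2::real)^j)^2 = 4^j" by (simp add: power2_eq_square flip: power_mult_distrib)
        then have "5 * m * r = 5 * m * (198 * face_const) * (X powr (2/3) * 4^j)" by (simp add: r_def mult_ac)
        also have "\<dots> \<le> C0 * (X powr (2/3) * 4^j)"
          unfolding C0_def by (intro mult_right_mono mult_left_mono) auto
        finally show ?thesis by (simp add: mult.assoc)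
      qed
      finally show ?thesis .
    qed
    have "real (card (S \<inter> region i X (cusp 1))) - \<delta> * real (card (region i X (cusp 1)))
       = (\<Sum>j<J. (?E j - \<delta> * ?U j) / 2^Suc j)"
      using cusp_layers[OF S X, of i J] cusp_layers[OF inv X, of i J] empty
      by (simp add: sum_distrib_left diff_divide_distrib sum_subtractf)
    also have "\<bar>\<dots>\<bar> \<le> (\<Sum>j<J. \<bar>(?E j - \<delta> * ?U j) / 2^Suc j\<bar>)" by (rule sum_abs)
    also have "\<dots> \<le> (\<Sum>j<J. C0 * X powr (2/3) * 2^j)"
    proof (rule sum_mono)
      fix j
      have "\<bar>(?E j - \<delta> * ?U j) / 2^Suc j\<bar> = \<bar>?E j - \<delta> * ?U j\<bar> / 2^Suc j" by (simp add: abs_divide)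
      also have "\<dots> \<le> C0 * X powr (2/3) * 4^j / 2^Suc j" by (intro divide_right_mono layer) simp
      also have "\<dots> \<le> C0 * X powr (2/3) * 2^j"
      proof -
        have "(4::real)^j = 2^j * 2^j" by (simp flip: power_mult_distrib)
        then have "C0 * X powr (2/3) * 4^j / 2^Suc j = C0 * X powr (2/3) * 2^j / 2" by (simp add: field_simps)
        moreover have "C0 * X powr (2/3) * 2^j \<ge> 0" using C0 by simp
        ultimately show ?thesis by linarith
      qed
      finally show "\<bar>(?E j - \<delta> * ?U j) / 2^Suc j\<bar> \<le> C0 * X powr (2/3) * 2^j" .
    qed
    also have "\<dots> = C0 * X powr (2/3) * (\<Sum>j<J. 2^j)" by (simp add: sum_distrib_left)
    also have "\<dots> \<le> C0 * X powr (2/3) * (80 * X powr (1/12))"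
    proof (rule mult_left_mono)
      have "(\<Sum>j<J. (2::real)^j) = 2^J - 1" by (induction J) simp_all
      then show "(\<Sum>j<J. (2::real)^j) \<le> 80 * X powr (1/12)" using J2 by linarith
    qed (use C0 in simp)
    also have "\<dots> = 80 * C0 * X powr (3/4)" using X by (simp flip: powr_add)
    finally show ?thesis by (simp add: \<delta>_def)
  qed
  then show ?thesis by blast
qed

section \<open>Local densities\<close>

lemma congruence_condition_dvd:
  assumes "congruence_condition m S" "m dvd n"
  shows "congruence_condition n S"
  unfolding congruence_condition_def
proof (intro allI impI)
  fix f g :: quartic
  assume e: "\<forall>j. f$j mod int n = g$j mod int n"
  have "f$j mod int m = g$j mod int m" for j
    using e assms(2) by (metis int_dvd_int_iff mod_mod_cancel)
  then show "f \<in> S \<longleftrightarrow> g \<in> S" using assms(1) unfolding congruence_condition_def by blast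
qed

lemma congruence_condition_Inter:
  assumes "\<And>C. C \<in> \<C> \<Longrightarrow> congruence_condition m C"
  shows "congruence_condition m (\<Inter>\<C>)"
  using assms unfolding congruence_condition_def by (meson InterI InterE)

lemma card_residues_mod: "card (residues_mod m) = m ^ 5"
proof -
  have "bij_betw (\<lambda>v j. v$j) (residues_mod m) (PiE UNIV (\<lambda>_ :: 5. {0..<int m}))"
    by (rule bij_betw_byWitness[where f' = "\<lambda>h. \<chi> j. h j"]) (auto simp: residues_mod_def)
  then have "card (residues_mod m) = card (PiE UNIV (\<lambda>_ :: 5. {0..<int m}))" by (rule bij_betw_same_card)
  then show ?thesis by (simp add: card_PiE)
qed

lemma reduce_mod_condition:
  "congruence_condition m S \<Longrightarrow> reduce_mod m f \<in> S \<longleftrightarrow> f \<in> S"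
  unfolding congruence_condition_def by (simp add: reduce_mod_def)

text \<open>The Chinese remainder theorem: residues modulo m n correspond to pairs of residues, and
  the two conditions concern different components.\<close>

lemma density_mod_mult:
  assumes A: "congruence_condition m A" and B: "congruence_condition n B"
    and cop: "coprime m n" and pos: "m > 0" "n > 0"
  shows "density_mod (m * n) (A \<inter> B) = density_mod m A * density_mod n B"
proof -
  let ?h = "\<lambda>f. (reduce_mod m f, reduce_mod n f)"
  let ?R = "residues_mod (m * n)" let ?T = "residues_mod m \<times> residues_mod n"
  have inj: "inj_on ?h ?R"
  proof (rule inj_onI)
    fix f g assume fg: "f \<in> ?R" "g \<in> ?R" "?h f = ?h g"
    have "f$j = g$j" for j
    proof -
      have "int m dvd f$j - g$j" "int n dvd f$j - g$j"
        using fg(3) by (auto simp: reduce_mod_def vec_eq_iff mod_eq_dvd_iff)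
      moreover have "coprime (int m) (int n)" using cop by simp
      ultimately have "int m * int n dvd f$j - g$j" by (rule divides_mult)
      then have "f$j mod int (m * n) = g$j mod int (m * n)" by (simp add: mod_eq_dvd_iff)
      then show ?thesis using fg(1,2) by (simp add: residues_mod_def del: of_nat_mult)
    qed
    then show "f = g" by (simp add: vec_eq_iff)
  qed
  have fin: "finite ?T" by (simp add: finite_residues_mod)
  have sub: "?h ` ?R \<subseteq> ?T" using reduce_mod_in pos by blast
  have "card (?h ` ?R) = card ?T"
    using inj by (simp add: card_image card_residues_mod card_cartesian_product power_mult_distrib)
  then have im: "?h ` ?R = ?T" using card_subset_eq[OF fin sub] by blast
  have "?h ` ((A \<inter> B) \<inter> ?R) = (A \<inter> residues_mod m) \<times> (B \<inter> residues_mod n)"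
  proof
    show "?h ` ((A \<inter> B) \<inter> ?R) \<subseteq> (A \<inter> residues_mod m) \<times> (B \<inter> residues_mod n)"
      using reduce_mod_in pos reduce_mod_condition[OF A] reduce_mod_condition[OF B] by auto
    show "(A \<inter> residues_mod m) \<times> (B \<inter> residues_mod n) \<subseteq> ?h ` ((A \<inter> B) \<inter> ?R)"
    proof
      fix x assume x: "x \<in> (A \<inter> residues_mod m) \<times> (B \<inter> residues_mod n)"
      then have "x \<in> ?h ` ?R" unfolding im by auto
      then obtain f where f: "f \<in> ?R" "x = ?h f" by blast
      then have "f \<in> A \<inter> B" using x reduce_mod_condition[OF A] reduce_mod_condition[OF B] by auto
      then show "x \<in> ?h ` ((A \<inter> B) \<inter> ?R)" using f by blast
    qed
  qed
  moreover have "inj_on ?h ((A \<inter> B) \<inter> ?R)" using inj by (rule inj_on_subset) blast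
  ultimately have "card ((A \<inter> B) \<inter> ?R) = card (A \<inter> residues_mod m) * card (B \<inter> residues_mod n)"
    using card_image[of ?h "(A \<inter> B) \<inter> ?R"] by (simp add: card_cartesian_product)
  then show ?thesis by (simp add: density_mod_def card_residues_mod power_mult_distrib)
qed

lemma density_mod_UNIV: "m > 0 \<Longrightarrow> density_mod m UNIV = 1"
  by (simp add: density_mod_def card_residues_mod)

lemma density_mod_prod:
  fixes q :: "nat \<Rightarrow> nat" and T :: "nat \<Rightarrow> quartic set"
  assumes "finite P" "\<And>p. p \<in> P \<Longrightarrow> congruence_condition (q p) (T p)" "\<And>p. p \<in> P \<Longrightarrow> q p > 0"
    "\<And>p p'. p \<in> P \<Longrightarrow> p' \<in> P \<Longrightarrow> p \<noteq> p' \<Longrightarrow> coprime (q p) (q p')"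
  shows "congruence_condition (\<Prod>p\<in>P. q p) (\<Inter>p\<in>P. T p) \<and>
     density_mod (\<Prod>p\<in>P. q p) (\<Inter>p\<in>P. T p) = (\<Prod>p\<in>P. density_mod (q p) (T p))"
  using assms
proof (induction P rule: finite_induct)
  case empty
  then show ?case by (simp add: congruence_condition_def density_mod_UNIV)
next
  case (insert p P)
  let ?m = "\<Prod>p\<in>P. q p" let ?A = "\<Inter>p\<in>P. T p"
  have IH: "congruence_condition ?m ?A" "density_mod ?m ?A = (\<Prod>p\<in>P. density_mod (q p) (T p))"
    using insert by auto
  have cop: "coprime (q p) ?m" by (rule prod_coprime_right) (use insert in auto)
  have pos: "q p > 0" "?m > 0" using insert by (auto intro: prod_pos)
  have cp: "congruence_condition (q p) (T p)" using insert by simp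
  have "congruence_condition (q p * ?m) (\<Inter>{T p, ?A})"
    by (rule congruence_condition_Inter)
      (use congruence_condition_dvd[OF cp, of "q p * ?m"] congruence_condition_dvd[OF IH(1), of "q p * ?m"] in auto)
  then have "congruence_condition (q p * ?m) (T p \<inter> ?A)" by simp
  moreover have "density_mod (q p * ?m) (T p \<inter> ?A) = density_mod (q p) (T p) * density_mod ?m ?A"
    by (rule density_mod_mult[OF cp IH(1) cop pos])
  ultimately show ?case using insert(1,2) IH by simp
qed

section \<open>Closures and Haar measure at a prime\<close>

lemma V_Zp_of_int_in: "p > 0 \<Longrightarrow> V_Zp_of_int p f \<in> V_Zp p"
  by (simp add: V_Zp_iff V_Zp_of_int_def padic_of_int_def mod_mod_pow del: power_Suc)

lemma V_Zp_of_int_level: "(V_Zp_of_int p f $ j) n = f$j mod int p ^ n"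
  by (simp add: V_Zp_of_int_def padic_of_int_def)

lemma crt_int:
  fixes a b m n :: int
  assumes "coprime m n"
  shows "\<exists>x. x mod m = a mod m \<and> x mod n = b mod n"
proof -
  obtain u w where uw: "u * m + w * n = 1" using bezout_int[of m n] assms by auto
  let ?x = "a * w * n + b * u * m"
  have "?x - a = m * (u * (b - a))" "?x - b = n * (w * (a - b))" using uw by algebra+
  then have "m dvd ?x - a" "n dvd ?x - b" by (metis dvd_triv_left)+
  then have "?x mod m = a mod m \<and> ?x mod n = b mod n" unfolding mod_eq_dvd_iff by blast
  then show ?thesis by blast
qed

text \<open>Conditions prime to p are invisible in the closure: by the Chinese remainder theorem a
  form that is p-adically close to v can also be chosen congruent modulo M to a given element of A,
  which \<open>ne\<close> provides. The condition T survives in the closure because it depends on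
  level K only.\<close>

lemma closure_of_congruence:
  assumes p: "p > 0" and T: "congruence_condition (p ^ K) T" and A: "congruence_condition M A"
    and cop: "coprime p M" and ne: "T \<inter> A \<noteq> {}"
  shows "top_of_set (V_Zp p) closure_of (V_Zp_of_int p ` (T \<inter> A)) = {v \<in> V_Zp p. (\<chi> j. (v$j) K) \<in> T}"
proof (intro equalityI subsetI)
  fix v assume v: "v \<in> top_of_set (V_Zp p) closure_of (V_Zp_of_int p ` (T \<inter> A))"
  then have vZ: "v \<in> V_Zp p" by (simp add: in_closure_of)
  define W where "W = V_Zp p \<inter> {u. \<forall>j. (u$j) K = (v$j) K}"
  have "openin (top_of_set (V_Zp p)) W"
    unfolding W_def by (rule openin_open_Int[OF open_level[OF p]])
  moreover have "v \<in> W" using vZ by (simp add: W_def)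
  moreover have "\<forall>W. v \<in> W \<and> openin (top_of_set (V_Zp p)) W \<longrightarrow> (\<exists>y. y \<in> V_Zp_of_int p ` (T \<inter> A) \<and> y \<in> W)"
    using v unfolding in_closure_of by (rule conjunct2)
  ultimately obtain y where "y \<in> V_Zp_of_int p ` (T \<inter> A)" "y \<in> W" by blast
  then obtain f where f: "f \<in> T" "\<And>j. f$j mod int p ^ K = (v$j) K" by (auto simp: V_Zp_of_int_level W_def)
  have "(\<chi> j. (v$j) K) = reduce_mod (p ^ K) f" by (simp add: reduce_mod_def f(2))
  then show "v \<in> {v \<in> V_Zp p. (\<chi> j. (v$j) K) \<in> T}" using vZ f(1) reduce_mod_condition[OF T] by simp
next
  fix v assume "v \<in> {v \<in> V_Zp p. (\<chi> j. (v$j) K) \<in> T}"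
  then have vZ: "v \<in> V_Zp p" and vT: "(\<chi> j. (v$j) K) \<in> T" by auto
  obtain f0 where f0: "f0 \<in> T \<inter> A" using ne by blast
  show "v \<in> top_of_set (V_Zp p) closure_of (V_Zp_of_int p ` (T \<inter> A))"
    unfolding in_closure_of
  proof (intro conjI allI impI)
    show "v \<in> topspace (top_of_set (V_Zp p))" using vZ by simp
    fix W assume W: "v \<in> W \<and> openin (top_of_set (V_Zp p)) W"
    then obtain U where U: "open U" "W = V_Zp p \<inter> U" by (auto simp: openin_open)
    then obtain n where n: "pball p n v \<subseteq> U" using open_pball[OF p U(1)] W vZ by blast
    \<comment> \<open>Fine enough both for the neighbourhood and for the condition T.\<close>
    define N where "N = max n K"
    have "coprime (int p ^ N) (int M)" using cop by simp
    then have "\<forall>j. \<exists>x. x mod int p ^ N = (v$j) N mod int p ^ N \<and> x mod int M = f0$j mod int M" using crt_int by blast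
    then obtain x where x: "\<And>j. x j mod int p ^ N = (v$j) N mod int p ^ N" "\<And>j. x j mod int M = f0$j mod int M" by metis
    define f :: quartic where "f = (\<chi> j. x j)"
    have lev: "f$j mod int p ^ k = (v$j) k" if "k \<le> N" for j k
    proof -
      have "f$j mod int p ^ k = f$j mod int p ^ N mod int p ^ k"
        using that by (simp add: mod_mod_cancel le_imp_power_dvd)
      also have "\<dots> = (v$j) N mod int p ^ k"
        using x(1)[of j] that by (simp add: f_def mod_mod_cancel le_imp_power_dvd)
      also have "\<dots> = (v$j) k" by (rule V_Zp_mod[OF vZ that])
      finally show ?thesis .
    qed
    have "(\<chi> j. (v$j) K) = reduce_mod (p ^ K) f" using lev[of K] by (simp add: reduce_mod_def N_def)
    then have "f \<in> T" using vT reduce_mod_condition[OF T] by simp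
    moreover have "f \<in> A"
      using A f0 x(2) unfolding congruence_condition_def by (metis IntD2 f_def vec_lambda_beta)
    moreover have "V_Zp_of_int p f \<in> pball p n v"
      using V_Zp_of_int_in[OF p] lev[of n] by (simp add: pball_def V_Zp_of_int_level N_def)
    ultimately show "\<exists>y. y \<in> V_Zp_of_int p ` (T \<inter> A) \<and> y \<in> W"
      using n U(2) V_Zp_of_int_in[OF p] by blast
  qed
qed

text \<open>The set is a disjoint union of balls of level K, one for each residue in T, and
  translation invariance gives all these balls the same measure.\<close>

lemma measure_haar_level:
  assumes p: "p > 0"
  shows "measure (haar p) {v \<in> V_Zp p. (\<chi> j. (v$j) K) \<in> T} = density_mod (p ^ K) T"
proof -
  let ?M = "haar p" let ?R = "residues_mod (p ^ K)"
  define B where "B w = pball p K (V_Zp_of_int p w)" for w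
  have M: "is_normalized_haar p ?M" by (rule haar_normalized[OF p])
  then have sM: "sets ?M = sets (restrict_space borel (V_Zp p))" and one: "emeasure ?M (V_Zp p) = 1"
    by (auto simp: is_normalized_haar_def)
  have Bsets: "B w \<in> sets ?M" for w using pball_measurable[OF p] sM by (simp add: B_def)
  define c where "c = (1 :: ennreal) / of_nat (card (pball p K ` V_Zp p))"
  have Bc: "emeasure ?M (B w) = c" for w
    unfolding B_def c_def by (rule haar_pball[OF p M V_Zp_of_int_in[OF p]])
  have Bv: "v \<in> B w \<longleftrightarrow> v \<in> V_Zp p \<and> (\<chi> j. (v$j) K) = w" if "w \<in> ?R" for v w
    using that by (auto simp: B_def pball_def V_Zp_of_int_level residues_mod_def vec_eq_iff)
  have inR: "(\<chi> j. (v$j) K) \<in> ?R" if "v \<in> V_Zp p" for v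
    using that by (simp add: residues_mod_def V_Zp_iff)
  have W: "{v \<in> V_Zp p. (\<chi> j. (v$j) K) \<in> T} = (\<Union>w\<in>T \<inter> ?R. B w)" for T
    using inR Bv by auto
  have em: "emeasure ?M {v \<in> V_Zp p. (\<chi> j. (v$j) K) \<in> T} = of_nat (card (T \<inter> ?R)) * c" for T
  proof -
    have "emeasure ?M (\<Union>w\<in>T \<inter> ?R. B w) = (\<Sum>w\<in>T \<inter> ?R. emeasure ?M (B w))"
    proof (rule sum_emeasure[symmetric])
      show "B ` (T \<inter> ?R) \<subseteq> sets ?M" using Bsets by blast
      show "disjoint_family_on B (T \<inter> ?R)" using Bv by (auto simp: disjoint_family_on_def)
      show "finite (T \<inter> ?R)" by (simp add: finite_residues_mod)
    qed
    then show ?thesis unfolding W by (simp add: Bc)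
  qed
  have "1 = of_nat (card ?R) * c" using em[of UNIV] one by simp
  moreover have "card ?R \<noteq> 0" using p by (simp add: card_residues_mod)
  then have "of_nat (card ?R) \<noteq> (0 :: ennreal)" by simp
  ultimately have c: "c = 1 / of_nat (card ?R)"
    by (metis ennreal_mult_divide_eq ennreal_of_nat_neq_top mult.commute)
  have "emeasure ?M {v \<in> V_Zp p. (\<chi> j. (v$j) K) \<in> T} = ennreal (density_mod (p ^ K) T)"
    unfolding em c density_mod_def using \<open>card ?R \<noteq> 0\<close>
    by (simp add: ennreal_of_nat_eq_real_of_nat divide_ennreal flip: ennreal_1 ennreal_mult)
  then show ?thesis by (simp add: measure_def density_mod_def)
qed

text \<open>Grouped by primes, the conditions are sets \<open>T p\<close> for finitely many p. The
  density modulo m factors accordingly, and at all other primes the local density is 1, so the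
  partial products are eventually constant. The empty set is treated separately: its closure is
  empty at every prime, even where \<open>T p\<close> is not.\<close>

lemma prod_local_densities_eq:
  assumes "finitely_many_congruence_conditions S"
  shows "\<exists>m>0. congruence_condition m S \<and> prod_local_densities S = density_mod m S"
proof (cases "S = {}")
  case True
  have "local_density p {} = 0" for p by (simp add: local_density_def)
  \<comment> \<open>The factor at the prime 2 already vanishes.\<close>
  then have "(\<Prod>p | prime p \<and> p \<le> n. local_density p {}) = 0" if "n \<ge> 2" for n :: nat
    using that by (intro prod_zero bexI[of _ 2]) auto
  then have "(\<lambda>n. \<Prod>p | prime p \<and> p \<le> n. local_density p {}) \<longlonglongrightarrow> 0"
    by (intro tendsto_eventually) (auto simp: eventually_sequentially)
  then have "prod_local_densities S = 0" unfolding prod_local_densities_def True by (rule limI)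
  then show ?thesis using True by (intro exI[of _ 1]) (simp add: congruence_condition_def density_mod_def)
next
  case False
  obtain \<C> where \<C>: "finite \<C>" "\<And>C. C \<in> \<C> \<Longrightarrow> \<exists>p k. prime p \<and> congruence_condition (p ^ k) C" "S = \<Inter>\<C>"
    using assms unfolding finitely_many_congruence_conditions_def by blast
  then have "\<forall>C\<in>\<C>. \<exists>x. prime (fst x) \<and> congruence_condition (fst x ^ snd x) C" by fastforce
  then obtain x where x: "\<And>C. C \<in> \<C> \<Longrightarrow> prime (fst (x C)) \<and> congruence_condition (fst (x C) ^ snd (x C)) C"
    by (metis (no_types) bchoice)
  define pr where "pr C = fst (x C)" for C
  define P where "P = pr ` \<C>"
  \<comment> \<open>The sum serves as a common bound for the finitely many exponents.\<close>
  define K where "K = (\<Sum>C\<in>\<C>. snd (x C))"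
  define T where "T p = \<Inter>{C \<in> \<C>. pr C = p}" for p
  have finP: "finite P" using \<C>(1) by (simp add: P_def)
  have prP: "prime p" if "p \<in> P" for p using that x by (auto simp: P_def pr_def)
  have cT: "congruence_condition (p ^ K) (T p)" for p
    unfolding T_def
  proof (rule congruence_condition_Inter)
    fix C assume C: "C \<in> {C \<in> \<C>. pr C = p}"
    have "snd (x C) \<le> K" unfolding K_def by (rule member_le_sum) (use C \<C>(1) in auto)
    then have "p ^ snd (x C) dvd p ^ K" by (rule le_imp_power_dvd)
    moreover have "congruence_condition (p ^ snd (x C)) C" using x[of C] C by (auto simp: pr_def)
    ultimately show "congruence_condition (p ^ K) C" using congruence_condition_dvd by blast
  qed
  have ST: "S = (\<Inter>p\<in>P. T p)" unfolding \<C>(3) T_def P_def by auto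
  have T1: "T p = UNIV" if "p \<notin> P" for p using that by (auto simp: T_def P_def)
  have cop: "coprime (p ^ K) (p' ^ K)" if "prime p" "prime p'" "p \<noteq> p'" for p p' :: nat
    using primes_coprime[OF that] by simp
  have pos: "p ^ K > 0" if "prime p" for p :: nat using prime_gt_0_nat[OF that] by simp
  define m where "m = (\<Prod>p\<in>P. p ^ K)"
  have main: "congruence_condition m S" "density_mod m S = (\<Prod>p\<in>P. density_mod (p ^ K) (T p))"
    using density_mod_prod[of P "\<lambda>p. p ^ K" T] finP cT prP cop pos unfolding m_def ST by auto
  have m0: "m > 0" unfolding m_def by (rule prod_pos) (use pos prP in blast)
  have loc: "local_density p S = density_mod (p ^ K) (T p)" if p: "prime p" for p
  proof -
    let ?Q = "P - {p}"
    define M where "M = (\<Prod>p\<in>?Q. p ^ K)"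
    define A where "A = (\<Inter>p\<in>?Q. T p)"
    have A: "congruence_condition M A"
      using density_mod_prod[of ?Q "\<lambda>p. p ^ K" T] finP cT prP cop pos unfolding M_def A_def by auto
    have "coprime p M" unfolding M_def
      by (rule prod_coprime_right) (use primes_coprime[OF p] prP in auto)
    moreover have S: "S = T p \<inter> A"
    proof (cases "p \<in> P")
      case True then show ?thesis unfolding ST A_def by blast
    next
      case n: False then show ?thesis unfolding ST A_def using T1[OF n] by auto
    qed
    ultimately have "top_of_set (V_Zp p) closure_of (V_Zp_of_int p ` S) = {v \<in> V_Zp p. (\<chi> j. (v$j) K) \<in> T p}"
      using closure_of_congruence[OF prime_gt_0_nat[OF p] cT A] False by simp
    then show ?thesis
      unfolding local_density_def using measure_haar_level[OF prime_gt_0_nat[OF p]] by simp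
  qed
  have "(\<Prod>p | prime p \<and> p \<le> n. local_density p S) = density_mod m S" if n: "n \<ge> Max (insert 0 P)" for n
  proof -
    have sub: "P \<subseteq> {p. prime p \<and> p \<le> n}" using prP n finP by auto
    have "(\<Prod>p | prime p \<and> p \<le> n. local_density p S) = (\<Prod>p\<in>P. local_density p S)"
    proof (rule prod.mono_neutral_right[OF _ sub])
      show "\<forall>p\<in>{p. prime p \<and> p \<le> n} - P. local_density p S = 1"
        using loc T1 pos by (auto simp: density_mod_UNIV)
    qed simp
    also have "\<dots> = density_mod m S" unfolding main(2) using loc prP by simp
    finally show ?thesis .
  qed
  then have "(\<lambda>n. \<Prod>p | prime p \<and> p \<le> n. local_density p S) \<longlonglongrightarrow> density_mod m S"
    by (intro tendsto_eventually) (auto simp: eventually_sequentially)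
  then have "prod_local_densities S = density_mod m S" unfolding prod_local_densities_def by (rule limI)
  then show ?thesis using main(1) m0 by blast
qed

theorem theorem2p11:
  fixes S :: "quartic set" and \<epsilon> :: real
  assumes "GL2Z_invariant S"
    and "finitely_many_congruence_conditions S"
    and "\<epsilon> > 0"
  shows "\<exists>C. \<forall>i\<in>{0, 1, 2}. \<forall>X\<ge>1.
    \<bar>real (N_classes (S \<inter> V_Z i) X) - real (N_classes (V_Z i) X) * prod_local_densities S\<bar>
      \<le> C * X powr (3 / 4 + \<epsilon>)"
proof -
  obtain m where m: "m > 0" "congruence_condition m S" "prod_local_densities S = density_mod m S"
    using prod_local_densities_eq[OF assms(2)] by blast
  define \<delta> where "\<delta> = density_mod m S"
  have \<delta>: "0 \<le> \<delta>" "\<delta> \<le> 1"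
    unfolding \<delta>_def density_mod_def
    by (auto intro!: divide_le_eq_1[THEN iffD2] card_mono simp: finite_residues_mod divide_le_eq_1 card_gt_0_iff)
  have each: "\<exists>C\<ge>0. \<forall>X\<ge>1. \<bar>real (N_classes (S \<inter> V_Z i) X) - real (N_classes (V_Z i) X) * \<delta>\<bar> \<le> C * X powr (3/4)"
    if i: "i \<in> {0, 1, 2}" for i :: nat
  proof -
    \<comment> \<open>One constant for all invariant sets: it is applied to \<open>S\<close> and to
      \<open>UNIV\<close>.\<close>
    obtain C1 where C1: "\<And>S X. GL2Z_invariant S \<Longrightarrow> X \<ge> 1 \<Longrightarrow>
      \<bar>2 * real (N_classes (S \<inter> V_Z i) X) - real (card (S \<inter> region i X (cusp 1)))\<bar> \<le> C1 * X powr (3/4)"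
      using N_classes_region[OF i] by meson
    obtain C2 where C2: "\<And>X. X \<ge> 1 \<Longrightarrow>
      \<bar>real (card (S \<inter> region i X (cusp 1))) - \<delta> * real (card (region i X (cusp 1)))\<bar> \<le> C2 * X powr (3/4)"
      using region_equidistribution[OF assms(1) m(2,1)] unfolding \<delta>_def by meson
    have "\<bar>real (N_classes (S \<inter> V_Z i) X) - real (N_classes (V_Z i) X) * \<delta>\<bar> \<le> (\<bar>C1\<bar> + \<bar>C2\<bar>) * X powr (3/4)"
      if X: "X \<ge> 1" for X
    proof -
      define a where "a = real (N_classes (S \<inter> V_Z i) X)"
      define b where "b = real (N_classes (V_Z i) X)"
      define A where "A = real (card (S \<inter> region i X (cusp 1)))"
      define B where "B = real (card (region i X (cusp 1)))"
      define E where "E = X powr (3/4)"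
      have E: "E \<ge> 0" by (simp add: E_def)
      have inv: "GL2Z_invariant (UNIV :: quartic set)" by (simp add: GL2Z_invariant_def)
      have "\<bar>2 * a - A\<bar> \<le> C1 * E" "\<bar>2 * b - B\<bar> \<le> C1 * E" "\<bar>A - \<delta> * B\<bar> \<le> C2 * E"
        using C1[OF assms(1) X] C1[OF inv X] C2[OF X] by (simp_all add: a_def b_def A_def B_def E_def)
      moreover have "C1 * E \<le> \<bar>C1\<bar> * E" "C2 * E \<le> \<bar>C2\<bar> * E" using E by (auto intro: mult_right_mono)
      ultimately have 1: "\<bar>2 * a - A\<bar> \<le> \<bar>C1\<bar> * E" "\<bar>2 * b - B\<bar> \<le> \<bar>C1\<bar> * E" "\<bar>A - \<delta> * B\<bar> \<le> \<bar>C2\<bar> * E" by linarith+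
      have 2: "\<bar>\<delta> * (2 * b - B)\<bar> \<le> 1 * \<bar>2 * b - B\<bar>"
        unfolding abs_mult using \<delta> by (intro mult_right_mono) auto
      \<comment> \<open>A and B count forms over the same region, so
        \<open>region_equidistribution\<close> compares them directly.\<close>
      have "2 * (a - b * \<delta>) = (2 * a - A) + (A - \<delta> * B) - \<delta> * (2 * b - B)" by algebra
      then have "2 * \<bar>a - b * \<delta>\<bar> = \<bar>(2 * a - A) + (A - \<delta> * B) - \<delta> * (2 * b - B)\<bar>"
        by (metis abs_mult abs_numeral)
      also have "\<dots> \<le> \<bar>2 * a - A\<bar> + \<bar>A - \<delta> * B\<bar> + \<bar>\<delta> * (2 * b - B)\<bar>"
        by (rule order_trans[OF abs_triangle_ineq4 add_right_mono[OF abs_triangle_ineq]])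
      also have "\<dots> \<le> \<bar>C1\<bar> * E + \<bar>C2\<bar> * E + \<bar>C1\<bar> * E"
        using 1 order_trans[OF 2[unfolded mult_1] 1(2)] by (intro add_mono)
      finally have "2 * \<bar>a - b * \<delta>\<bar> \<le> \<bar>C1\<bar> * E + \<bar>C2\<bar> * E + \<bar>C1\<bar> * E" .
      moreover have "0 \<le> \<bar>C2\<bar> * E" using E by simp
      moreover have "x \<le> c + d" if "2 * x \<le> c + d + c" "0 \<le> d" for x c d :: real using that by linarith
      ultimately have "\<bar>a - b * \<delta>\<bar> \<le> \<bar>C1\<bar> * E + \<bar>C2\<bar> * E" by blast
      then show ?thesis by (simp add: a_def b_def E_def distrib_right)
    qed
    then show ?thesis by (intro exI[of _ "\<bar>C1\<bar> + \<bar>C2\<bar>"]) auto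
  qed
  then obtain C where C: "\<And>i. i \<in> {0,1,2} \<Longrightarrow> C i \<ge> 0 \<and> (\<forall>X\<ge>1.
      \<bar>real (N_classes (S \<inter> V_Z i) X) - real (N_classes (V_Z i) X) * \<delta>\<bar> \<le> C i * X powr (3/4))"
    by metis
  \<comment> \<open>As all \<open>C i\<close> are nonnegative, their sum is a common constant for
    the three values of i; the exponent may be raised by \<epsilon> because X >= 1.\<close>
  show ?thesis
  proof (intro exI[of _ "C 0 + C 1 + C 2"] ballI allI impI)
    fix i :: nat and X :: real
    assume i: "i \<in> {0, 1, 2}" and X: "X \<ge> 1"
    have le: "C i \<le> C 0 + C 1 + C 2" using i C[of 0] C[of 1] C[of 2] by auto
    have "\<bar>real (N_classes (S \<inter> V_Z i) X) - real (N_classes (V_Z i) X) * \<delta>\<bar> \<le> C i * X powr (3/4)"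
      using C[OF i] X by blast
    also have "\<dots> \<le> (C 0 + C 1 + C 2) * X powr (3/4 + \<epsilon>)"
      using le C[OF i] X assms(3) by (intro mult_mono powr_mono) auto
    finally show "\<bar>real (N_classes (S \<inter> V_Z i) X) - real (N_classes (V_Z i) X) * prod_local_densities S\<bar>
      \<le> (C 0 + C 1 + C 2) * X powr (3 / 4 + \<epsilon>)" by (simp add: m(3) \<delta>_def)
  qed
qed

end
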